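(* Let $\mathbb K$ be a commutative semiring with $0\neq1$ and let $S:\Delta^*\to K$ be a formal power series. The following are equivalent: (1) $S$ is an algebraic formal power series; (2) $S=\pi(R)$ for some regular alternating text series $R:\mathrm{TXT}(\Delta)\to K$; (3) there is a sentence $\varphi\in\mathrm{sRFO}(\mathbb K)$ over the signature of texts such that $[\![\exists\le_2.\varphi]\!]^{\mathrm{tdo}}=S$.
   Context: Texts: a text over a finite alphabet $\Delta$ is $(V,\lambda,\le_1,\le_2)$, $V$ finite nonempty, $\lambda:V\to\Delta$, two linear orders, up to isomorphism; it is the structure with unary $\mathrm{Lab}_a=\lambda^{-1}(a)$ and binary $\le_1,\le_2$. $\tau\circ\tau'$ (resp. $\tau\bullet\tau'$): disjoint union, all of $\tau$ before $\tau'$ in $\le_1$, and in $\le_2$ all of $\tau$ before $\tau'$ (resp. all of $\tau'$ before $\tau$). $\mathrm{TXT}(\Delta)$: texts generated from singletons by $\circ,\bullet$. A word $w=a_1\cdots a_n\in\Delta^+$ is identified with $([n],\le_1,\lambda)$, $\le_1$ the natural order, $\lambda(i)=a_i$. A linear order $\le_2$ on $[n]$ is tree-definable (for $w$) if $([n],\lambda,\le_1,\le_2)\in\mathrm{TXT}(\Delta)$; $\mathrm{TDO}_n$ is the set of these. Projection: $\pi(\tau)$ is the label word along $\le_1$; $\pi(R)(w)=\sum_{\tau\in\mathrm{TXT}(\Delta),\pi(\tau)=w}R(\tau)$. WPA: $\mathcal A=(H,V,\Omega,\mu,\mu_{op},\mu_{cl},\lambda,\gamma)$, $H,V$ disjoint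 finite sets, $\Omega$ finite, $\mu:(H\times\Delta\times H)\cup(V\times\Delta\times V)\to K$, $\mu_{op},\mu_{cl}:(H\times\Omega\times V)\cup(V\times\Omega\times H)\to K$, $\lambda,\gamma:H\cup V\to K$. Runs: (1) $(q_1,a,q_2)$ for $(q_1,q_2)\in(H\times H)\cup(V\times V)$, $a\in\Delta$: label $a$, weight $\mu(q_1,a,q_2)$, from $q_1$ to $q_2$; (2) if final$(r_1)=$ initial$(r_2)=q$, $r_1r_2$ is a run from initial$(r_1)$ to final$(r_2)$, weight the product, label $\mathrm{lab}(r_1)\circ\mathrm{lab}(r_2)$ if $q\in H$ and $\mathrm{lab}(r_1)\bullet\mathrm{lab}(r_2)$ if $q\in V$; (3) if $r$ is obtained by rule (2), from $p_1$ to $p_2$, $p_1\in H$ (resp. $V$), $q_1,q_2\in V$ (resp. $H$), $s\in\Omega$: $(q_1,(_s,p_1)\,r\,(p_2,)_s,q_2)$ is a run from $q_1$ to $q_2$, label $\mathrm{lab}(r)$, weight $\mu_{op}(q_1,s,p_1)\mathrm{wt}(r)\mu_{cl}(p_2,s,q_2)$. $\|\mathcal A\|(\tau)=\sum_{q_1,q_2}\lambda(q_1)\sum_r\mathrm{wt}(r)\gamma(q_2)$ over runs from $q_1$ to $q_2$ labeled $\tau$; regular series are the $\|\mathcal A\|$. Weighted logic over texts: classical formulas from $x=y$, $\mathrm{Lab}_a(x)$, $x\le_1y$, $x\le_2y$, $x\in X$ by $\vee,\neg,\exists x,\exists X$ ($x<y:=\neg(y\le_1x)$, usual abbreviations). Weighted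 formulas: constants $k\in K$, atomic formulas and negations, $\vee,\wedge,\exists x,\exists X,\forall x,\forall X$; semantics: $[\![k]\!]=k$, (negated) atomic $1$ if true else $0$, $\vee\mapsto+$, $\wedge\mapsto\cdot$, $\exists$ sums and $\forall$ multiplies over elements/subsets. For classical $\varphi$ (using $\le_1$ as the order): atomic $\varphi^+=\varphi,\varphi^-=\neg\varphi$; $(\neg\psi)^\pm=\psi^\mp$; $(\psi\vee\psi')^+=\psi^+\vee(\psi^-\wedge\psi'^+)$, $(\psi\vee\psi')^-=\psi^-\wedge\psi'^-$; $(\exists x.\psi(x))^+=\exists x.(\psi(x)^+\wedge\forall y.(y<x\wedge\psi(y))^-)$, $(\exists x.\psi)^-=\forall x.\psi^-$; $(\exists X.\psi(X))^+=\exists X.(\psi(X)^+\wedge\forall Y.(Y<X\wedge\psi(Y))^-)$, $(\exists X.\psi)^-=\forall X.\psi^-$, with $Y<X:=\exists y.(y\in X\wedge\neg y\in Y\wedge\forall z.(z<y\to(z\in X\leftrightarrow z\in Y)))$; these are syntactically unambiguous. $\mathrm{aUMSO}(\mathbb K)$: smallest set containing constants and syntactically unambiguous formulas closed under $\wedge,\vee$. $\mathrm{sRFO}(\mathbb K)$: weighted formulas without second-order quantifiers in which every subformula $\forall x.\psi$ has $\psi\in\mathrm{aUMSO}(\mathbb K)$. For a sentence $\varphi$ and $w\in\Delta^+$ of length $n$: $[\![\exists\le_2.\varphi]\!]^{\mathrm{tdo}}(w)=\sum_{\le_2\in\mathrm{TDO}_n}[\![\varphi]\!](([n],\lambda,\le_1,\le_2))$,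 and value $0$ at $\varepsilon$. Algebraic series: formal power series are maps $\Delta^*\to K$ with pointwise sum/scalar product and Cauchy product $(S_1S_2)(w)=\sum_{w=w_1w_2}S_1(w_1)S_2(w_2)$; words identified with characteristic series. For a finite variable set $\mathcal X$ disjoint from $\Delta$, a polynomial is a finitely supported map $(\Delta\cup\mathcal X)^*\to K$; an algebraic system is $(P_X)_{X\in\mathcal X}$; a solution is $(S_X)$ with $S_X=\sum(P_X,u_1X_1\cdots u_kX_ku_{k+1})u_1S_{X_1}\cdots u_kS_{X_k}u_{k+1}$ over the support of $P_X$. Proper: $P_X(Y)=P_X(\varepsilon)=0$; quasiregular: $S(\varepsilon)=0$. A proper system has exactly one quasiregular solution; algebraic series are its components for some proper system. *)

theory Defs
  imports Main
begin

text \<open>A text over the alphabet of the type variable (Delta = UNIV, the type variable finite) is represented canonically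
  (up to isomorphism) by the word w of its labels along the first order (positions
  0..<length w, first order = natural order) together with the list p enumerating
  the positions in the order of the second order.\<close>

type_synonym 'a ttext = "'a list \<times> nat list"

definition tcirc :: "'a ttext \<Rightarrow> 'a ttext \<Rightarrow> 'a ttext" where
  "tcirc t1 t2 = (fst t1 @ fst t2, snd t1 @ map (\<lambda>i. i + length (fst t1)) (snd t2))"

definition tbullet :: "'a ttext \<Rightarrow> 'a ttext \<Rightarrow> 'a ttext" where
  "tbullet t1 t2 = (fst t1 @ fst t2, map (\<lambda>i. i + length (fst t1)) (snd t2) @ snd t1)"

inductive_set TXT :: "'a ttext set" where
  sing: "([a], [0]) \<in> TXT"
| circ: "t1 \<in> TXT \<Longrightarrow> t2 \<in> TXT \<Longrightarrow> tcirc t1 t2 \<in> TXT"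
| bull: "t1 \<in> TXT \<Longrightarrow> t2 \<in> TXT \<Longrightarrow> tbullet t1 t2 \<in> TXT"

definition le2 :: "nat list \<Rightarrow> nat \<Rightarrow> nat \<Rightarrow> bool" where
  "le2 p x y \<longleftrightarrow> (\<exists>i j. i \<le> j \<and> j < length p \<and> p ! i = x \<and> p ! j = y)"

definition proj :: "('a ttext \<Rightarrow> 'k::comm_monoid_add) \<Rightarrow> 'a list \<Rightarrow> 'k" where
  "proj R w = (\<Sum>\<tau>\<in>{\<tau> \<in> TXT. fst \<tau> = w}. R \<tau>)"

record ('a, 'k) wpa =
  HS :: "nat set"
  VS :: "nat set"
  Om :: "nat set"
  mu :: "nat \<Rightarrow> 'a \<Rightarrow> nat \<Rightarrow> 'k"
  muop :: "nat \<Rightarrow> nat \<Rightarrow> nat \<Rightarrow> 'k"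
  mucl :: "nat \<Rightarrow> nat \<Rightarrow> nat \<Rightarrow> 'k"
  lam :: "nat \<Rightarrow> 'k"
  gam :: "nat \<Rightarrow> 'k"

definition wpa_wf :: "('a, 'k) wpa \<Rightarrow> bool" where
  "wpa_wf A \<longleftrightarrow> finite (HS A) \<and> finite (VS A) \<and> finite (Om A) \<and> HS A \<inter> VS A = {}"

text \<open>tokens of runs: transitions (q1,a,q2), opening (q1,(_s,p1) and closing (p2,)_s,q2)\<close>
datatype 'a tok = Tr nat 'a nat | Op nat nat nat | Cl nat nat nat

inductive wrun :: "('a, 'k) wpa \<Rightarrow> nat \<Rightarrow> 'a tok list \<Rightarrow> nat \<Rightarrow> 'a ttext \<Rightarrow> bool \<Rightarrow> bool"
  for A :: "('a, 'k) wpa" where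
  r1: "(q1 \<in> HS A \<and> q2 \<in> HS A) \<or> (q1 \<in> VS A \<and> q2 \<in> VS A) \<Longrightarrow>
       wrun A q1 [Tr q1 a q2] q2 ([a], [0]) False"
| r2: "wrun A q1 r1 q t1 b1 \<Longrightarrow> wrun A q r2 q2 t2 b2 \<Longrightarrow>
       wrun A q1 (r1 @ r2) q2 (if q \<in> HS A then tcirc t1 t2 else tbullet t1 t2) True"
| r3: "wrun A p1 r p2 t True \<Longrightarrow>
       (p1 \<in> HS A \<and> q1 \<in> VS A \<and> q2 \<in> VS A) \<or> (p1 \<in> VS A \<and> q1 \<in> HS A \<and> q2 \<in> HS A) \<Longrightarrow>
       s \<in> Om A \<Longrightarrow>
       wrun A q1 (Op q1 s p1 # r @ [Cl p2 s q2]) q2 t False"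

fun tokwt :: "('a, 'k) wpa \<Rightarrow> 'a tok \<Rightarrow> 'k" where
  "tokwt A (Tr q1 a q2) = mu A q1 a q2"
| "tokwt A (Op q1 s p1) = muop A q1 s p1"
| "tokwt A (Cl p2 s q2) = mucl A p2 s q2"

definition runwt :: "('a, 'k::comm_monoid_mult) wpa \<Rightarrow> 'a tok list \<Rightarrow> 'k" where
  "runwt A r = prod_list (map (tokwt A) r)"

definition behaviour :: "('a, 'k::comm_semiring_1) wpa \<Rightarrow> 'a ttext \<Rightarrow> 'k" where
  "behaviour A \<tau> = (\<Sum>q1\<in>HS A \<union> VS A. \<Sum>q2\<in>HS A \<union> VS A.
      lam A q1 * (\<Sum>r\<in>{r. \<exists>b. wrun A q1 r q2 \<tau> b}. runwt A r) * gam A q2)"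

text \<open>regular (alternating) text series: a series TXT -> K recognized by a WPA
  (values outside TXT are irrelevant)\<close>
definition regular_text_series :: "('a ttext \<Rightarrow> 'k::comm_semiring_1) \<Rightarrow> bool" where
  "regular_text_series R \<longleftrightarrow>
     (\<exists>A :: ('a, 'k) wpa. wpa_wf A \<and> (\<forall>\<tau>\<in>TXT. R \<tau> = behaviour A \<tau>))"

definition cauchy :: "('a list \<Rightarrow> 'k::semiring_1) \<Rightarrow> ('a list \<Rightarrow> 'k) \<Rightarrow> 'a list \<Rightarrow> 'k" where
  "cauchy S1 S2 w = (\<Sum>i\<le>length w. S1 (take i w) * S2 (drop i w))"

definition charser :: "'a list \<Rightarrow> 'a list \<Rightarrow> 'k::semiring_1" where
  "charser u w = (if w = u then 1 else 0)"

fun evalw :: "(nat \<Rightarrow> 'a list \<Rightarrow> 'k::semiring_1) \<Rightarrow> ('a + nat) list \<Rightarrow> 'a list \<Rightarrow> 'k" where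
  "evalw \<sigma> [] = charser []"
| "evalw \<sigma> (Inl a # u) = cauchy (charser [a]) (evalw \<sigma> u)"
| "evalw \<sigma> (Inr X # u) = cauchy (\<sigma> X) (evalw \<sigma> u)"

definition alg_system :: "nat set \<Rightarrow> (nat \<Rightarrow> ('a + nat) list \<Rightarrow> 'k::zero) \<Rightarrow> bool" where
  "alg_system Xs P \<longleftrightarrow> finite Xs \<and>
     (\<forall>X\<in>Xs. finite {u. P X u \<noteq> 0} \<and> (\<forall>u. P X u \<noteq> 0 \<longrightarrow> (\<forall>Y. Inr Y \<in> set u \<longrightarrow> Y \<in> Xs)))"

definition proper_system :: "nat set \<Rightarrow> (nat \<Rightarrow> ('a + nat) list \<Rightarrow> 'k::zero) \<Rightarrow> bool" where
  "proper_system Xs P \<longleftrightarrow> (\<forall>X\<in>Xs. P X [] = 0 \<and> (\<forall>Y\<in>Xs. P X [Inr Y] = 0))"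

definition is_solution ::
  "nat set \<Rightarrow> (nat \<Rightarrow> ('a + nat) list \<Rightarrow> 'k::comm_semiring_1) \<Rightarrow> (nat \<Rightarrow> 'a list \<Rightarrow> 'k) \<Rightarrow> bool" where
  "is_solution Xs P \<sigma> \<longleftrightarrow>
     (\<forall>X\<in>Xs. \<sigma> X = (\<lambda>w. \<Sum>u\<in>{u. P X u \<noteq> 0}. P X u * evalw \<sigma> u w))"

text \<open>algebraic: a component of the (unique) quasiregular solution of a proper system\<close>
definition algebraic :: "('a list \<Rightarrow> 'k::comm_semiring_1) \<Rightarrow> bool" where
  "algebraic S \<longleftrightarrow> (\<exists>Xs (P :: nat \<Rightarrow> ('a + nat) list \<Rightarrow> 'k) \<sigma> X0.
     alg_system Xs P \<and> proper_system Xs P \<and> is_solution Xs P \<sigma> \<and>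
     (\<forall>X\<in>Xs. \<sigma> X [] = 0) \<and> X0 \<in> Xs \<and> S = \<sigma> X0)"

datatype 'a atom = AEq nat nat | ALab 'a nat | ALe1 nat nat | ALe2 nat nat
  | AIn nat nat

datatype 'a mso = Atm "'a atom" | MOr "'a mso" "'a mso" | MNeg "'a mso"
  | MEx1 nat "'a mso" | MEx2 nat "'a mso"

datatype ('a, 'k) wf = WConst 'k | WAtm "'a atom" | WNAtm "'a atom"
  | WOr "('a, 'k) wf" "('a, 'k) wf" | WAnd "('a, 'k) wf" "('a, 'k) wf"
  | WEx1 nat "('a, 'k) wf" | WEx2 nat "('a, 'k) wf"
  | WAll1 nat "('a, 'k) wf" | WAll2 nat "('a, 'k) wf"

fun asem :: "'a ttext \<Rightarrow> (nat \<Rightarrow> nat) \<Rightarrow> (nat \<Rightarrow> nat set) \<Rightarrow> 'a atom \<Rightarrow> bool" where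
  "asem t f g (AEq x y) = (f x = f y)"
| "asem t f g (ALab a x) = (fst t ! f x = a)"
| "asem t f g (ALe1 x y) = (f x \<le> f y)"
| "asem t f g (ALe2 x y) = le2 (snd t) (f x) (f y)"
| "asem t f g (AIn x X) = (f x \<in> g X)"

fun wsem :: "'a ttext \<Rightarrow> (nat \<Rightarrow> nat) \<Rightarrow> (nat \<Rightarrow> nat set) \<Rightarrow> ('a, 'k::comm_semiring_1) wf \<Rightarrow> 'k" where
  "wsem t f g (WConst k) = k"
| "wsem t f g (WAtm a) = (if asem t f g a then 1 else 0)"
| "wsem t f g (WNAtm a) = (if asem t f g a then 0 else 1)"
| "wsem t f g (WOr a b) = wsem t f g a + wsem t f g b"
| "wsem t f g (WAnd a b) = wsem t f g a * wsem t f g b"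
| "wsem t f g (WEx1 x a) = (\<Sum>i<length (fst t). wsem t (f(x := i)) g a)"
| "wsem t f g (WAll1 x a) = (\<Prod>i<length (fst t). wsem t (f(x := i)) g a)"
| "wsem t f g (WEx2 X a) = (\<Sum>B\<in>Pow {..<length (fst t)}. wsem t f (g(X := B)) a)"
| "wsem t f g (WAll2 X a) = (\<Prod>B\<in>Pow {..<length (fst t)}. wsem t f (g(X := B)) a)"

fun afv1 :: "'a atom \<Rightarrow> nat set" where
  "afv1 (AEq x y) = {x, y}" | "afv1 (ALab a x) = {x}" | "afv1 (ALe1 x y) = {x, y}"
| "afv1 (ALe2 x y) = {x, y}" | "afv1 (AIn x X) = {x}"

fun afv2 :: "'a atom \<Rightarrow> nat set" where
  "afv2 (AIn x X) = {X}" | "afv2 _ = {}"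

fun wfv1 :: "('a, 'k) wf \<Rightarrow> nat set" where
  "wfv1 (WConst k) = {}" | "wfv1 (WAtm a) = afv1 a" | "wfv1 (WNAtm a) = afv1 a"
| "wfv1 (WOr a b) = wfv1 a \<union> wfv1 b" | "wfv1 (WAnd a b) = wfv1 a \<union> wfv1 b"
| "wfv1 (WEx1 x a) = wfv1 a - {x}" | "wfv1 (WAll1 x a) = wfv1 a - {x}"
| "wfv1 (WEx2 X a) = wfv1 a" | "wfv1 (WAll2 X a) = wfv1 a"

fun wfv2 :: "('a, 'k) wf \<Rightarrow> nat set" where
  "wfv2 (WConst k) = {}" | "wfv2 (WAtm a) = afv2 a" | "wfv2 (WNAtm a) = afv2 a"
| "wfv2 (WOr a b) = wfv2 a \<union> wfv2 b" | "wfv2 (WAnd a b) = wfv2 a \<union> wfv2 b"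
| "wfv2 (WEx1 x a) = wfv2 a" | "wfv2 (WAll1 x a) = wfv2 a"
| "wfv2 (WEx2 X a) = wfv2 a - {X}" | "wfv2 (WAll2 X a) = wfv2 a - {X}"

definition sentence :: "('a, 'k) wf \<Rightarrow> bool" where
  "sentence \<phi> \<longleftrightarrow> wfv1 \<phi> = {} \<and> wfv2 \<phi> = {}"

definition MAnd :: "'a mso \<Rightarrow> 'a mso \<Rightarrow> 'a mso" where
  "MAnd a b = MNeg (MOr (MNeg a) (MNeg b))"
definition MImp :: "'a mso \<Rightarrow> 'a mso \<Rightarrow> 'a mso" where
  "MImp a b = MOr (MNeg a) b"
definition MIff :: "'a mso \<Rightarrow> 'a mso \<Rightarrow> 'a mso" where
  "MIff a b = MAnd (MImp a b) (MImp b a)"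
definition MLess :: "nat \<Rightarrow> nat \<Rightarrow> 'a mso" where
  "MLess x y = MNeg (Atm (ALe1 y x))"
definition MAll1 :: "nat \<Rightarrow> 'a mso \<Rightarrow> 'a mso" where
  "MAll1 z a = MNeg (MEx1 z (MNeg a))"

text \<open>Y < X (lexicographic order on sets w.r.t. the first order), with bound
  first-order variables y = 0, z = 1\<close>
definition SLess :: "nat \<Rightarrow> nat \<Rightarrow> 'a mso" where
  "SLess Y X = MEx1 0 (MAnd (Atm (AIn 0 X)) (MAnd (MNeg (Atm (AIn 0 Y)))
      (MAll1 1 (MImp (MLess 1 0) (MIff (Atm (AIn 1 X)) (Atm (AIn 1 Y)))))))"

fun aren1 :: "nat \<Rightarrow> nat \<Rightarrow> 'a atom \<Rightarrow> 'a atom" where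
  "aren1 x y (AEq u v) = AEq (if u = x then y else u) (if v = x then y else v)"
| "aren1 x y (ALab a u) = ALab a (if u = x then y else u)"
| "aren1 x y (ALe1 u v) = ALe1 (if u = x then y else u) (if v = x then y else v)"
| "aren1 x y (ALe2 u v) = ALe2 (if u = x then y else u) (if v = x then y else v)"
| "aren1 x y (AIn u X) = AIn (if u = x then y else u) X"

fun aren2 :: "nat \<Rightarrow> nat \<Rightarrow> 'a atom \<Rightarrow> 'a atom" where
  "aren2 X Y (AIn u Z) = AIn u (if Z = X then Y else Z)"
| "aren2 X Y a = a"

fun ren1 :: "nat \<Rightarrow> nat \<Rightarrow> 'a mso \<Rightarrow> 'a mso" where
  "ren1 x y (Atm a) = Atm (aren1 x y a)"
| "ren1 x y (MOr a b) = MOr (ren1 x y a) (ren1 x y b)"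
| "ren1 x y (MNeg a) = MNeg (ren1 x y a)"
| "ren1 x y (MEx1 z a) = (if z = x then MEx1 z a else MEx1 z (ren1 x y a))"
| "ren1 x y (MEx2 Z a) = MEx2 Z (ren1 x y a)"

fun ren2 :: "nat \<Rightarrow> nat \<Rightarrow> 'a mso \<Rightarrow> 'a mso" where
  "ren2 X Y (Atm a) = Atm (aren2 X Y a)"
| "ren2 X Y (MOr a b) = MOr (ren2 X Y a) (ren2 X Y b)"
| "ren2 X Y (MNeg a) = MNeg (ren2 X Y a)"
| "ren2 X Y (MEx1 z a) = MEx1 z (ren2 X Y a)"
| "ren2 X Y (MEx2 Z a) = (if Z = X then MEx2 Z a else MEx2 Z (ren2 X Y a))"

fun abnd1 :: "'a atom \<Rightarrow> nat" where
  "abnd1 (AEq u v) = max u v" | "abnd1 (ALab a u) = u" | "abnd1 (ALe1 u v) = max u v"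
| "abnd1 (ALe2 u v) = max u v" | "abnd1 (AIn u X) = u"

fun abnd2 :: "'a atom \<Rightarrow> nat" where
  "abnd2 (AIn u X) = X" | "abnd2 _ = 0"

fun bnd1 :: "'a mso \<Rightarrow> nat" where
  "bnd1 (Atm a) = abnd1 a" | "bnd1 (MOr a b) = max (bnd1 a) (bnd1 b)"
| "bnd1 (MNeg a) = bnd1 a" | "bnd1 (MEx1 z a) = max z (bnd1 a)" | "bnd1 (MEx2 Z a) = bnd1 a"

fun bnd2 :: "'a mso \<Rightarrow> nat" where
  "bnd2 (Atm a) = abnd2 a" | "bnd2 (MOr a b) = max (bnd2 a) (bnd2 b)"
| "bnd2 (MNeg a) = bnd2 a" | "bnd2 (MEx1 z a) = bnd2 a" | "bnd2 (MEx2 Z a) = max Z (bnd2 a)"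

definition fresh1 :: "nat \<Rightarrow> 'a mso \<Rightarrow> nat" where "fresh1 x a = Suc (max x (bnd1 a))"
definition fresh2 :: "nat \<Rightarrow> 'a mso \<Rightarrow> nat" where "fresh2 X a = Suc (max X (bnd2 a))"

fun msz :: "'a mso \<Rightarrow> nat" where
  "msz (Atm a) = 1" | "msz (MOr a b) = msz a + msz b + 1" | "msz (MNeg a) = msz a + 1"
| "msz (MEx1 z a) = msz a + 20" | "msz (MEx2 Z a) = msz a + 200"

lemma msz_ren1[simp]: "msz (ren1 x y a) = msz a"
  by (induction a) auto
lemma msz_ren2[simp]: "msz (ren2 x y a) = msz a"
  by (induction a) auto

subsection \<open>Syntactically unambiguous translation: tr True = (.)^+, tr False = (.)^-\<close>

function tr :: "bool \<Rightarrow> 'a mso \<Rightarrow> ('a, 'k) wf" where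
  "tr True (Atm a) = WAtm a"
| "tr False (Atm a) = WNAtm a"
| "tr b (MNeg a) = tr (\<not> b) a"
| "tr True (MOr a c) = WOr (tr True a) (WAnd (tr False a) (tr True c))"
| "tr False (MOr a c) = WAnd (tr False a) (tr False c)"
| "tr True (MEx1 x a) = WEx1 x (WAnd (tr True a)
      (WAll1 (fresh1 x a) (tr False (MAnd (MLess (fresh1 x a) x) (ren1 x (fresh1 x a) a)))))"
| "tr False (MEx1 x a) = WAll1 x (tr False a)"
| "tr True (MEx2 X a) = WEx2 X (WAnd (tr True a)
      (WAll2 (fresh2 X a) (tr False (MAnd (SLess (fresh2 X a) X) (ren2 X (fresh2 X a) a)))))"
| "tr False (MEx2 X a) = WAll2 X (tr False a)"
  by pat_completeness auto
termination
  by (relation "measure (\<lambda>(b, a). msz a)")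
     (auto simp: MAnd_def MLess_def SLess_def MAll1_def MImp_def MIff_def)

inductive_set aUMSO :: "('a, 'k) wf set" where
  const: "WConst k \<in> aUMSO"
| unamb: "tr True \<phi> \<in> aUMSO"
| conj: "a \<in> aUMSO \<Longrightarrow> b \<in> aUMSO \<Longrightarrow> WAnd a b \<in> aUMSO"
| disj: "a \<in> aUMSO \<Longrightarrow> b \<in> aUMSO \<Longrightarrow> WOr a b \<in> aUMSO"

fun noSO :: "('a, 'k) wf \<Rightarrow> bool" where
  "noSO (WEx2 X a) = False" | "noSO (WAll2 X a) = False"
| "noSO (WOr a b) = (noSO a \<and> noSO b)" | "noSO (WAnd a b) = (noSO a \<and> noSO b)"
| "noSO (WEx1 x a) = noSO a" | "noSO (WAll1 x a) = noSO a"
| "noSO _ = True"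

fun allok :: "('a, 'k) wf \<Rightarrow> bool" where
  "allok (WAll1 x a) = (a \<in> aUMSO \<and> allok a)"
| "allok (WAll2 X a) = allok a" | "allok (WEx2 X a) = allok a"
| "allok (WOr a b) = (allok a \<and> allok b)" | "allok (WAnd a b) = (allok a \<and> allok b)"
| "allok (WEx1 x a) = allok a"
| "allok _ = True"

definition sRFO :: "('a, 'k) wf set" where
  "sRFO = {\<phi>. noSO \<phi> \<and> allok \<phi>}"

definition tdo_sem :: "('a, 'k::comm_semiring_1) wf \<Rightarrow> 'a list \<Rightarrow> 'k" where
  "tdo_sem \<phi> w = (if w = [] then 0 else
     (\<Sum>p\<in>{p. (w, p) \<in> TXT}. wsem (w, p) (\<lambda>_. 0) (\<lambda>_. {}) \<phi>))"

end

theory Submission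
  imports Defs
begin

text \<open>
  Every text of TXT is denoted by exactly one canonical term, in which no left child carries the
  operation of its parent. A function on texts that is computed by a bilinear recursion over canonical
  terms therefore projects to a series solving a quadratic, hence proper, algebraic system. Both the
  behaviour of an automaton and the semantics of a weighted first-order sentence are of this kind: for
  the latter, the first-order parts are finite congruences on terms whose leaves carry the values of
  the variables, and a universal quantifier over a step function becomes a product over the leaves
  that is computed by guessing the value of the context.

  Conversely, an automaton simulates an algebraic system by nesting one pair of parentheses per
  production. For a sentence, the algebra generated by the components of the solution is first
  enlarged, as in Greibach's normal form, to one that is closed under left derivatives. Deriving by a
  word of length \<open>j\<close> that is specific to a generator yields a grammar in which the length of the
  terminal prefix of a right-hand side determines the left-hand side. A derivation of this grammar is
  written down as a text: a production is an inner node whose first child is a node with \<open>j\<close> leaves,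
  and whose other children are letters and nested productions. Nodes and their children are first-order
  definable from the two orders, so the weight of the derivation is a product of a first-order step
  function over the positions.
\<close>


section \<open>Canonical terms of texts\<close>

text \<open>The sentence has no set quantifiers, so the only choice available to it is the second
  order over which the outer sum ranges; a derivation must be stored in that order alone. As
  \<open>K\<close> need not have subtraction or idempotent addition, each derivation must be stored
  in exactly one text: overcounting could not be corrected afterwards. An order has no room for
  names of nonterminals, but it can count, which is why the number of leaves of a first child serves
  as a name. This requires productions beginning with a prescribed number of letters, hence
  derivatives by longer words instead of the single leading letter of Greibach's form. The number 1
  would be confused with a plain letter, so the numbers start at 2. Words too short to carry their
  prefix are cut off at a bound \<open>M\<close> and restored at the end by a finite disjunction. In
  the converse direction the obstacle is the universal quantifier: a product over positions of
  arbitrary series can leave the class, but a step function has finitely many values, which keeps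
  the set of possible context weights finite.\<close>

datatype 'a trm = Lf 'a | Nd bool "'a trm" "'a trm"

primrec word_of :: "'a trm \<Rightarrow> 'a list" where
  "word_of (Lf a) = [a]"
| "word_of (Nd b s t) = word_of s @ word_of t"

abbreviation len :: "'a trm \<Rightarrow> nat" where "len s \<equiv> length (word_of s)"

definition comb :: "bool \<Rightarrow> 'a ttext \<Rightarrow> 'a ttext \<Rightarrow> 'a ttext" where
  "comb b t1 t2 = (if b then tcirc t1 t2 else tbullet t1 t2)"

primrec text_of :: "'a trm \<Rightarrow> 'a ttext" where
  "text_of (Lf a) = ([a], [0])"
| "text_of (Nd b s t) = comb b (text_of s) (text_of t)"

primrec root_op :: "'a trm \<Rightarrow> bool option" where
  "root_op (Lf a) = None"
| "root_op (Nd b s t) = Some b"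

primrec canon :: "'a trm \<Rightarrow> bool" where
  "canon (Lf a) = True"
| "canon (Nd b s t) = (root_op s \<noteq> Some b \<and> canon s \<and> canon t)"

lemma len_pos [simp]: "word_of s \<noteq> []" "0 < len s" "Suc 0 \<le> len s"
proof -
  show *: "word_of s \<noteq> []" by (induction s) auto
  show "0 < len s" using * by simp
  then show "Suc 0 \<le> len s" by linarith
qed

lemma fst_tx [simp]: "fst (text_of s) = word_of s"
  by (induction s) (auto simp: comb_def tcirc_def tbullet_def)

lemma snd_tx_Nd: "snd (text_of (Nd b s t)) =
   (if b then snd (text_of s) @ map (\<lambda>i. i + len s) (snd (text_of t))
    else map (\<lambda>i. i + len s) (snd (text_of t)) @ snd (text_of s))"
  by (simp add: comb_def tcirc_def tbullet_def)

lemma set_snd_tx: "set (snd (text_of s)) = {..<len s}"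
proof (induction s)
  case (Nd b s t)
  have "(\<lambda>i. i + len s) ` {..<len t} = {len s..<len s + len t}"
    by (simp add: lessThan_atLeast0 add.commute)
  then show ?case using Nd by (auto simp: snd_tx_Nd simp del: text_of.simps)
qed auto

lemma comb_assoc: "comb b (comb b t1 t2) t3 = comb b t1 (comb b t2 t3)"
  by (auto simp: comb_def tcirc_def tbullet_def o_def add.assoc add.commute)

text \<open>By associativity \<open>t\<close> sinks along the right spine of \<open>s\<close>: while
  the root of \<open>s\<close> carries \<open>b\<close>, its left child stays in place and its right
  child is combined with \<open>t\<close>. A root with the other operation, or a leaf, makes
  \<open>s\<close> itself an admissible left child.\<close>

lemma canon_comb:
  assumes "canon s" "canon t"
  shows "\<exists>u. canon u \<and> root_op u = Some b \<and> text_of u = comb b (text_of s) (text_of t)"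
  using assms
proof (induction s arbitrary: t)
  case (Lf a)
  then show ?case by (intro exI[of _ "Nd b (Lf a) t"]) auto
next
  case (Nd b' s1 s2)
  show ?case
  proof (cases "b' = b")
    case True
    from Nd obtain u where u: "canon u" "text_of u = comb b (text_of s2) (text_of t)" by (metis canon.simps(2))
    show ?thesis using Nd u True
      by (intro exI[of _ "Nd b s1 u"]) (auto simp: comb_assoc)
  next
    case False
    then show ?thesis using Nd.prems by (intro exI[of _ "Nd b (Nd b' s1 s2) t"]) auto
  qed
qed

lemma TXT_eq: "TXT = text_of ` {s. canon s}"
proof (intro set_eqI iffI)
  fix \<tau> :: "'a ttext" assume "\<tau> \<in> TXT"
  then show "\<tau> \<in> text_of ` {s. canon s}"
  proof induction
    case (sing a)
    show ?case by (rule image_eqI[of _ _ "Lf a"]) auto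
  next
    case (circ t1 t2)
    then obtain s t where st: "canon s" "canon t" "t1 = text_of s" "t2 = text_of t" by auto
    from canon_comb[OF this(1,2), of True] st show ?case by (force simp: comb_def)
  next
    case (bull t1 t2)
    then obtain s t where st: "canon s" "canon t" "t1 = text_of s" "t2 = text_of t" by auto
    from canon_comb[OF this(1,2), of False] st show ?case by (force simp: comb_def)
  qed
next
  have "text_of s \<in> TXT" for s :: "'a trm"
    by (induction s) (auto simp: comb_def intro: TXT.intros)
  then show "\<tau> \<in> TXT" if "\<tau> \<in> text_of ` {s. canon s}" for \<tau> :: "'a ttext"
    using that by auto
qed

section \<open>Uniqueness of the canonical term of a text\<close>

text \<open>For positions x < y: whether the lowest common ancestor of x and y is a \<open>\<circ>\<close>-node.\<close>

primrec opat :: "'a trm \<Rightarrow> nat \<Rightarrow> nat \<Rightarrow> bool" where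
  "opat (Lf a) x y = True"
| "opat (Nd b s t) x y = (if y < len s then opat s x y
     else if x < len s then b else opat t (x - len s) (y - len s))"

lemma le2_append: "le2 (p @ q) x y \<longleftrightarrow> le2 p x y \<or> le2 q x y \<or> (x \<in> set p \<and> y \<in> set q)"
proof
  assume "le2 (p @ q) x y"
  then obtain i j where ij: "i \<le> j" "j < length p + length q" "(p @ q) ! i = x" "(p @ q) ! j = y"
    by (auto simp: le2_def)
  consider "j < length p" | "i < length p" "\<not> j < length p" | "\<not> i < length p" by linarith
  then show "le2 p x y \<or> le2 q x y \<or> (x \<in> set p \<and> y \<in> set q)"
  proof cases
    case 1
    then show ?thesis using ij by (auto simp: le2_def nth_append)
  next
    case 2
    then show ?thesis using ij by (auto simp: nth_append)
  next
    case 3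
    then have "le2 q x y" unfolding le2_def using ij
      by (intro exI[of _ "i - length p"] exI[of _ "j - length p"]) (auto simp: nth_append)
    then show ?thesis by simp
  qed
next
  assume "le2 p x y \<or> le2 q x y \<or> (x \<in> set p \<and> y \<in> set q)"
  then consider "le2 p x y" | "le2 q x y" | "x \<in> set p" "y \<in> set q" by blast
  then show "le2 (p @ q) x y"
  proof cases
    case 1
    then obtain i j where "i \<le> j" "j < length p" "p ! i = x" "p ! j = y" by (auto simp: le2_def)
    then show ?thesis unfolding le2_def
      by (intro exI[of _ i] exI[of _ j]) (auto simp: nth_append)
  next
    case 2
    then obtain i j where "i \<le> j" "j < length q" "q ! i = x" "q ! j = y" by (auto simp: le2_def)
    then show ?thesis unfolding le2_def
      by (intro exI[of _ "length p + i"] exI[of _ "length p + j"]) (auto simp: nth_append)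
  next
    case 3
    then obtain i j where "i < length p" "p ! i = x" "j < length q" "q ! j = y"
      by (auto simp: in_set_conv_nth)
    then show ?thesis unfolding le2_def
      by (intro exI[of _ i] exI[of _ "length p + j"]) (auto simp: nth_append)
  qed
qed

lemma le2_in: "le2 p x y \<Longrightarrow> x \<in> set p \<and> y \<in> set p"
  by (auto simp: le2_def)

lemma le2_map_add: "le2 (map (\<lambda>i. i + n) p) x y \<longleftrightarrow> n \<le> x \<and> n \<le> y \<and> le2 p (x - n) (y - n)"
proof
  assume "le2 (map (\<lambda>i. i + n) p) x y"
  then show "n \<le> x \<and> n \<le> y \<and> le2 p (x - n) (y - n)"
    by (fastforce simp: le2_def)
next
  assume "n \<le> x \<and> n \<le> y \<and> le2 p (x - n) (y - n)"
  then obtain i j where "i \<le> j" "j < length p" "p ! i + n = x" "p ! j + n = y"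
    by (auto simp: le2_def)
  then show "le2 (map (\<lambda>i. i + n) p) x y"
    unfolding le2_def by (intro exI[of _ i] exI[of _ j]) auto
qed

lemma le2_Nd: "le2 (snd (text_of (Nd b s t))) x y \<longleftrightarrow>
   le2 (snd (text_of s)) x y \<or> (len s \<le> x \<and> len s \<le> y \<and> le2 (snd (text_of t)) (x - len s) (y - len s))
   \<or> (x < len s \<and> len s \<le> y \<and> y < len s + len t \<and> b)
   \<or> (y < len s \<and> len s \<le> x \<and> x < len s + len t \<and> \<not> b)"
proof -
  have "(\<lambda>i. i + len s) ` {..<len t} = {len s..<len s + len t}"
    by (simp add: lessThan_atLeast0 add.commute)
  then show ?thesis
    by (auto simp: snd_tx_Nd le2_append le2_map_add set_snd_tx simp del: text_of.simps)
qed

text \<open>A circ-node keeps its two blocks in the first order and a bullet-node swaps them, so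
  agreement of the two orders on a pair reveals the operation at its lowest common ancestor.\<close>

lemma le2_tx: "x < len s \<Longrightarrow> y < len s \<Longrightarrow>
   le2 (snd (text_of s)) x y = (x = y \<or> (if x < y then opat s x y else \<not> opat s y x))"
proof (induction s arbitrary: x y)
  case (Lf a)
  then show ?case by (auto simp: le2_def)
next
  case (Nd b s t)
  have *: "le2 (snd (text_of s)) x y \<Longrightarrow> x < len s \<and> y < len s"
    by (metis le2_in lessThan_iff set_snd_tx)
  have "x < len s \<Longrightarrow> y < len s \<Longrightarrow> ?case"
    using Nd.IH(1)[of x y] unfolding le2_Nd by auto
  moreover have "\<not> x < len s \<Longrightarrow> \<not> y < len s \<Longrightarrow> ?case"
    using Nd.IH(2)[of "x - len s" "y - len s"] Nd.prems * unfolding le2_Nd by auto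
  moreover have "x < len s \<Longrightarrow> \<not> y < len s \<Longrightarrow> ?case"
    using Nd.prems * unfolding le2_Nd by auto
  moreover have "\<not> x < len s \<Longrightarrow> y < len s \<Longrightarrow> ?case"
    using Nd.prems * unfolding le2_Nd by auto
  ultimately show ?case by blast
qed

text \<open>The outermost positions lie in different children of the root, so comparing them
  recovers the root operation.\<close>

lemma opat_ends: "opat (Nd b s t) 0 (len s + len t - 1) = b"
  "len s \<le> y \<Longrightarrow> opat (Nd b s t) 0 y = b"
  using len_pos(3)[of t] len_pos(3)[of s] by (auto simp del: len_pos)

text \<open>The root operation is visible at the two ends. If the left children had different
  lengths, the first and last positions of the longer one would be separated by the root of the
  other term; its own root operation would then be \<open>b\<close>, against canonicity. With equal
  lengths the children are compared recursively.\<close>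

lemma canon_eqI:
  assumes "canon s" "canon t" "word_of s = word_of t"
    and "\<And>x y. x < y \<Longrightarrow> y < len s \<Longrightarrow> opat s x y = opat t x y"
  shows "s = t"
  using assms
proof (induction s arbitrary: t)
  case (Lf a)
  show ?case
  proof (cases t)
    case (Nd b u v)
    then have "length [a] = len u + len v" using Lf by (metis length_append word_of.simps)
    then show ?thesis using len_pos(2)[of u] len_pos(2)[of v] by (simp del: len_pos)
  qed (use Lf in auto)
next
  case (Nd b s1 s2)
  note 1 = len_pos(2)[of s1] and 2 = len_pos(2)[of s2]
  then obtain b' t1 t2 where t: "t = Nd b' t1 t2"
    using Nd.prems(3) by (cases t) (auto simp: append_eq_Cons_conv)
  note 3 = len_pos(2)[of t1] and 4 = len_pos(2)[of t2]
  have l: "len s1 + len s2 = len t1 + len t2"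
    using Nd.prems(3) t by (metis length_append word_of.simps(2))
  have b: "b' = b"
    using Nd.prems(4)[of 0 "len s1 + len s2 - 1"] opat_ends(1)[of b s1 s2] opat_ends(1)[of b' t1 t2] l 1 2
    by (simp add: t del: opat.simps len_pos)
  have leq: "len s1 = len t1"
  proof (rule linorder_cases)
    assume lt: "len s1 < len t1"
    then obtain c u v where t1: "t1 = Nd c u v" using 1 by (cases t1) auto
    have "opat (Nd b s1 s2) 0 (len t1 - 1) = b" using lt 1 by auto
    moreover have "opat (Nd b s1 s2) 0 (len t1 - 1) = opat t 0 (len t1 - 1)"
    proof (rule Nd.prems(4))
      show "0 < len t1 - 1" using lt 1 l 4 by linarith
      show "len t1 - 1 < len (Nd b s1 s2)" unfolding word_of.simps length_append using lt 1 l 4 by linarith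
    qed
    moreover have "opat t 0 (len t1 - 1) = c"
      using 3 opat_ends(1)[of c u v] by (simp add: t t1)
    ultimately show ?thesis using Nd.prems(2) t t1 b by auto
  next
    assume lt: "len t1 < len s1"
    then obtain c u v where s1: "s1 = Nd c u v" using 3 by (cases s1) auto
    have "opat t 0 (len s1 - 1) = b" using lt 3 t b by auto
    moreover have "opat (Nd b s1 s2) 0 (len s1 - 1) = opat t 0 (len s1 - 1)"
    proof (rule Nd.prems(4))
      show "0 < len s1 - 1" using lt 3 l 2 by linarith
      show "len s1 - 1 < len (Nd b s1 s2)" unfolding word_of.simps length_append using lt 3 l 2 by linarith
    qed
    moreover have "opat (Nd b s1 s2) 0 (len s1 - 1) = c"
      using 1 opat_ends(1)[of c u v] by (simp add: s1)
    ultimately show ?thesis using Nd.prems(1) s1 b by auto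
  qed
  have w: "word_of s1 = word_of t1" "word_of s2 = word_of t2"
    using Nd.prems(3) t leq by auto
  have "s1 = t1"
  proof (rule Nd.IH(1))
    fix x y assume "x < y" "y < len s1"
    then show "opat s1 x y = opat t1 x y" using Nd.prems(4)[of x y] t leq by auto
  qed (use Nd.prems t w in auto)
  moreover have "s2 = t2"
  proof (rule Nd.IH(2))
    fix x y assume "x < y" "y < len s2"
    then show "opat s2 x y = opat t2 x y"
      using Nd.prems(4)[of "x + len s1" "y + len s1"] t leq by auto
  qed (use Nd.prems t w in auto)
  ultimately show ?case using t b by simp
qed

lemma inj_on_tx: "inj_on text_of {s. canon s}"
proof (rule inj_onI)
  fix s t :: "'a trm" assume st: "s \<in> {s. canon s}" "t \<in> {s. canon s}" "text_of s = text_of t"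
  have w: "word_of s = word_of t" using arg_cong[OF st(3), of fst] by simp
  show "s = t"
  proof (rule canon_eqI)
    fix x y assume "x < y" "y < len s"
    then show "opat s x y = opat t x y"
      using le2_tx[of x s y] le2_tx[of x t y] st(3) w by auto
  qed (use st w in auto)
qed

section \<open>Sums over texts as sums over canonical terms\<close>

definition canon_terms :: "'a list \<Rightarrow> 'a trm set" where
  "canon_terms w = {s. canon s \<and> word_of s = w}"

lemma finite_wd: "finite {s. word_of s = w}"
proof (induction w rule: length_induct)
  case (1 w)
  have "{s. word_of s = w} \<subseteq> Lf ` set w \<union>
     (\<Union>i\<in>{1..<length w}. \<Union>b. (\<lambda>(s, t). Nd b s t) `
        ({s. word_of s = take i w} \<times> {s. word_of s = drop i w}))" (is "_ \<subseteq> ?R")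
  proof
    fix s assume "s \<in> {s. word_of s = w}"
    then have s: "word_of s = w" by simp
    show "s \<in> ?R"
    proof (cases s)
      case (Lf a)
      then show ?thesis using s by auto
    next
      case (Nd b u v)
      then have *: "word_of u = take (len u) w" "word_of v = drop (len u) w" "len u \<in> {1..<length w}"
        using s len_pos[of u] len_pos[of v] by (auto simp del: len_pos)
      have "s \<in> (\<lambda>(s, t). Nd b s t) `
          ({s. word_of s = take (len u) w} \<times> {s. word_of s = drop (len u) w})"
        using *(1,2) Nd by (intro image_eqI[of _ _ "(u, v)"]) simp_all
      then show ?thesis using *(3) by blast
    qed
  qed
  moreover have "finite ?R"
  proof -
    have "finite {s. word_of s = take i w}" "finite {s. word_of s = drop i w}" if "i \<in> {1..<length w}" for i
      using 1 that by auto
    then show ?thesis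
      by (intro finite_UnI finite_UN_I finite_imageI finite_cartesian_product) simp_all
  qed
  ultimately show ?case by (rule finite_subset)
qed

lemma finite_CT [simp]: "finite (canon_terms w)"
  unfolding canon_terms_def by (rule finite_subset[OF _ finite_wd[of w]]) auto

lemma CT_Nil [simp]: "canon_terms [] = {}"
  by (auto simp: canon_terms_def)

lemma sum_TXT: "(\<Sum>\<tau>\<in>{\<tau> \<in> TXT. fst \<tau> = w}. R \<tau>) = (\<Sum>s\<in>canon_terms w. R (text_of s))"
proof -
  have "{\<tau> \<in> TXT. fst \<tau> = w} = text_of ` canon_terms w"
    by (auto simp: TXT_eq canon_terms_def)
  moreover have "inj_on text_of (canon_terms w)"
    by (rule inj_on_subset[OF inj_on_tx]) (auto simp: canon_terms_def)
  ultimately show ?thesis by (simp add: sum.reindex)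
qed

lemma tdo_sem_CT: "tdo_sem \<phi> w = (\<Sum>s\<in>canon_terms w. wsem (text_of s) (\<lambda>_. 0) (\<lambda>_. {}) \<phi>)"
proof (cases "w = []")
  case False
  have "(\<Sum>p\<in>{p. (w, p) \<in> TXT}. wsem (w, p) (\<lambda>_. 0) (\<lambda>_. {}) \<phi>) =
    (\<Sum>\<tau>\<in>{\<tau> \<in> TXT. fst \<tau> = w}. wsem \<tau> (\<lambda>_. 0) (\<lambda>_. {}) \<phi>)"
    by (rule sum.reindex_bij_witness[of _ snd "\<lambda>p. (w, p)"]) auto
  then show ?thesis using False by (simp add: tdo_sem_def sum_TXT)
qed (simp add: tdo_sem_def)

text \<open>The index \<open>i\<close> is the length of the left child, which must not repeat the
  operation \<open>b\<close>. The values 0 and \<open>length w\<close> contribute empty sums,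
  because no term has an empty word; they are kept so that the range is that of the Cauchy
  product.\<close>

lemma sum_CT_Nd:
  fixes h :: "'a trm \<Rightarrow> 'a trm \<Rightarrow> 'k::comm_monoid_add"
  shows "(\<Sum>s\<in>{s \<in> canon_terms w. root_op s = Some b}. case s of Nd _ s1 s2 \<Rightarrow> h s1 s2 | _ \<Rightarrow> 0) =
    (\<Sum>i\<le>length w. \<Sum>s1\<in>{s \<in> canon_terms (take i w). root_op s \<noteq> Some b}. \<Sum>s2\<in>canon_terms (drop i w). h s1 s2)"
proof -
  have "(\<Sum>i\<le>length w. \<Sum>s1\<in>{s \<in> canon_terms (take i w). root_op s \<noteq> Some b}. \<Sum>s2\<in>canon_terms (drop i w). h s1 s2) =
    (\<Sum>i\<le>length w. \<Sum>p\<in>{s \<in> canon_terms (take i w). root_op s \<noteq> Some b} \<times> canon_terms (drop i w). h (fst p) (snd p))"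
    by (simp only: sum.cartesian_product split_def)
  also have "\<dots> = (\<Sum>q\<in>(SIGMA i:{..length w}. {s \<in> canon_terms (take i w). root_op s \<noteq> Some b} \<times> canon_terms (drop i w)).
      h (fst (snd q)) (snd (snd q)))"
    by (subst sum.Sigma) (simp_all add: split_def)
  also have "\<dots> = (\<Sum>s\<in>{s \<in> canon_terms w. root_op s = Some b}. case s of Nd _ s1 s2 \<Rightarrow> h s1 s2 | _ \<Rightarrow> 0)"
    by (rule sum.reindex_bij_witness[of _ "\<lambda>s. case s of Nd _ s1 s2 \<Rightarrow> (len s1, s1, s2)"
       "\<lambda>(i, s1, s2). Nd b s1 s2"]) (auto simp: canon_terms_def split: trm.splits)
  finally show ?thesis by simp
qed

section \<open>Bilinear recursions over canonical terms\<close>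

lemma sum_rotate_left: "(\<Sum>a\<in>A. \<Sum>b\<in>B. \<Sum>c\<in>C. F a b c) = (\<Sum>c\<in>C. \<Sum>a\<in>A. \<Sum>b\<in>B. F a b c)"
  by (simp only: sum.swap[where A = B and B = C] sum.swap[where A = A and B = C])

lemma sum_rotate_right: "(\<Sum>a\<in>A. \<Sum>b\<in>B. \<Sum>c\<in>C. F a b c) = (\<Sum>b\<in>B. \<Sum>c\<in>C. \<Sum>a\<in>A. F a b c)"
  by (simp only: sum.swap[where A = A and B = B] sum.swap[where A = A and B = C])

lemma cauchy_char_Nil [simp]: "cauchy S (charser []) = S"
proof
  fix w
  have "cauchy S (charser []) w = (\<Sum>i\<le>length w. if i = length w then S w else 0)"
    unfolding cauchy_def charser_def by (rule sum.cong) auto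
  then show "cauchy S (charser []) w = S w" by simp
qed

lemma evalw_pair [simp]: "evalw \<sigma> [Inr Y, Inr Z] = cauchy (\<sigma> Y) (\<sigma> Z)"
  by simp

text \<open>Right-hand sides consist of one letter or of two variables, so the system is proper, and
  the given family is itself a quasiregular solution. The maps \<open>e\<close> and \<open>d\<close>
  code an arbitrary finite index set by natural numbers.\<close>

lemma quad_algebraic:
  fixes N :: "'i \<Rightarrow> 'a::finite list \<Rightarrow> 'k::comm_semiring_1"
  assumes fin: "finite I" and i0: "i0 \<in> I" and nil: "\<And>i. i \<in> I \<Longrightarrow> N i [] = 0"
    and eq: "\<And>i w. i \<in> I \<Longrightarrow> N i w = (if length w = 1 then l i (hd w) else 0) +
       (\<Sum>j\<in>I. \<Sum>k\<in>I. c i j k * cauchy (N j) (N k) w)"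
  shows "algebraic (N i0)"
proof -
  obtain e :: "'i \<Rightarrow> nat" where e: "inj_on e I"
    using finite_imp_inj_to_nat_seg[OF fin] by auto
  define d where "d = inv_into I e"
  have d [simp]: "d (e i) = i" if "i \<in> I" for i
    using that e by (simp add: d_def)
  define P :: "nat \<Rightarrow> ('a + nat) list \<Rightarrow> 'k" where
    "P X u = (case u of [Inl a] \<Rightarrow> l (d X) a
       | [Inr Y, Inr Z] \<Rightarrow> (if Y \<in> e ` I \<and> Z \<in> e ` I then c (d X) (d Y) (d Z) else 0)
       | _ \<Rightarrow> 0)" for X u
  define U :: "('a + nat) list set" where
    "U = (\<lambda>a. [Inl a]) ` UNIV \<union> (\<lambda>(j, k). [Inr (e j), Inr (e k)]) ` (I \<times> I)"
  have finU: "finite U" unfolding U_def using fin by simp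
  have P0: "P X u = 0" if "u \<notin> U" for X u
    using that by (fastforce simp: P_def U_def split: list.splits sum.splits)
  then have sub: "{u. P X u \<noteq> 0} \<subseteq> U" for X by blast
  have "is_solution (e ` I) P (\<lambda>X. N (d X))"
    unfolding is_solution_def
  proof (intro ballI ext)
    fix X w assume "X \<in> e ` I"
    then obtain i where i: "i \<in> I" "X = e i" by auto
    let ?ev = "\<lambda>u. P X u * evalw (\<lambda>X. N (d X)) u w"
    have "(\<Sum>u\<in>{u. P X u \<noteq> 0}. ?ev u) = (\<Sum>u\<in>U. ?ev u)"
      by (rule sum.mono_neutral_left[OF finU sub]) auto
    also have "\<dots> = (\<Sum>u\<in>(\<lambda>a. [Inl a]) ` UNIV. ?ev u) +
       (\<Sum>u\<in>(\<lambda>(j, k). [Inr (e j), Inr (e k)]) ` (I \<times> I). ?ev u)"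
      unfolding U_def using fin by (intro sum.union_disjoint) auto
    also have "(\<Sum>u\<in>(\<lambda>a. [Inl a]) ` UNIV. ?ev u) = (\<Sum>a\<in>UNIV. l i a * charser [a] w)"
      using i by (subst sum.reindex) (auto simp: inj_on_def P_def)
    also have "\<dots> = (if length w = 1 then l i (hd w) else 0)"
    proof (cases "length w = 1")
      case True
      then obtain a where w: "w = [a]" by (auto simp: length_Suc_conv)
      have "(\<Sum>b\<in>UNIV. l i b * charser [b] w) = (\<Sum>b\<in>UNIV. if b = a then l i b else 0)"
        unfolding w charser_def by (rule sum.cong) auto
      then show ?thesis using w by simp
    qed (auto simp: charser_def intro!: sum.neutral)
    also have "(\<Sum>u\<in>(\<lambda>(j, k). [Inr (e j), Inr (e k)]) ` (I \<times> I). ?ev u) =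
       (\<Sum>(j, k)\<in>I \<times> I. c i j k * cauchy (N j) (N k) w)"
      using i e by (subst sum.reindex) (auto simp: inj_on_def P_def intro!: sum.cong)
    also have "\<dots> = (\<Sum>j\<in>I. \<Sum>k\<in>I. c i j k * cauchy (N j) (N k) w)"
      by (simp add: sum.cartesian_product)
    finally show "N (d X) w = (\<Sum>u\<in>{u. P X u \<noteq> 0}. ?ev u)"
      using eq[OF i(1), of w] i by simp
  qed
  moreover have "alg_system (e ` I) P"
    unfolding alg_system_def
  proof (intro conjI ballI allI impI)
    fix X u Y assume "P X u \<noteq> 0" "Inr Y \<in> set u"
    then have "u \<in> U" using P0 by blast
    then show "Y \<in> e ` I" using \<open>Inr Y \<in> set u\<close> by (auto simp: U_def)
  qed (use fin finite_subset[OF sub finU] in auto)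
  moreover have "proper_system (e ` I) P"
    by (auto simp: proper_system_def P_def)
  ultimately show ?thesis
    unfolding algebraic_def using i0 nil
    by (intro exI[of _ "e ` I"] exI[of _ P] exI[of _ "\<lambda>X. N (d X)"] exI[of _ "e i0"]) auto
qed

text \<open>A new variable whose right-hand side is a combination of single variables would violate
  properness. Instead the index \<open>None\<close> receives the same combination of the right-hand
  sides of the old variables, which is again quadratic.\<close>

lemma quad_algebraic_lincomb:
  fixes N :: "'i \<Rightarrow> 'a::finite list \<Rightarrow> 'k::comm_semiring_1"
  assumes fin: "finite I" and nil: "\<And>i. i \<in> I \<Longrightarrow> N i [] = 0"
    and eq: "\<And>i w. i \<in> I \<Longrightarrow> N i w = (if length w = 1 then l i (hd w) else 0) +
       (\<Sum>j\<in>I. \<Sum>k\<in>I. c i j k * cauchy (N j) (N k) w)"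
  shows "algebraic (\<lambda>w. \<Sum>i\<in>I. m i * N i w)"
proof -
  define N' where "N' o' = (case o' of Some i \<Rightarrow> N i | None \<Rightarrow> (\<lambda>w. \<Sum>i\<in>I. m i * N i w))" for o'
  define l' where "l' o' a = (case o' of Some i \<Rightarrow> l i a | None \<Rightarrow> (\<Sum>i\<in>I. m i * l i a))" for o' a
  define c' where "c' o' p q = (case (p, q) of (Some j, Some k) \<Rightarrow>
     (case o' of Some i \<Rightarrow> c i j k | None \<Rightarrow> (\<Sum>i\<in>I. m i * c i j k)) | _ \<Rightarrow> 0)" for o' p q
  have "algebraic (N' None)"
  proof (rule quad_algebraic[where I = "insert None (Some ` I)" and l = l' and c = c'])
    fix o' w assume o': "o' \<in> insert None (Some ` I)"
    have "(\<Sum>j\<in>insert None (Some ` I). \<Sum>k\<in>insert None (Some ` I). c' o' j k * cauchy (N' j) (N' k) w) =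
       (\<Sum>j\<in>I. \<Sum>k\<in>I. c' o' (Some j) (Some k) * cauchy (N j) (N k) w)"
      using fin by (auto simp: sum.reindex c'_def N'_def)
    also have "(if length w = 1 then l' o' (hd w) else 0) + \<dots> = N' o' w"
    proof (cases o')
      case None
      have "N' None w = (\<Sum>i\<in>I. m i * ((if length w = 1 then l i (hd w) else 0) +
          (\<Sum>j\<in>I. \<Sum>k\<in>I. c i j k * cauchy (N j) (N k) w)))"
        unfolding N'_def using eq by simp
      also have "\<dots> = (if length w = 1 then l' None (hd w) else 0) +
         (\<Sum>i\<in>I. \<Sum>j\<in>I. \<Sum>k\<in>I. m i * c i j k * cauchy (N j) (N k) w)"
        by (simp add: distrib_left sum.distrib sum_distrib_left l'_def mult.assoc)
      also have "(\<Sum>i\<in>I. \<Sum>j\<in>I. \<Sum>k\<in>I. m i * c i j k * cauchy (N j) (N k) w) =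
         (\<Sum>j\<in>I. \<Sum>k\<in>I. \<Sum>i\<in>I. m i * c i j k * cauchy (N j) (N k) w)"
        by (rule sum_rotate_right)
      finally show ?thesis using None by (simp add: c'_def sum_distrib_right)
    next
      case (Some i)
      then show ?thesis using eq[of i w] o' by (auto simp: N'_def l'_def c'_def)
    qed
    finally show "N' o' w = (if length w = 1 then l' o' (hd w) else 0) +
      (\<Sum>j\<in>insert None (Some ` I). \<Sum>k\<in>insert None (Some ` I). c' o' j k * cauchy (N' j) (N' k) w)"
      by simp
  qed (use fin nil in \<open>auto simp: N'_def\<close>)
  then show ?thesis by (simp add: N'_def)
qed

text \<open>Canonicity has to be enforced by the system itself. For this a variable carries, besides
  the component \<open>i\<close>, the root operation that is forbidden to its terms:
  \<open>Some b\<close> for a left child of a \<open>b\<close>-node, \<open>None\<close> where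
  nothing is forbidden.\<close>

lemma bilinear_algebraic:
  fixes V :: "'a::finite trm \<Rightarrow> 'i \<Rightarrow> 'k::comm_semiring_1"
  assumes fin: "finite I"
    and rec: "\<And>b s t i. i \<in> I \<Longrightarrow> canon (Nd b s t) \<Longrightarrow>
       V (Nd b s t) i = (\<Sum>j\<in>I. \<Sum>k\<in>I. c b i j k * (V s j * V t k))"
  shows "algebraic (\<lambda>w. \<Sum>s\<in>canon_terms w. \<Sum>i\<in>I. m i * V s i)"
proof -
  define N where "N p w = (\<Sum>s\<in>{s \<in> canon_terms w. fst p = None \<or> root_op s \<noteq> fst p}. V s (snd p))"
    for p :: "bool option \<times> 'i" and w
  \<comment> \<open>Sums over the root operations \<open>b\<close> still allowed at
    \<open>p\<close>; the left factor then forbids \<open>b\<close> and the right factor forbids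
    nothing.\<close>
  define c' where "c' p q r = (\<Sum>b\<in>{b. fst p \<noteq> Some b}.
      if fst q = Some b \<and> fst r = None then c b (snd p) (snd q) (snd r) else 0)"
    for p q r :: "bool option \<times> 'i"
  define I' where "I' = (UNIV :: bool option set) \<times> I"
  have finI': "finite I'" unfolding I'_def using fin by simp
  have node: "(\<Sum>s\<in>{s \<in> canon_terms w. root_op s = Some b}. V s i) =
     (\<Sum>j\<in>I. \<Sum>k\<in>I. c b i j k * cauchy (N (Some b, j)) (N (None, k)) w)" if i: "i \<in> I" for i w b
  proof -
    have "(\<Sum>s\<in>{s \<in> canon_terms w. root_op s = Some b}. V s i) =
      (\<Sum>s\<in>{s \<in> canon_terms w. root_op s = Some b}. case s of Nd _ s1 s2 \<Rightarrow>
         (\<Sum>j\<in>I. \<Sum>k\<in>I. c b i j k * (V s1 j * V s2 k)) | _ \<Rightarrow> 0)"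
      using rec i by (intro sum.cong) (auto simp: canon_terms_def split: trm.splits)
    also have "\<dots> = (\<Sum>n\<le>length w. \<Sum>s1\<in>{s \<in> canon_terms (take n w). root_op s \<noteq> Some b}. \<Sum>s2\<in>canon_terms (drop n w).
       \<Sum>j\<in>I. \<Sum>k\<in>I. c b i j k * (V s1 j * V s2 k))"
      by (rule sum_CT_Nd)
    also have "\<dots> = (\<Sum>n\<le>length w. \<Sum>j\<in>I. \<Sum>k\<in>I. c b i j k *
        (N (Some b, j) (take n w) * N (None, k) (drop n w)))"
    proof (rule sum.cong[OF refl])
      fix n
      let ?A = "{s \<in> canon_terms (take n w). root_op s \<noteq> Some b}" and ?B = "canon_terms (drop n w)"
      have "(\<Sum>s1\<in>?A. \<Sum>s2\<in>?B. \<Sum>j\<in>I. \<Sum>k\<in>I. c b i j k * (V s1 j * V s2 k)) =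
        (\<Sum>j\<in>I. \<Sum>k\<in>I. \<Sum>s1\<in>?A. \<Sum>s2\<in>?B. c b i j k * (V s1 j * V s2 k))"
        by (subst sum_rotate_left, subst sum_rotate_left) (rule refl)
      also have "\<dots> = (\<Sum>j\<in>I. \<Sum>k\<in>I. c b i j k * (N (Some b, j) (take n w) * N (None, k) (drop n w)))"
      proof -
        have N_eq: "N (Some b, j) v = (\<Sum>s\<in>{s \<in> canon_terms v. root_op s \<noteq> Some b}. V s j)"
          "N (None, j) v = (\<Sum>s\<in>canon_terms v. V s j)" for j v by (simp_all add: N_def)
        show ?thesis unfolding N_eq sum_product unfolding sum_distrib_left by (rule refl)
      qed
      finally show "(\<Sum>s1\<in>?A. \<Sum>s2\<in>?B. \<Sum>j\<in>I. \<Sum>k\<in>I. c b i j k * (V s1 j * V s2 k)) =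
         (\<Sum>j\<in>I. \<Sum>k\<in>I. c b i j k * (N (Some b, j) (take n w) * N (None, k) (drop n w)))" .
    qed
    also have "\<dots> = (\<Sum>j\<in>I. \<Sum>k\<in>I. \<Sum>n\<le>length w. c b i j k *
        (N (Some b, j) (take n w) * N (None, k) (drop n w)))"
      by (rule sum_rotate_right)
    finally show ?thesis by (simp add: cauchy_def sum_distrib_left)
  qed
  have leaf: "(\<Sum>s\<in>{s \<in> canon_terms w. root_op s = None}. V s i) = (if length w = 1 then V (Lf (hd w)) i else 0)"
    for w i
  proof (cases "length w = 1")
    case True
    then obtain a where w: "w = [a]" by (auto simp: length_Suc_conv)
    have "s = Lf a" if "root_op s = None" "word_of s = [a]" for s using that by (cases s) auto
    then have "{s \<in> canon_terms w. root_op s = None} = {Lf a}" using w by (auto simp: canon_terms_def)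
    then show ?thesis using w by simp
  next
    case False
    have "length (word_of s) = 1" if "root_op s = None" for s :: "'a trm" using that by (cases s) auto
    then have "{s \<in> canon_terms w. root_op s = None} = {}" using False by (auto simp: canon_terms_def)
    then show ?thesis using False by (simp only: sum.empty if_False)
  qed
  have "algebraic (\<lambda>w. \<Sum>p\<in>I'. (if fst p = None then m (snd p) else 0) * N p w)"
  proof (rule quad_algebraic_lincomb[where I = I' and c = c' and l = "\<lambda>p a. V (Lf a) (snd p)", OF finI'])
    fix p and w :: "'a list" assume "p \<in> I'"
    then obtain q i where p: "p = (q, i)" "i \<in> I" by (auto simp: I'_def)
    have eq: "{s \<in> canon_terms w. q = None \<or> root_op s \<noteq> q} = {s \<in> canon_terms w. root_op s = None} \<union>
        (\<Union>b\<in>{b. q \<noteq> Some b}. {s \<in> canon_terms w. root_op s = Some b})"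
    proof (rule set_eqI)
      fix s
      show "s \<in> {s \<in> canon_terms w. q = None \<or> root_op s \<noteq> q} \<longleftrightarrow> s \<in> {s \<in> canon_terms w. root_op s = None} \<union>
        (\<Union>b\<in>{b. q \<noteq> Some b}. {s \<in> canon_terms w. root_op s = Some b})"
        by (cases "root_op s"; cases q) auto
    qed
    have dis: "(\<Sum>s\<in>(\<Union>b\<in>{b. q \<noteq> Some b}. {s \<in> canon_terms w. root_op s = Some b}). V s i) =
        (\<Sum>b\<in>{b. q \<noteq> Some b}. \<Sum>s\<in>{s \<in> canon_terms w. root_op s = Some b}. V s i)"
      by (rule sum.UNION_disjoint) auto
    have "N p w = (\<Sum>s\<in>{s \<in> canon_terms w. root_op s = None}. V s i) +
        (\<Sum>b\<in>{b. q \<noteq> Some b}. \<Sum>s\<in>{s \<in> canon_terms w. root_op s = Some b}. V s i)"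
      unfolding N_def fst_conv snd_conv p dis[symmetric] eq by (rule sum.union_disjoint) auto
    also have "\<dots> = (if length w = 1 then V (Lf (hd w)) i else 0) +
        (\<Sum>b\<in>{b. q \<noteq> Some b}. \<Sum>j\<in>I. \<Sum>k\<in>I. c b i j k * cauchy (N (Some b, j)) (N (None, k)) w)"
      using leaf node[OF p(2)] by simp
    also have "(\<Sum>b\<in>{b. q \<noteq> Some b}. \<Sum>j\<in>I. \<Sum>k\<in>I. c b i j k * cauchy (N (Some b, j)) (N (None, k)) w) =
        (\<Sum>b\<in>{b. q \<noteq> Some b}. \<Sum>r\<in>I'. \<Sum>r'\<in>I'. (if fst r = Some b \<and> fst r' = None then c b i (snd r) (snd r') else 0)
           * cauchy (N r) (N r') w)" (is "(\<Sum>b\<in>_. ?L b) = (\<Sum>b\<in>_. ?R b)")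
    proof (rule sum.cong[OF refl])
      fix b
      have "?R b = (\<Sum>r\<in>I'. \<Sum>r'\<in>I'. if fst r = Some b \<and> fst r' = None then
           c b i (snd r) (snd r') * cauchy (N r) (N r') w else 0)"
        by (intro sum.cong) auto
      also have "\<dots> = (\<Sum>q'\<in>UNIV. \<Sum>j\<in>I. \<Sum>q''\<in>UNIV. \<Sum>k\<in>I. if q' = Some b \<and> q'' = None then
           c b i j k * cauchy (N (q', j)) (N (q'', k)) w else 0)"
        unfolding I'_def by (simp add: sum.cartesian_product' cong: if_cong)
      also have "\<dots> = (\<Sum>q'\<in>UNIV. \<Sum>j\<in>I. \<Sum>q''\<in>UNIV. if q' = Some b then (if q'' = None then \<Sum>k\<in>I. 
           c b i j k * cauchy (N (q', j)) (N (q'', k)) w else 0) else 0)"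
        by (intro sum.cong refl) auto
      also have "\<dots> = (\<Sum>q'\<in>UNIV. if q' = Some b then (\<Sum>j\<in>I. \<Sum>q''\<in>UNIV. if q'' = None then \<Sum>k\<in>I. 
           c b i j k * cauchy (N (q', j)) (N (q'', k)) w else 0) else 0)"
        by (intro sum.cong refl) auto
      also have "\<dots> = ?L b" by simp
      finally show "?L b = ?R b" by simp
    qed
    also have "\<dots> = (\<Sum>r\<in>I'. \<Sum>r'\<in>I'. c' p r r' * cauchy (N r) (N r') w)"
      unfolding c'_def p fst_conv snd_conv sum_distrib_right by (rule sum_rotate_right)
    finally show "N p w = (if length w = 1 then V (Lf (hd w)) (snd p) else 0) +
       (\<Sum>r\<in>I'. \<Sum>r'\<in>I'. c' p r r' * cauchy (N r) (N r') w)" using p by simp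
  qed (simp add: N_def)
  also have "(\<lambda>w. \<Sum>p\<in>I'. (if fst p = None then m (snd p) else 0) * N p w) =
     (\<lambda>w. \<Sum>s\<in>canon_terms w. \<Sum>i\<in>I. m i * V s i)"
  proof
    fix w
    have "(\<Sum>p\<in>I'. (if fst p = None then m (snd p) else 0) * N p w) =
      (\<Sum>q\<in>UNIV. \<Sum>i\<in>I. (if q = None then m i else 0) * N (q, i) w)"
      unfolding I'_def by (simp add: sum.cartesian_product split_def)
    also have "\<dots> = (\<Sum>q\<in>UNIV. if q = None then (\<Sum>i\<in>I. m i * N (q, i) w) else 0)"
      by (intro sum.cong) auto
    also have "\<dots> = (\<Sum>i\<in>I. m i * N (None, i) w)" by simp
    also have "\<dots> = (\<Sum>s\<in>canon_terms w. \<Sum>i\<in>I. m i * V s i)"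
      unfolding N_def by (simp add: sum_distrib_left sum.swap[where A = I])
    finally show "(\<Sum>p\<in>I'. (if fst p = None then m (snd p) else 0) * N p w) = \<dots>" .
  qed
  finally show ?thesis .
qed

section \<open>Weighted parenthesizing automata\<close>

lemma sum_if_const: "(\<Sum>x\<in>A. if P then f x else 0) = (if P then sum f A else 0)"
  by simp

locale wf_wpa =
  fixes A :: "('a, 'k::comm_semiring_1) wpa"
  assumes wf: "wpa_wf A"
begin

definition states :: "bool \<Rightarrow> nat set" where
  "states c = (if c then HS A else VS A)"

definition St :: "nat set" where "St = HS A \<union> VS A"

definition runs :: "nat \<Rightarrow> nat \<Rightarrow> 'a trm \<Rightarrow> 'a tok list set" where
  "runs q1 q2 s = {r. \<exists>b. wrun A q1 r q2 (text_of s) b}"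

definition run_sum :: "'a trm \<Rightarrow> nat \<Rightarrow> nat \<Rightarrow> 'k" where
  "run_sum s q1 q2 = (\<Sum>r\<in>runs q1 q2 s. runwt A r)"

lemma finite_Ty [simp]: "finite (states c)" and finite_St [simp]: "finite St"
  and finite_Om [simp]: "finite (Om A)"
  using wf by (auto simp: states_def St_def wpa_wf_def)

lemma Ty_disj: "q \<in> states c \<Longrightarrow> q \<in> states d \<longleftrightarrow> d = c"
  using wf by (auto simp: states_def wpa_wf_def split: if_splits)

lemma Ty_H: "q \<in> states c \<Longrightarrow> q \<in> HS A \<longleftrightarrow> c"
  using Ty_disj[of q c True] by (auto simp: states_def)

lemma St_Ty: "St = states True \<union> states False"
  by (simp add: St_def states_def)

text \<open>States change their type only at brackets, so both ends of a run have a common type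
  \<open>c\<close>. Gluing at states of type \<open>c\<close> produces a root with operation
  \<open>c\<close>, whereas a bracket hides a root of the opposite operation; hence the flag is
  determined by the label and the type.\<close>

lemma wrun_inv:
  assumes "wrun A q1 r q2 t b"
  shows "\<exists>c s. q1 \<in> states c \<and> q2 \<in> states c \<and> canon s \<and> t = text_of s \<and> b = (root_op s = Some c)"
  using assms
proof induction
  case (r1 q1 q2 a)
  then obtain c where "q1 \<in> states c \<and> q2 \<in> states c" by (metis (full_types) states_def)
  then show ?case by (intro exI[of _ c] exI[of _ "Lf a"]) auto
next
  case (r2 q1 r1 q t1 b1 r2 q2 t2 b2)
  then obtain c s1 d s2 where *: "q1 \<in> states c" "q \<in> states c" "canon s1" "t1 = text_of s1"
    "q \<in> states d" "q2 \<in> states d" "canon s2" "t2 = text_of s2" by blast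
  then have "d = c" using Ty_disj by blast
  moreover obtain u where "canon u" "root_op u = Some c" "text_of u = comb c (text_of s1) (text_of s2)"
    using canon_comb[OF *(3,7)] by blast
  ultimately show ?case using * Ty_H[OF *(2)]
    by (intro exI[of _ c] exI[of _ u]) (auto simp: comb_def)
next
  case (r3 p1 r p2 t q1 q2 s)
  then obtain c s' where *: "p1 \<in> states c" "canon s'" "t = text_of s'" "root_op s' = Some c" by auto
  have "q1 \<in> states (\<not> c) \<and> q2 \<in> states (\<not> c)"
    using r3.hyps(2) * Ty_disj[OF *(1), of True] Ty_disj[OF *(1), of False]
    by (auto simp: states_def)
  then show ?case using * by (intro exI[of _ "\<not> c"] exI[of _ s']) auto
qed

text \<open>Rule (2) may be applied in any grouping. Associativity allows regrouping to the right,
  with an indecomposable first factor, which is the shape of canonical terms.\<close>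

lemma wrun_True_decomp:
  assumes "wrun A q1 r q2 t b" "b"
  shows "\<exists>r1 q t1 r2 t2 b2. r = r1 @ r2 \<and> wrun A q1 r1 q t1 False \<and> wrun A q r2 q2 t2 b2 \<and>
     t = comb (q \<in> HS A) t1 t2"
  using assms
proof induction
  case (r2 q1 ra q t1 b1 rb q2 t2 b2)
  show ?case
  proof (cases b1)
    case False
    then show ?thesis using r2.hyps by (metis comb_def)
  next
    case True
    then obtain rc q' tc rd td bd where *: "ra = rc @ rd" "wrun A q1 rc q' tc False"
      "wrun A q' rd q td bd" "t1 = comb (q' \<in> HS A) tc td" using r2.IH by blast
    obtain c where c: "q' \<in> states c" "q \<in> states c" using wrun_inv[OF *(3)] by blast
    have eq: "q' \<in> HS A \<longleftrightarrow> c" "q \<in> HS A \<longleftrightarrow> c" using Ty_H c by blast+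
    have 1: "wrun A q' (rd @ rb) q2 (comb c td t2) True"
      using wrun.r2[OF *(3) r2.hyps(2)] eq by (simp add: comb_def)
    have "(if q \<in> HS A then tcirc t1 t2 else tbullet t1 t2) = comb c t1 t2"
      by (simp only: eq comb_def)
    also have "\<dots> = comb c tc (comb c td t2)" by (simp only: *(4) eq comb_assoc)
    finally have 2: "(if q \<in> HS A then tcirc t1 t2 else tbullet t1 t2) =
      comb (q' \<in> HS A) tc (comb c td t2)" by (simp only: eq)
    show ?thesis
      using *(1,2) 1 2 by (intro exI[of _ rc] exI[of _ q'] exI[of _ tc] exI[of _ "rd @ rb"]
        exI[of _ "comb c td t2"] exI[of _ True] conjI) (simp_all only: append_assoc)
  qed
qed auto

section \<open>Unique factorization of runs by bracket height\<close>

primrec tht :: "'a tok \<Rightarrow> int" where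
  "tht (Tr _ _ _) = 0" | "tht (Op _ _ _) = 1" | "tht (Cl _ _ _) = -1"

primrec ttgt :: "'a tok \<Rightarrow> nat" where
  "ttgt (Tr _ _ q) = q" | "ttgt (Op _ _ q) = q" | "ttgt (Cl _ _ q) = q"

abbreviation ht :: "'a tok list \<Rightarrow> int" where "ht r \<equiv> sum_list (map tht r)"

text \<open>Runs are balanced bracket words. In a run built by rule (3) the outer bracket stays open
  until the last token, so indecomposable runs return to height 0 only at their end. The final state
  can be read off the last token.\<close>

lemma wrun_ht:
  assumes "wrun A q1 r q2 t b"
  shows "r \<noteq> [] \<and> ttgt (last r) = q2 \<and> ht r = 0 \<and> (\<forall>n. 0 \<le> ht (take n r)) \<and>
     (\<not> b \<longrightarrow> (\<forall>n. 0 < n \<longrightarrow> n < length r \<longrightarrow> 0 < ht (take n r)))"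
  using assms
proof induction
  case (r3 p1 r p2 t q1 q2 s)
  have "0 < ht (take n (Op q1 s p1 # r @ [Cl p2 s q2]))" if "0 < n" "n < length r + 2" for n
    using that r3.IH by (cases n) (auto simp: add_pos_nonneg)
  moreover have "ht (take n (Op q1 s p1 # r @ [Cl p2 s q2])) = 0" if "n = 0 \<or> n \<ge> length r + 2" for n
    using that r3.IH by (cases n) auto
  ultimately have "0 \<le> ht (take n (Op q1 s p1 # r @ [Cl p2 s q2]))" for n
    by (metis gr0I less_imp_le not_le order_refl)
  then show ?case using r3.IH \<open>\<And>n. _ \<Longrightarrow> _ \<Longrightarrow> 0 < _\<close> by auto
qed (auto simp: take_Cons')

text \<open>Indecomposable runs form a prefix code: the shorter of two such prefixes of one token
  list would be a proper nonempty prefix of height 0 of the longer one.\<close>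

lemma item_prefix_unique:
  assumes "wrun A q1 r1 q t1 False" "wrun A q1 r1' q' t1' False" "r1 @ r2 = r1' @ r2'"
  shows "r1 = r1' \<and> r2 = r2' \<and> q = q'"
proof -
  note 1 = wrun_ht[OF assms(1)] and 2 = wrun_ht[OF assms(2)]
  have "length r1 = length r1'"
  proof (rule linorder_cases)
    assume l: "length r1 < length r1'"
    have "take (length r1) r1' = r1" using assms(3) l
      by (metis append_eq_append_conv_if less_imp_le_nat)
    then show ?thesis using 1 2 l by (metis length_greater_0_conv less_irrefl)
  next
    assume l: "length r1' < length r1"
    have "take (length r1') r1 = r1'" using assms(3) l
      by (metis append_eq_append_conv_if less_imp_le_nat)
    then show ?thesis using 1 2 l by (metis length_greater_0_conv less_irrefl)
  qed
  then have "r1 = r1'" "r2 = r2'" using assms(3) by auto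
  then show ?thesis using 1 2 by auto
qed

lemma Rn_Lf: "runs q1 q2 (Lf a) = (if \<exists>c. q1 \<in> states c \<and> q2 \<in> states c then {[Tr q1 a q2]} else {})"
proof -
  have "r = [Tr q1 a q2]" if "wrun A q1 r q2 (text_of (Lf a)) b" for r b
  proof -
    have b: "\<not> b" using wrun_inv[OF that] inj_onD[OF inj_on_tx, of _ "Lf a"]
      by (metis canon.simps(1) mem_Collect_eq option.distinct(1) root_op.simps(1))
    from that show ?thesis
    proof cases
      case (r3 p1 r' p2 s)
      then have "wrun A p1 r' p2 (text_of (Lf a)) True" by simp
      from wrun_inv[OF this] show ?thesis using inj_onD[OF inj_on_tx, of _ "Lf a"]
        by (metis canon.simps(1) mem_Collect_eq option.distinct(1) root_op.simps(1))
    qed (use b in auto)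
  qed
  moreover have "wrun A q1 [Tr q1 a q2] q2 (text_of (Lf a)) False" if "\<exists>c. q1 \<in> states c \<and> q2 \<in> states c"
    using that by (auto simp: states_def intro!: wrun.r1 split: if_splits)
  moreover have "\<exists>c. q1 \<in> states c \<and> q2 \<in> states c" if "wrun A q1 r q2 (text_of (Lf a)) b" for r b
    using wrun_inv[OF that] by blast
  ultimately show ?thesis unfolding runs_def
    by (cases "\<exists>c. q1 \<in> states c \<and> q2 \<in> states c") (simp_all only: if_True if_False, blast+)
qed

lemma Rn_other: "\<not> (\<exists>c. q1 \<in> states c \<and> q2 \<in> states c) \<Longrightarrow> runs q1 q2 s = {}"
  unfolding runs_def using wrun_inv by blast

lemma Rn_D:
  assumes "r \<in> runs q1 q2 s" "canon s" "q1 \<in> states c"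
  shows "wrun A q1 r q2 (text_of s) (root_op s = Some c) \<and> q2 \<in> states c"
proof -
  from assms obtain b where b: "wrun A q1 r q2 (text_of s) b" by (auto simp: runs_def)
  from wrun_inv[OF b] obtain d s' where *: "q1 \<in> states d" "q2 \<in> states d" "canon s'" "text_of s = text_of s'"
    "b = (root_op s' = Some d)" by blast
  have "s = s'" using inj_onD[OF inj_on_tx, of s s'] * assms by auto
  moreover have "d = c" using Ty_disj * assms(3) by blast
  ultimately show ?thesis using b * by simp
qed

lemma Rn_same:
  assumes "canon (Nd c s1 s2)" "q1 \<in> states c" "q2 \<in> states c"
  shows "runs q1 q2 (Nd c s1 s2) =
     (\<lambda>(q, r1, r2). r1 @ r2) ` (SIGMA q:states c. runs q1 q s1 \<times> runs q q2 s2)" (is "_ = ?R")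
proof (intro equalityI subsetI)
  fix r assume "r \<in> runs q1 q2 (Nd c s1 s2)"
  from Rn_D[OF this assms(1,2)] have "wrun A q1 r q2 (text_of (Nd c s1 s2)) True" by simp
  from wrun_True_decomp[OF this] obtain r1 q t1 r2 t2 b2 where
    *: "r = r1 @ r2" "wrun A q1 r1 q t1 False" "wrun A q r2 q2 t2 b2"
    "text_of (Nd c s1 s2) = comb (q \<in> HS A) t1 t2" by blast
  obtain d u1 where u1: "q1 \<in> states d" "q \<in> states d" "canon u1" "t1 = text_of u1" "root_op u1 \<noteq> Some d"
    using wrun_inv[OF *(2)] by blast
  have d: "d = c" using Ty_disj u1 assms by blast
  obtain u2 where u2: "canon u2" "t2 = text_of u2" using wrun_inv[OF *(3)] by blast
  have "text_of (Nd c s1 s2) = text_of (Nd c u1 u2)"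
    using *(4) u1 u2 d Ty_H[OF u1(2)] by simp
  then have "Nd c s1 s2 = Nd c u1 u2"
    using inj_onD[OF inj_on_tx, of "Nd c s1 s2" "Nd c u1 u2"] assms u1 u2 d by auto
  then show "r \<in> ?R" using * u1 u2 d by (force simp: runs_def)
next
  fix r assume "r \<in> ?R"
  then obtain q r1 r2 where *: "q \<in> states c" "r1 \<in> runs q1 q s1" "r2 \<in> runs q q2 s2" "r = r1 @ r2"
    by auto
  then obtain b1 b2 where "wrun A q1 r1 q (text_of s1) b1" "wrun A q r2 q2 (text_of s2) b2"
    by (auto simp: runs_def)
  from wrun.r2[OF this] show "r \<in> runs q1 q2 (Nd c s1 s2)"
    using Ty_H[OF *(1)] *(4) by (auto simp: runs_def comb_def)
qed

text \<open>By canonicity \<open>s1\<close> does not have root operation \<open>c\<close>, so its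
  runs between states of type \<open>c\<close> are indecomposable. The token list then determines
  the point of division and the state there, and no run is counted twice.\<close>

lemma inj_same:
  assumes "canon (Nd c s1 s2)" "q1 \<in> states c"
  shows "inj_on (\<lambda>(q, r1, r2). r1 @ r2) (SIGMA q:states c. runs q1 q s1 \<times> runs q q2 s2)"
proof -
  have "q = q' \<and> r1 = r1' \<and> r2 = r2'"
    if *: "r1 \<in> runs q1 q s1" "r1' \<in> runs q1 q' s1" "r1 @ r2 = r1' @ r2'" for q r1 r2 q' r1' r2'
  proof -
  have "wrun A q1 r1 q (text_of s1) False" "wrun A q1 r1' q' (text_of s1) False"
    using Rn_D[OF *(1) _ assms(2)] Rn_D[OF *(2) _ assms(2)] assms by auto
    from item_prefix_unique[OF this *(3)] show ?thesis by blast
  qed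
  note unique = this
  show ?thesis
  proof (rule inj_onI)
    fix x y
    assume xy: "x \<in> (SIGMA q:states c. runs q1 q s1 \<times> runs q q2 s2)" "y \<in> (SIGMA q:states c. runs q1 q s1 \<times> runs q q2 s2)"
      "(\<lambda>(q, r1, r2). r1 @ r2) x = (\<lambda>(q, r1, r2). r1 @ r2) y"
    obtain q r1 r2 q' r1' r2' where "x = (q, r1, r2)" "y = (q', r1', r2')"
      by (cases x; cases y)
    then show "x = y" using xy unique[of r1 q r1' q' r2 r2'] by simp
  qed
qed

text \<open>At states of the opposite type the flag is \<open>False\<close>, which rules out gluing,
  and the label is no letter; only a bracket pair remains. Since brackets enclose composed runs
  only, they cannot be stacked directly on each other.\<close>

lemma Rn_opp:
  assumes "canon (Nd c s1 s2)" "q1 \<in> states (\<not> c)" "q2 \<in> states (\<not> c)"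
  shows "runs q1 q2 (Nd c s1 s2) =
     (\<lambda>(o', p1, p2, r). Op q1 o' p1 # r @ [Cl p2 o' q2]) `
       (SIGMA o':Om A. SIGMA p1:states c. SIGMA p2:states c. runs p1 p2 (Nd c s1 s2))" (is "_ = ?R")
proof (intro equalityI subsetI)
  fix r assume "r \<in> runs q1 q2 (Nd c s1 s2)"
  from Rn_D[OF this assms(1,2)] have "wrun A q1 r q2 (text_of (Nd c s1 s2)) False" by simp
  then show "r \<in> ?R"
  proof cases
    case (r1 a)
    have "Nd c s1 s2 = Lf a"
      using inj_onD[OF inj_on_tx, of "Nd c s1 s2" "Lf a"] r1 assms by simp
    then show ?thesis by simp
  next
    case (r3 p1 r' p2 o')
    have "r' \<in> runs p1 p2 (Nd c s1 s2)" using r3 by (auto simp: runs_def)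
    moreover have *: "wrun A p1 r' p2 (text_of (Nd c s1 s2)) True"
      and o: "p1 \<in> HS A \<and> q1 \<in> VS A \<and> q2 \<in> VS A \<or> p1 \<in> VS A \<and> q1 \<in> HS A \<and> q2 \<in> HS A"
      using r3 by simp_all
    moreover from wrun_inv[OF *] obtain d where d: "p1 \<in> states d" "p2 \<in> states d" by blast
    moreover have "d = c"
      using o d assms(2) Ty_disj[of p1 d True] Ty_disj[of p1 d False] Ty_disj[of q1 "\<not> c" True]
        Ty_disj[of q1 "\<not> c" False] by (auto simp: states_def)
    ultimately show ?thesis using r3 by force
  qed simp_all
next
  fix r assume "r \<in> ?R"
  then obtain o' p1 p2 r' where *: "o' \<in> Om A" "p1 \<in> states c" "p2 \<in> states c"
    "r' \<in> runs p1 p2 (Nd c s1 s2)" "r = Op q1 o' p1 # r' @ [Cl p2 o' q2]" by auto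
  have "wrun A p1 r' p2 (text_of (Nd c s1 s2)) True" using Rn_D[OF *(4) assms(1) *(2)] by simp
  from wrun.r3[OF this _ *(1), of q1 q2] show "r \<in> runs q1 q2 (Nd c s1 s2)"
    using * assms by (auto simp: runs_def states_def split: if_splits)
qed

lemma finite_Rn: "canon s \<Longrightarrow> finite (runs q1 q2 s)"
proof (induction s arbitrary: q1 q2)
  case (Lf a)
  then show ?case by (simp add: Rn_Lf)
next
  case (Nd c s1 s2)
  have same: "finite (runs q1 q2 (Nd c s1 s2))" if "q1 \<in> states c" "q2 \<in> states c" for q1 q2
    unfolding Rn_same[OF Nd.prems that] using Nd by auto
  show ?case
  proof (cases "\<exists>d. q1 \<in> states d \<and> q2 \<in> states d")
    case True
    then obtain d where d: "q1 \<in> states d" "q2 \<in> states d" by blast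
    show ?thesis
    proof (cases "d = c")
      case False
      then have "d = (\<not> c)" by auto
      then have "q1 \<in> states (\<not> c)" "q2 \<in> states (\<not> c)" using d by auto
      from Rn_opp[OF Nd.prems this] same show ?thesis by auto
    qed (use same d in auto)
  qed (simp add: Rn_other)
qed

lemma Ru_Lf: "run_sum (Lf a) q1 q2 = (if \<exists>c. q1 \<in> states c \<and> q2 \<in> states c then mu A q1 a q2 else 0)"
  by (cases "\<exists>c. q1 \<in> states c \<and> q2 \<in> states c")
    (simp_all only: run_sum_def Rn_Lf if_True if_False, simp_all add: runwt_def)

lemma Ru_other: "\<not> (\<exists>c. q1 \<in> states c \<and> q2 \<in> states c) \<Longrightarrow> run_sum s q1 q2 = 0"
  by (simp add: run_sum_def Rn_other)

lemma Ru_same: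
  assumes "canon (Nd c s1 s2)" "q1 \<in> states c" "q2 \<in> states c"
  shows "run_sum (Nd c s1 s2) q1 q2 = (\<Sum>q\<in>states c. run_sum s1 q1 q * run_sum s2 q q2)"
proof -
  have "run_sum (Nd c s1 s2) q1 q2 = (\<Sum>x\<in>(SIGMA q:states c. runs q1 q s1 \<times> runs q q2 s2).
      runwt A ((\<lambda>(q, r1, r2). r1 @ r2) x))"
    unfolding run_sum_def Rn_same[OF assms] by (subst sum.reindex[OF inj_same[OF assms(1,2)]]) simp
  also have "\<dots> = (\<Sum>(q, y)\<in>(SIGMA q:states c. runs q1 q s1 \<times> runs q q2 s2).
      runwt A (fst y) * runwt A (snd y))"
    by (intro sum.cong) (auto simp: runwt_def)
  also have "\<dots> = (\<Sum>q\<in>states c. \<Sum>y\<in>runs q1 q s1 \<times> runs q q2 s2. runwt A (fst y) * runwt A (snd y))"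
    using assms finite_Rn by (intro sum.Sigma[symmetric]) auto
  finally show ?thesis
    by (simp add: run_sum_def sum_product sum.cartesian_product split_def)
qed

lemma Ru_opp:
  assumes "canon (Nd c s1 s2)" "q1 \<in> states (\<not> c)" "q2 \<in> states (\<not> c)"
  shows "run_sum (Nd c s1 s2) q1 q2 = (\<Sum>p1\<in>states c. \<Sum>p2\<in>states c.
     (\<Sum>o'\<in>Om A. muop A q1 o' p1 * mucl A p2 o' q2) * run_sum (Nd c s1 s2) p1 p2)"
proof -
  let ?f = "\<lambda>(o', p1, p2, r). Op q1 o' p1 # r @ [Cl p2 o' q2]"
  let ?S = "SIGMA o':Om A. SIGMA p1:states c. SIGMA p2:states c. runs p1 p2 (Nd c s1 s2)"
  let ?g = "\<lambda>o' p1 p2 r. muop A q1 o' p1 * mucl A p2 o' q2 * runwt A r"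
  have inj: "inj_on ?f ?S" by (rule inj_onI) auto
  have "run_sum (Nd c s1 s2) q1 q2 = (\<Sum>x\<in>?S. runwt A (?f x))"
    unfolding run_sum_def Rn_opp[OF assms] by (subst sum.reindex[OF inj]) simp
  also have "\<dots> = (\<Sum>(o', p1, p2, r)\<in>?S. ?g o' p1 p2 r)"
    by (intro sum.cong) (auto simp: runwt_def mult.commute mult.left_commute)
  also have "\<dots> = (\<Sum>o'\<in>Om A. \<Sum>p1\<in>states c. \<Sum>p2\<in>states c. \<Sum>r\<in>runs p1 p2 (Nd c s1 s2). ?g o' p1 p2 r)"
    using finite_Rn[OF assms(1)]
    by (simp add: sum.Sigma split_def)
  also have "\<dots> = (\<Sum>p1\<in>states c. \<Sum>p2\<in>states c. \<Sum>o'\<in>Om A. \<Sum>r\<in>runs p1 p2 (Nd c s1 s2). ?g o' p1 p2 r)"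
    by (rule sum_rotate_right)
  finally show ?thesis by (simp add: run_sum_def sum_product)
qed

text \<open>Coefficients obtained by inserting \<open>Ru_same\<close> into \<open>Ru_opp\<close>:
  two runs of type \<open>b\<close> are glued at a common state, and the result is either taken as
  it is or wrapped in one bracket pair.\<close>

definition cf :: "bool \<Rightarrow> nat \<times> nat \<Rightarrow> nat \<times> nat \<Rightarrow> nat \<times> nat \<Rightarrow> 'k" where
  "cf b i j k = (if snd j = fst k \<and> fst j \<in> states b \<and> snd j \<in> states b \<and> snd k \<in> states b then
     (if fst i \<in> states b \<and> snd i \<in> states b then (if fst i = fst j \<and> snd i = snd k then 1 else 0)
      else if fst i \<in> states (\<not> b) \<and> snd i \<in> states (\<not> b) then
        (\<Sum>o'\<in>Om A. muop A (fst i) o' (fst j) * mucl A (snd k) o' (snd i)) else 0) else 0)"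

lemma Ru_bilinear:
  assumes can: "canon (Nd b s t)"
  shows "run_sum (Nd b s t) q1 q2 = (\<Sum>j\<in>St \<times> St. \<Sum>k\<in>St \<times> St.
      cf b (q1, q2) j k * (run_sum s (fst j) (snd j) * run_sum t (fst k) (snd k)))"
proof -
  \<comment> \<open>The weight of passing from the outer pair of states to the ends
    \<open>p\<close>, \<open>p'\<close> of the composed run: the unit matrix if the types agree, one
    bracket pair if they are opposite.\<close>
  define K where "K p p' = (if q1 \<in> states b \<and> q2 \<in> states b then (if q1 = p \<and> q2 = p' then 1 else 0)
      else if q1 \<in> states (\<not> b) \<and> q2 \<in> states (\<not> b) then
        (\<Sum>o'\<in>Om A. muop A q1 o' p * mucl A p' o' q2) else 0)" for p p'
  let ?R = "run_sum (Nd b s t)"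
  have sub: "states b \<subseteq> St" by (cases b) (auto simp: St_Ty)
  have red: "(\<Sum>x\<in>St. if x \<in> states b then f x else 0) = (\<Sum>x\<in>states b. f x)" for f :: "nat \<Rightarrow> 'k"
    using sub by (simp add: sum.If_cases Int_absorb1 flip: sum.inter_filter)
  have "(\<Sum>j\<in>St \<times> St. \<Sum>k\<in>St \<times> St. cf b (q1, q2) j k * (run_sum s (fst j) (snd j) * run_sum t (fst k) (snd k)))
     = (\<Sum>p\<in>St. \<Sum>q\<in>St. \<Sum>q'\<in>St. \<Sum>p'\<in>St. cf b (q1, q2) (p, q) (q', p') * (run_sum s p q * run_sum t q' p'))"
    by (simp add: sum.cartesian_product')
  also have "\<dots> = (\<Sum>p\<in>St. \<Sum>q\<in>St. \<Sum>q'\<in>St. \<Sum>p'\<in>St. if p \<in> states b then if q \<in> states b then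
      if q' = q then if p' \<in> states b then K p p' * (run_sum s p q * run_sum t q' p') else 0 else 0 else 0 else 0)"
    by (intro sum.cong refl) (simp add: cf_def K_def)
  also have "\<dots> = (\<Sum>p\<in>St. if p \<in> states b then \<Sum>q\<in>St. if q \<in> states b then \<Sum>q'\<in>St. if q' = q then
      \<Sum>p'\<in>St. if p' \<in> states b then K p p' * (run_sum s p q * run_sum t q' p') else 0 else 0 else 0 else 0)"
    by (simp only: sum_if_const)
  also have "\<dots> = (\<Sum>p\<in>states b. \<Sum>q\<in>states b. \<Sum>p'\<in>states b. K p p' * (run_sum s p q * run_sum t q p'))"
    unfolding red by (rule sum.cong[OF refl], rule sum.cong[OF refl]) (use sub in \<open>auto simp: subset_iff\<close>)
  also have "\<dots> = (\<Sum>p\<in>states b. \<Sum>p'\<in>states b. \<Sum>q\<in>states b. K p p' * (run_sum s p q * run_sum t q p'))"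
    by (rule sum.cong[OF refl], rule sum.swap)
  also have "\<dots> = (\<Sum>p\<in>states b. \<Sum>p'\<in>states b. K p p' * ?R p p')"
    using Ru_same[OF can] by (intro sum.cong refl) (simp add: sum_distrib_left)
  also have "\<dots> = ?R q1 q2"
  proof (cases "q1 \<in> states b \<and> q2 \<in> states b")
    case True
    then have "(\<Sum>p\<in>states b. \<Sum>p'\<in>states b. K p p' * ?R p p') =
       (\<Sum>p\<in>states b. \<Sum>p'\<in>states b. if p = q1 then (if p' = q2 then ?R p p' else 0) else 0)"
      by (intro sum.cong[OF refl]) (simp add: K_def)
    also have "\<dots> = (\<Sum>p\<in>states b. if p = q1 then (\<Sum>p'\<in>states b. if p' = q2 then ?R p p' else 0) else 0)"
      by (simp only: sum_if_const)
    finally show ?thesis using True by simp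
  next
    case False
    show ?thesis
    proof (cases "q1 \<in> states (\<not> b) \<and> q2 \<in> states (\<not> b)")
      case True
      have "K = (\<lambda>p p'. \<Sum>o'\<in>Om A. muop A q1 o' p * mucl A p' o' q2)"
        using True False by (auto simp: K_def fun_eq_iff)
      then show ?thesis using Ru_opp[OF can] True by simp
    next
      case F: False
      have "\<not> (q1 \<in> states c \<and> q2 \<in> states c)" for c using F False by (cases "c = b") auto
      then have "\<not> (\<exists>c. q1 \<in> states c \<and> q2 \<in> states c)" by blast
      then have "?R q1 q2 = 0" by (rule Ru_other)
      moreover have "K = (\<lambda>p p'. 0)" using F False by (auto simp: K_def fun_eq_iff)
      ultimately show ?thesis by simp
    qed
  qed
  finally show ?thesis by simp
qed

lemma behaviour_Ru:
  "behaviour A (text_of s) = (\<Sum>i\<in>St \<times> St. (lam A (fst i) * gam A (snd i)) * run_sum s (fst i) (snd i))"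
  unfolding behaviour_def St_def[symmetric] runs_def[symmetric] run_sum_def[symmetric]
  by (simp add: sum.cartesian_product' mult.commute mult.left_commute)

end

theorem projection_algebraic:
  fixes R :: "'a::finite ttext \<Rightarrow> 'k::comm_semiring_1"
  assumes "regular_text_series R"
  shows "algebraic (proj R)"
proof -
  from assms obtain A :: "('a, 'k) wpa" where A: "wpa_wf A" "\<forall>\<tau>\<in>TXT. R \<tau> = behaviour A \<tau>"
    by (auto simp: regular_text_series_def)
  interpret wf_wpa A by unfold_locales (rule A)
  have "proj R = (\<lambda>w. (\<Sum>s\<in>canon_terms w. \<Sum>i\<in>St \<times> St. (lam A (fst i) * gam A (snd i)) * run_sum s (fst i) (snd i)))"
    unfolding proj_def sum_TXT fun_eq_iff
    using A(2) by (intro allI sum.cong refl) (auto simp: behaviour_Ru[symmetric] canon_terms_def TXT_eq)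
  moreover have "algebraic (\<lambda>w. \<Sum>s\<in>canon_terms w. \<Sum>i\<in>St \<times> St. (lam A (fst i) * gam A (snd i)) * run_sum s (fst i) (snd i))"
    by (rule bilinear_algebraic[where c = cf]) (use Ru_bilinear in auto)
  ultimately show ?thesis by simp
qed

section \<open>From algebraic systems to automata\<close>

context wf_wpa
begin

text \<open>Between states of type \<open>b\<close> a run factors into items, that is, letters and
  bracketed runs. \<open>tsum\<close> collects the runs with one item, \<open>csum\<close> those
  with at least two, and \<open>nsum\<close> all of them.\<close>

definition tsum :: "bool \<Rightarrow> nat \<Rightarrow> nat \<Rightarrow> 'a list \<Rightarrow> 'k" where
  "tsum b q1 q2 w = (\<Sum>s\<in>{s \<in> canon_terms w. root_op s \<noteq> Some b}. run_sum s q1 q2)"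

definition nsum :: "nat \<Rightarrow> nat \<Rightarrow> 'a list \<Rightarrow> 'k" where
  "nsum q1 q2 w = (\<Sum>s\<in>canon_terms w. run_sum s q1 q2)"

definition csum :: "bool \<Rightarrow> nat \<Rightarrow> nat \<Rightarrow> 'a list \<Rightarrow> 'k" where
  "csum b q1 q2 w = (\<Sum>q\<in>states b. cauchy (tsum b q1 q) (nsum q q2) w)"

lemma tsum_Nil [simp]: "tsum b q1 q2 [] = 0" and nsum_Nil [simp]: "nsum q1 q2 [] = 0"
  by (simp_all add: tsum_def nsum_def)

lemma sum_Ru_root:
  assumes "q1 \<in> states b" "q2 \<in> states b"
  shows "(\<Sum>s\<in>{s \<in> canon_terms w. root_op s = Some b}. run_sum s q1 q2) = csum b q1 q2 w"
proof -
  have "(\<Sum>s\<in>{s \<in> canon_terms w. root_op s = Some b}. run_sum s q1 q2) = (\<Sum>s\<in>{s \<in> canon_terms w. root_op s = Some b}.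
     case s of Nd _ s1 s2 \<Rightarrow> (\<Sum>q\<in>states b. run_sum s1 q1 q * run_sum s2 q q2) | _ \<Rightarrow> 0)"
    using Ru_same[OF _ assms] by (intro sum.cong) (auto simp: canon_terms_def split: trm.splits)
  also have "\<dots> = (\<Sum>n\<le>length w. \<Sum>s1\<in>{s \<in> canon_terms (take n w). root_op s \<noteq> Some b}. \<Sum>s2\<in>canon_terms (drop n w).
     \<Sum>q\<in>states b. run_sum s1 q1 q * run_sum s2 q q2)"
    by (rule sum_CT_Nd)
  also have "\<dots> = (\<Sum>n\<le>length w. \<Sum>q\<in>states b. tsum b q1 q (take n w) * nsum q q2 (drop n w))"
    unfolding tsum_def nsum_def sum_product by (rule sum.cong[OF refl], rule sum_rotate_left)
  also have "\<dots> = csum b q1 q2 w"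
    unfolding csum_def cauchy_def by (rule sum.swap)
  finally show ?thesis .
qed

lemma nsum_eq:
  assumes "q1 \<in> states b" "q2 \<in> states b"
  shows "nsum q1 q2 w = tsum b q1 q2 w + csum b q1 q2 w"
proof -
  have "canon_terms w = {s \<in> canon_terms w. root_op s \<noteq> Some b} \<union> {s \<in> canon_terms w. root_op s = Some b}" by auto
  then have "nsum q1 q2 w = (\<Sum>s\<in>{s \<in> canon_terms w. root_op s \<noteq> Some b} \<union> {s \<in> canon_terms w. root_op s = Some b}. run_sum s q1 q2)"
    unfolding nsum_def by simp
  also have "\<dots> = tsum b q1 q2 w + (\<Sum>s\<in>{s \<in> canon_terms w. root_op s = Some b}. run_sum s q1 q2)"
    unfolding tsum_def by (rule sum.union_disjoint) auto
  finally show ?thesis by (simp add: sum_Ru_root[OF assms])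
qed

lemma tsum_eq:
  assumes q: "q1 \<in> states b" "q2 \<in> states b"
  shows "tsum b q1 q2 w = (if length w = 1 then mu A q1 (hd w) q2 else 0) +
     (\<Sum>p1\<in>states (\<not> b). \<Sum>p2\<in>states (\<not> b).
        (\<Sum>o'\<in>Om A. muop A q1 o' p1 * mucl A p2 o' q2) * csum (\<not> b) p1 p2 w)"
proof -
  let ?K = "\<lambda>p1 p2. (\<Sum>o'\<in>Om A. muop A q1 o' p1 * mucl A p2 o' q2)"
  have "root_op s \<noteq> Some b \<longleftrightarrow> root_op s = None \<or> root_op s = Some (\<not> b)" for s :: "'a trm"
    by (cases "root_op s") auto
  then have "{s \<in> canon_terms w. root_op s \<noteq> Some b} = {s \<in> canon_terms w. root_op s = None} \<union> {s \<in> canon_terms w. root_op s = Some (\<not> b)}"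
    by blast
  then have "tsum b q1 q2 w = (\<Sum>s\<in>{s \<in> canon_terms w. root_op s = None} \<union> {s \<in> canon_terms w. root_op s = Some (\<not> b)}. run_sum s q1 q2)"
    unfolding tsum_def by simp
  also have "\<dots> = (\<Sum>s\<in>{s \<in> canon_terms w. root_op s = None}. run_sum s q1 q2) + (\<Sum>s\<in>{s \<in> canon_terms w. root_op s = Some (\<not> b)}. run_sum s q1 q2)"
    by (rule sum.union_disjoint) auto
  also have "(\<Sum>s\<in>{s \<in> canon_terms w. root_op s = None}. run_sum s q1 q2) = (if length w = 1 then mu A q1 (hd w) q2 else 0)"
  proof (cases "length w = 1")
    case True
    then obtain a where w: "w = [a]" by (auto simp: length_Suc_conv)
    have "s = Lf a" if "root_op s = None" "word_of s = [a]" for s using that by (cases s) auto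
    then have "{s \<in> canon_terms w. root_op s = None} = {Lf a}" using w by (auto simp: canon_terms_def)
    then show ?thesis using w q by (auto simp: Ru_Lf)
  next
    case False
    have "length (word_of s) = 1" if "root_op s = None" for s :: "'a trm" using that by (cases s) auto
    then have "{s \<in> canon_terms w. root_op s = None} = {}" using False by (auto simp: canon_terms_def)
    then show ?thesis using False by (simp only: sum.empty if_False)
  qed
  also have "(\<Sum>s\<in>{s \<in> canon_terms w. root_op s = Some (\<not> b)}. run_sum s q1 q2) =
     (\<Sum>s\<in>{s \<in> canon_terms w. root_op s = Some (\<not> b)}. \<Sum>p1\<in>states (\<not> b). \<Sum>p2\<in>states (\<not> b). ?K p1 p2 * run_sum s p1 p2)"
  proof (rule sum.cong[OF refl])
    fix s assume "s \<in> {s \<in> canon_terms w. root_op s = Some (\<not> b)}"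
    then obtain s1 s2 where s: "s = Nd (\<not> b) s1 s2" "canon (Nd (\<not> b) s1 s2)"
      by (cases s) (auto simp: canon_terms_def)
    from Ru_opp[OF s(2), of q1 q2] q
    show "run_sum s q1 q2 = (\<Sum>p1\<in>states (\<not> b). \<Sum>p2\<in>states (\<not> b). ?K p1 p2 * run_sum s p1 p2)"
      by (simp add: s)
  qed
  also have "\<dots> = (\<Sum>p1\<in>states (\<not> b). \<Sum>p2\<in>states (\<not> b). \<Sum>s\<in>{s \<in> canon_terms w. root_op s = Some (\<not> b)}. ?K p1 p2 * run_sum s p1 p2)"
    by (rule sum_rotate_right)
  also have "\<dots> = (\<Sum>p1\<in>states (\<not> b). \<Sum>p2\<in>states (\<not> b). ?K p1 p2 * csum (\<not> b) p1 p2 w)"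
    by (intro sum.cong[OF refl]) (simp add: sum_Ru_root flip: sum_distrib_left)
  finally show ?thesis .
qed

lemma proj_behaviour:
  "proj (behaviour A) w = (\<Sum>i\<in>St \<times> St. (lam A (fst i) * gam A (snd i)) * nsum (fst i) (snd i) w)"
  unfolding proj_def sum_TXT behaviour_Ru nsum_def sum_distrib_left by (rule sum.swap)

end

section \<open>The automaton of an algebraic system\<close>

locale alg_sys =
  fixes Xs :: "nat set" and P :: "nat \<Rightarrow> ('a::finite + nat) list \<Rightarrow> 'k::comm_semiring_1"
    and \<sigma> :: "nat \<Rightarrow> 'a list \<Rightarrow> 'k" and X0 :: nat
  assumes sys: "alg_system Xs P" and propr: "proper_system Xs P" and sol: "is_solution Xs P \<sigma>"
    and quasi: "\<And>X. X \<in> Xs \<Longrightarrow> \<sigma> X [] = 0" and X0: "X0 \<in> Xs"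
begin

text \<open>The start variable is added as an artificial right-hand side, so that a successful run
  moves across this single symbol.\<close>

definition U :: "('a + nat) list set" where
  "U = insert [Inr X0] (\<Union>X\<in>Xs. {u. P X u \<noteq> 0})"

text \<open>Dotted items as in LR parsing: the right-hand side \<open>u\<close> has been read up to
  position \<open>i\<close>. The Boolean is the type of the state; it alternates with the nesting
  depth, since brackets exchange horizontal and vertical states.\<close>

definition QQ :: "(bool \<times> ('a + nat) list \<times> nat) set" where
  "QQ = {(b, u, i). u \<in> U \<and> i \<le> length u}"

lemma finite_supp: "X \<in> Xs \<Longrightarrow> finite {u. P X u \<noteq> 0}"
  using sys by (simp add: alg_system_def)

lemma finite_U: "finite U"
  using sys by (auto simp: U_def alg_system_def)

lemma finite_QQ: "finite QQ"
proof -
  have "QQ = UNIV \<times> (SIGMA u:U. {..length u})" by (auto simp: QQ_def)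
  then show ?thesis using finite_U by simp
qed

lemma U_vars: "u \<in> U \<Longrightarrow> Inr X \<in> set u \<Longrightarrow> X \<in> Xs"
  using sys X0 by (fastforce simp: U_def alg_system_def)

definition enc :: "bool \<times> ('a + nat) list \<times> nat \<Rightarrow> nat" where
  "enc = (SOME e. inj_on e QQ)"

lemma inj_enc: "inj_on enc QQ"
proof -
  obtain e :: "bool \<times> ('a + nat) list \<times> nat \<Rightarrow> nat" where "inj_on e QQ"
    using finite_imp_inj_to_nat_seg[OF finite_QQ] by auto
  then show ?thesis unfolding enc_def by (metis someI_ex)
qed

lemma enc_eq [simp]: "p \<in> QQ \<Longrightarrow> q \<in> QQ \<Longrightarrow> enc p = enc q \<longleftrightarrow> p = q"
  using inj_enc by (simp add: inj_on_eq_iff)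

definition dec :: "nat \<Rightarrow> bool \<times> ('a + nat) list \<times> nat" where
  "dec = inv_into QQ enc"

lemma dec_enc [simp]: "p \<in> QQ \<Longrightarrow> dec (enc p) = p"
  using inj_enc by (simp add: dec_def)

definition Q :: "bool \<Rightarrow> nat set" where
  "Q b = (\<lambda>(u, i). enc (b, u, i)) ` (SIGMA u:U. {..length u})"

text \<open>The bracket symbol is the item in which the bracket was opened, so that the closing
  bracket knows where to continue. Brackets must enclose composed runs, so a production with a
  single letter cannot be bracketed; its weight \<open>P X [Inl a]\<close> is put on the transition
  that crosses \<open>X\<close>.\<close>

definition aut :: "('a, 'k) wpa" where
  "aut = \<lparr> HS = Q True, VS = Q False, Om = Q True \<union> Q False,
     mu = (\<lambda>q1 a q2. case (dec q1, dec q2) of ((b, u, i), (b', u', i')) \<Rightarrow>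
        if i < length u \<and> u' = u \<and> i' = Suc i
        then (case u ! i of Inl a' \<Rightarrow> if a = a' then 1 else 0 | Inr X \<Rightarrow> P X [Inl a]) else 0),
     muop = (\<lambda>q1 o' p1. case (dec q1, dec p1) of ((b, u, i), (b', v, j)) \<Rightarrow>
        if o' = q1 \<and> i < length u \<and> j = 0
        then (case u ! i of Inl _ \<Rightarrow> 0 | Inr X \<Rightarrow> P X v) else 0),
     mucl = (\<lambda>p2 o' q2. case (dec p2, dec o', dec q2) of ((b', v, j), (b, u, i), (c, u', i')) \<Rightarrow>
        if j = length v \<and> u' = u \<and> i' = Suc i then 1 else 0),
     lam = (\<lambda>q. if q = enc (True, [Inr X0], 0) then 1 else 0),
     gam = (\<lambda>q. if q = enc (True, [Inr X0], 1) then 1 else 0) \<rparr>"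

lemma in_QQ [simp]: "(b, u, i) \<in> QQ \<longleftrightarrow> u \<in> U \<and> i \<le> length u"
  by (simp add: QQ_def)

lemma finite_Q: "finite (Q b)"
  unfolding Q_def using finite_U by simp

lemma wf_aut: "wpa_wf aut"
proof -
  have "Q True \<inter> Q False = {}"
    using inj_onD[OF inj_enc] by (fastforce simp: Q_def)
  then show ?thesis using finite_Q by (simp add: wpa_wf_def aut_def)
qed

sublocale W: wf_wpa aut by unfold_locales (rule wf_aut)

lemma Ty_aut: "W.states b = Q b"
  unfolding W.states_def by (simp add: aut_def)

definition symbol_coef :: "'a + nat \<Rightarrow> 'a list \<Rightarrow> 'k" where
  "symbol_coef x = (case x of Inl a \<Rightarrow> charser [a] | Inr X \<Rightarrow> \<sigma> X)"

lemma evalw_Cons: "evalw \<sigma> (x # u) = cauchy (symbol_coef x) (evalw \<sigma> u)"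
  by (cases x) (simp_all add: symbol_coef_def)

lemma sy_Nil: "u \<in> U \<Longrightarrow> x \<in> set u \<Longrightarrow> symbol_coef x [] = 0"
  using U_vars quasi by (auto simp: symbol_coef_def charser_def split: sum.splits)

lemma evalw_Nil: "u \<in> U \<Longrightarrow> set v \<subseteq> set u \<Longrightarrow> v \<noteq> [] \<Longrightarrow> evalw \<sigma> v [] = 0"
  by (cases v) (auto simp: evalw_Cons cauchy_def sy_Nil)

text \<open>Separates the productions handled by letter transitions from those handled by brackets.
  Properness leaves only length at least 2 for the latter.\<close>

lemma sol_split:
  assumes "X \<in> Xs"
  shows "\<sigma> X w = (if length w = 1 then P X [Inl (hd w)] else 0) +
     (\<Sum>v\<in>U. if 1 < length v then P X v * evalw \<sigma> v w else 0)"
proof -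
  let ?e = "\<lambda>v. P X v * evalw \<sigma> v w"
  have P0: "P X [] = 0" "P X [Inr Y] = 0" for Y
    using propr sys assms by (fastforce simp: proper_system_def alg_system_def)+
  have sub: "{u. P X u \<noteq> 0} \<subseteq> U" using assms by (auto simp: U_def)
  have "\<sigma> X w = (\<Sum>v\<in>{u. P X u \<noteq> 0}. ?e v)"
    using sol assms by (auto simp: is_solution_def)
  also have "\<dots> = (\<Sum>v\<in>U \<union> range (\<lambda>a. [Inl a]). ?e v)"
    using sub finite_U by (intro sum.mono_neutral_left) auto
  also have "\<dots> = (\<Sum>v\<in>range (\<lambda>a. [Inl a]) \<union> {v \<in> U. 1 < length v}. ?e v)"
  proof (rule sum.mono_neutral_right)
    show "\<forall>v\<in>U \<union> range (\<lambda>a. [Inl a]) - (range (\<lambda>a. [Inl a]) \<union> {v \<in> U. 1 < length v}). ?e v = 0"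
    proof
      fix v :: "('a + nat) list" assume v: "v \<in> U \<union> range (\<lambda>a. [Inl a]) - (range (\<lambda>a. [Inl a]) \<union> {v \<in> U. 1 < length v})"
      then have "\<not> 1 < length v" by auto
      then consider "v = []" | x where "v = [x]" by (cases v) (auto simp: Suc_lessI)
      then show "?e v = 0"
      proof cases
        case 2
        then show ?thesis using v P0 by (cases x) auto
      qed (simp add: P0)
    qed
  qed (use finite_U in auto)
  also have "\<dots> = (\<Sum>v\<in>range (\<lambda>a. [Inl a]). ?e v) + (\<Sum>v\<in>{v \<in> U. 1 < length v}. ?e v)"
    using finite_U by (intro sum.union_disjoint) auto
  also have "(\<Sum>v\<in>range (\<lambda>a. [Inl a]). ?e v) = (\<Sum>a\<in>UNIV. P X [Inl a] * charser [a] w)"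
    by (subst sum.reindex) (auto simp: inj_on_def)
  also have "\<dots> = (if length w = 1 then P X [Inl (hd w)] else 0)"
  proof (cases "length w = 1")
    case True
    then obtain a where w: "w = [a]" by (auto simp: length_Suc_conv)
    have "(\<Sum>b\<in>UNIV. P X [Inl b] * charser [b] w) = (\<Sum>b\<in>UNIV. if b = a then P X [Inl b] else 0)"
      unfolding w charser_def by (rule sum.cong) auto
    then show ?thesis using w by simp
  qed (auto simp: charser_def intro!: sum.neutral)
  finally show ?thesis using finite_U by (simp add: sum.inter_filter)
qed

definition tval :: "('a + nat) list \<Rightarrow> nat \<Rightarrow> ('a + nat) list \<Rightarrow> nat \<Rightarrow> 'a list \<Rightarrow> 'k" where
  "tval u i u' k w = (if u' = u \<and> i < length u \<and> k = Suc i then symbol_coef (u ! i) w else 0)"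

text \<open>The series spelled between two positions of one right-hand side that are more than
  \<open>n\<close> symbols apart; \<open>n = 0\<close> is the claimed value of \<open>nsum\<close>
  and \<open>n = 1\<close> that of \<open>csum\<close>.\<close>

definition nval :: "nat \<Rightarrow> ('a + nat) list \<Rightarrow> nat \<Rightarrow> ('a + nat) list \<Rightarrow> nat \<Rightarrow> 'a list \<Rightarrow> 'k" where
  "nval n u i u' k w = (if u' = u \<and> i + n < k \<and> k \<le> length u
     then evalw \<sigma> (take (k - i) (drop i u)) w else 0)"

lemma op_cl:
  assumes "u \<in> U" "i \<le> length u" "u' \<in> U" "k \<le> length u'" "v \<in> U" "j \<le> length v" "v' \<in> U" "j' \<le> length v'"
  shows "(\<Sum>o'\<in>Om aut. muop aut (enc (b, u, i)) o' (enc (c, v, j)) * mucl aut (enc (c, v', j')) o' (enc (b, u', k))) =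
    (if i < length u \<and> u' = u \<and> k = Suc i \<and> j = 0 \<and> j' = length v'
     then (case u ! i of Inl _ \<Rightarrow> 0 | Inr X \<Rightarrow> P X v) else 0)"
proof -
  have "enc (b, u, i) \<in> Om aut" using assms by (cases b) (auto simp: aut_def Q_def)
  moreover have "finite (Om aut)" by simp
  moreover have "muop aut (enc (b, u, i)) o' (enc (c, v, j)) * mucl aut (enc (c, v', j')) o' (enc (b, u', k)) =
    (if o' = enc (b, u, i) then (if i < length u \<and> u' = u \<and> k = Suc i \<and> j = 0 \<and> j' = length v'
     then (case u ! i of Inl _ \<Rightarrow> 0 | Inr X \<Rightarrow> P X v) else 0) else 0)" for o'
    using assms by (auto simp: aut_def)
  ultimately show ?thesis by simp
qed

text \<open>Induction on the length of the word. Both factors in \<open>csum\<close> are nonempty,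
  hence covered by the hypothesis, which gives \<open>csum\<close> at \<open>w\<close> for both
  types. One bracket step of type \<open>b\<close> reduces \<open>tsum\<close> to
  \<open>csum\<close> of the other type at the same \<open>w\<close>, and \<open>nsum\<close> is the
  sum of the two.\<close>

lemma sums:
  assumes "u \<in> U" "i \<le> length u" "u' \<in> U" "k \<le> length u'"
  shows "W.tsum b (enc (b, u, i)) (enc (b, u', k)) w = tval u i u' k w \<and>
         W.nsum (enc (b, u, i)) (enc (b, u', k)) w = nval 0 u i u' k w"
  using assms
proof (induction "length w" arbitrary: w b u i u' k rule: less_induct)
  case less
  show ?case
  proof (cases "w = []")
    case True
    then show ?thesis using less.prems
      by (auto simp: tval_def nval_def sy_Nil intro!: evalw_Nil[of u] dest: in_set_takeD in_set_dropD)
  next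
    case ne: False
    have comp: "W.csum b (enc (b, u, i)) (enc (b, u', k)) w = nval 1 u i u' k w"
      if A: "u \<in> U" "i \<le> length u" "u' \<in> U" "k \<le> length u'" for b u i u' k
    proof -
      have c: "cauchy (W.tsum b (enc (b, u, i)) (enc (b, v, j))) (W.nsum (enc (b, v, j)) (enc (b, u', k))) w =
          cauchy (tval u i v j) (nval 0 v j u' k) w" if v: "v \<in> U" "j \<le> length v" for v j
        unfolding cauchy_def
      proof (rule sum.cong[OF refl])
        fix n assume "n \<in> {..length w}"
        then consider "n = 0" | "n = length w" | "0 < n" "n < length w" by fastforce
        then show "W.tsum b (enc (b, u, i)) (enc (b, v, j)) (take n w) * W.nsum (enc (b, v, j)) (enc (b, u', k)) (drop n w) =
            tval u i v j (take n w) * nval 0 v j u' k (drop n w)"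
        proof cases
          case 1
          then show ?thesis using A sy_Nil[of u] by (simp add: tval_def)
        next
          case 2
          have "nval 0 v j u' k [] = 0"
            using v by (auto simp: nval_def intro!: evalw_Nil[of v] dest: in_set_takeD in_set_dropD)
          then show ?thesis using 2 by simp
        next
          case 3
          then show ?thesis using less.hyps[of "take n w" u i v j b] less.hyps[of "drop n w" v j u' k b] A v
            by simp
        qed
      qed
      have "W.csum b (enc (b, u, i)) (enc (b, u', k)) w = (\<Sum>q\<in>(\<lambda>(v, j). enc (b, v, j)) ` (SIGMA v:U. {..length v}).
          cauchy (W.tsum b (enc (b, u, i)) q) (W.nsum q (enc (b, u', k))) w)"
        by (simp add: W.csum_def Ty_aut Q_def)
      also have "\<dots> = (\<Sum>(v, j)\<in>(SIGMA v:U. {..length v}).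
          cauchy (W.tsum b (enc (b, u, i)) (enc (b, v, j))) (W.nsum (enc (b, v, j)) (enc (b, u', k))) w)"
      proof (subst sum.reindex)
        show "inj_on (\<lambda>(v, j). enc (b, v, j)) (SIGMA v:U. {..length v})"
          by (auto simp: inj_on_def)
      qed (simp add: split_def)
      also have "\<dots> = (\<Sum>(v, j)\<in>(SIGMA v:U. {..length v}). cauchy (tval u i v j) (nval 0 v j u' k) w)"
        by (intro sum.cong) (auto simp: c)
      also have "\<dots> = (\<Sum>p\<in>(SIGMA v:U. {..length v}). if p = (u, Suc i) then
          (if i < length u then cauchy (symbol_coef (u ! i)) (nval 0 u (Suc i) u' k) w else 0) else 0)"
      proof (rule sum.cong[OF refl])
        fix p
        have "cauchy (tval u i v j) F w = (if (v, j) = (u, Suc i) then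
            (if i < length u then cauchy (symbol_coef (u ! i)) F w else 0) else 0)" for v j F
        proof (cases "v = u \<and> j = Suc i \<and> i < length u")
          case False
          then have "tval u i v j = (\<lambda>w. 0)" by (auto simp: tval_def fun_eq_iff)
          then show ?thesis using False by (auto simp: cauchy_def)
        qed (simp add: tval_def cauchy_def)
        then show "(case p of (v, j) \<Rightarrow> cauchy (tval u i v j) (nval 0 v j u' k) w) =
           (if p = (u, Suc i) then
             (if i < length u then cauchy (symbol_coef (u ! i)) (nval 0 u (Suc i) u' k) w else 0) else 0)"
          by (cases p) simp
      qed
      also have "\<dots> = (if i < length u then cauchy (symbol_coef (u ! i)) (nval 0 u (Suc i) u' k) w else 0)"
        using finite_U A by (subst sum.delta) auto
      also have "\<dots> = nval 1 u i u' k w"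
      proof (cases "u' = u \<and> Suc i < k \<and> k \<le> length u")
        case True
        then have "take (k - i) (drop i u) = u ! i # take (k - Suc i) (drop (Suc i) u)"
          by (metis Cons_nth_drop_Suc Suc_diff_Suc Suc_lessD less_le_trans take_Suc_Cons)
        then show ?thesis using True by (simp add: nval_def evalw_Cons cauchy_def)
      next
        case False
        then show ?thesis by (auto simp: nval_def cauchy_def)
      qed
      finally show ?thesis .
    qed
    let ?q1 = "enc (b, u, i)" and ?q2 = "enc (b, u', k)"
    have q: "?q1 \<in> W.states b" "?q2 \<in> W.states b" using less.prems by (auto simp: Ty_aut Q_def)
    let ?S = "SIGMA v:U. {..length v}" and ?e = "\<lambda>(v, j). enc (\<not> b, v, j)"
    let ?K = "\<lambda>p1 p2. (\<Sum>o'\<in>Om aut. muop aut ?q1 o' p1 * mucl aut p2 o' ?q2) * W.csum (\<not> b) p1 p2 w"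
    let ?c = "i < length u \<and> u' = u \<and> k = Suc i"
    have inj: "inj_on ?e ?S" by (auto simp: inj_on_def)
    have "(\<Sum>p1\<in>W.states (\<not> b). \<Sum>p2\<in>W.states (\<not> b). ?K p1 p2) = (\<Sum>x\<in>?S. \<Sum>y\<in>?S. ?K (?e x) (?e y))"
      unfolding Ty_aut Q_def sum.reindex[OF inj] by (simp add: o_def)
    also have "\<dots> = (\<Sum>x\<in>?S. \<Sum>y\<in>?S. if y = (fst x, length (fst x)) then
       (if snd x = 0 then if 1 < length (fst x) then if ?c then (case u ! i of Inl _ \<Rightarrow> 0 | Inr X \<Rightarrow> P X (fst x) * evalw \<sigma> (fst x) w) else 0 else 0 else 0) else 0)"
    proof (rule sum.cong[OF refl], rule sum.cong[OF refl])
      fix x y assume "x \<in> ?S" "y \<in> ?S"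
      then obtain v j v' j' where xy: "x = (v, j)" "y = (v', j')" "v \<in> U" "j \<le> length v" "v' \<in> U" "j' \<le> length v'"
        by auto
      show "?K (?e x) (?e y) = (if y = (fst x, length (fst x)) then
       (if snd x = 0 then if 1 < length (fst x) then if ?c then (case u ! i of Inl _ \<Rightarrow> 0 | Inr X \<Rightarrow> P X (fst x) * evalw \<sigma> (fst x) w) else 0 else 0 else 0) else 0)"
        unfolding xy prod.case op_cl[OF less.prems xy(3-6)] comp[OF xy(3-6)] nval_def
        by (cases ?c; cases "u ! i") auto
    qed
    also have "\<dots> = (\<Sum>x\<in>?S. 
       (if snd x = 0 then if 1 < length (fst x) then if ?c then (case u ! i of Inl _ \<Rightarrow> 0 | Inr X \<Rightarrow> P X (fst x) * evalw \<sigma> (fst x) w) else 0 else 0 else 0))"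
      using finite_U by (intro sum.cong refl) (subst sum.delta, auto)
    also have "\<dots> = (\<Sum>v\<in>U. \<Sum>j\<le>length v. if j = 0 then
        (if 1 < length v then if ?c then (case u ! i of Inl _ \<Rightarrow> 0 | Inr X \<Rightarrow> P X v * evalw \<sigma> v w) else 0 else 0) else 0)"
      using finite_U by (subst sum.Sigma) (auto simp: split_def)
    also have "\<dots> = (\<Sum>v\<in>U. if 1 < length v then if ?c then (case u ! i of Inl _ \<Rightarrow> 0 | Inr X \<Rightarrow> P X v * evalw \<sigma> v w) else 0 else 0)"
      by (intro sum.cong refl) simp
    also have "\<dots> = (if ?c then (case u ! i of Inl _ \<Rightarrow> 0 | Inr X \<Rightarrow>
        (\<Sum>v\<in>U. if 1 < length v then P X v * evalw \<sigma> v w else 0)) else 0)"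
    proof (cases ?c)
      case True
      then show ?thesis by (cases "u ! i") (simp_all cong: if_cong)
    next
      case False
      show ?thesis by (simp only: if_not_P[OF False] if_cancel sum.neutral_const)
    qed
    finally have K: "(\<Sum>p1\<in>W.states (\<not> b). \<Sum>p2\<in>W.states (\<not> b). ?K p1 p2) = \<dots>" .
    have t: "W.tsum b ?q1 ?q2 w = tval u i u' k w"
    proof (cases ?c)
      case True
      have mem: "u ! i \<in> set u" using True by simp
      have m: "mu aut ?q1 a ?q2 = (case u ! i of Inl a' \<Rightarrow> if a = a' then 1 else 0 | Inr X \<Rightarrow> P X [Inl a])" for a
        using less.prems True by (simp add: aut_def)
      show ?thesis
      proof (cases "u ! i")
        case (Inl a)
        have "charser [a] w = (if length w = 1 then if hd w = a then 1 else 0 else 0 :: 'k)"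
          by (auto simp: charser_def length_Suc_conv)
        then show ?thesis using True Inl unfolding W.tsum_eq[OF q] K m
          by (simp add: tval_def symbol_coef_def cong: if_cong)
      next
        case (Inr X)
        then have "X \<in> Xs" using mem U_vars less.prems by metis
        then show ?thesis using True Inr sol_split[of X w] unfolding W.tsum_eq[OF q] K m
          by (simp add: tval_def symbol_coef_def)
      qed
    next
      case False
      have "mu aut ?q1 a ?q2 = 0" for a
        using less.prems False by (auto simp: aut_def)
      then show ?thesis using False unfolding W.tsum_eq[OF q] K by (auto simp: tval_def)
    qed
    moreover have "W.nsum ?q1 ?q2 w = nval 0 u i u' k w"
    proof -
      have "take (Suc i - i) (drop i u) = [u ! i]" if "i < length u"
        using that by (simp add: Cons_nth_drop_Suc[symmetric])
      then have "tval u i u' k w + nval 1 u i u' k w = nval 0 u i u' k w"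
        by (auto simp: tval_def nval_def evalw_Cons)
      then show ?thesis unfolding W.nsum_eq[OF q] t comp[OF less.prems] .
    qed
    ultimately show ?thesis by blast
  qed
qed

lemma proj_aut: "proj (behaviour aut) = \<sigma> X0"
proof
  fix w
  let ?a = "enc (True, [Inr X0], 0)" and ?b = "enc (True, [Inr X0], 1)"
  have U0: "[Inr X0] \<in> U" by (simp add: U_def)
  then have in_St: "(?a, ?b) \<in> W.St \<times> W.St"
    by (force simp: W.St_Ty Ty_aut Q_def)
  have "proj (behaviour aut) w = (\<Sum>p\<in>W.St \<times> W.St. if p = (?a, ?b) then W.nsum ?a ?b w else 0)"
    unfolding W.proj_behaviour by (intro sum.cong refl) (auto simp: aut_def)
  also have "\<dots> = W.nsum ?a ?b w" using in_St by (subst sum.delta) auto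
  also have "\<dots> = \<sigma> X0 w" using sums[of "[Inr X0]" 0 "[Inr X0]" 1 True w] U0 by (simp add: nval_def)
  finally show "proj (behaviour aut) w = \<sigma> X0 w" .
qed

end

theorem algebraic_projection:
  fixes S :: "'a::finite list \<Rightarrow> 'k::comm_semiring_1"
  assumes "algebraic S"
  shows "\<exists>R :: 'a ttext \<Rightarrow> 'k. regular_text_series R \<and> proj R = S"
proof -
  from assms obtain Xs P \<sigma> X0 where *: "alg_system Xs P" "proper_system Xs P" "is_solution Xs P \<sigma>"
     "\<forall>X\<in>Xs. \<sigma> X [] = 0" "X0 \<in> Xs" "S = \<sigma> X0"
    unfolding algebraic_def by blast
  interpret alg_sys Xs P \<sigma> X0 using * by unfold_locales auto
  show ?thesis using wf_aut proj_aut *(6)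
    by (intro exI[of _ "behaviour aut"]) (auto simp: regular_text_series_def)
qed

section \<open>First-order definable step functions\<close>

text \<open>A leaf carries its label and the set of all variables whose value it is. Assignments are
  total on infinitely many variables, so this alphabet is infinite; finiteness is demanded of the
  range of a homomorphism instead.\<close>

type_synonym 'a mtrm = "('a \<times> nat set) trm"

primrec mark :: "nat \<Rightarrow> 'a trm \<Rightarrow> (nat \<Rightarrow> nat) \<Rightarrow> 'a mtrm" where
  "mark n (Lf a) f = Lf (a, {x. f x = n})"
| "mark n (Nd b s t) f = Nd b (mark n s f) (mark (n + len s) t f)"

primrec unmark :: "nat \<Rightarrow> 'a mtrm \<Rightarrow> 'a mtrm" where
  "unmark x (Lf p) = Lf (fst p, snd p - {x})"
| "unmark x (Nd b s t) = Nd b (unmark x s) (unmark x t)"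

text \<open>The variants in which \<open>x\<close> is moved to one leaf, in the order of the leaves.
  Only one child of a node receives the mark while the other loses it, which is the recursion
  exploited for all three kinds of quantification.\<close>

primrec marks :: "nat \<Rightarrow> 'a mtrm \<Rightarrow> 'a mtrm list" where
  "marks x (Lf p) = [Lf (fst p, insert x (snd p))]"
| "marks x (Nd b s t) = map (\<lambda>m. Nd b m (unmark x t)) (marks x s) @ map (\<lambda>m. Nd b (unmark x s) m) (marks x t)"

lemma er_mk: "i < n \<or> n + len s \<le> i \<Longrightarrow> mark n s (f(x := i)) = unmark x (mark n s f)"
proof (induction s arbitrary: n)
  case (Lf a)
  then show ?case by auto
next
  case (Nd b s t)
  then show ?case by auto
qed

lemma marks_mk: "marks x (mark n s f) = map (\<lambda>i. mark n s (f(x := i))) [n..<n + len s]"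
proof (induction s arbitrary: n)
  case (Lf a)
  have "{y. (f(x := n)) y = n} = insert x {y. f y = n}" by auto
  then show ?case by simp
next
  case (Nd b s t)
  have "[n..<n + (len s + len t)] = [n..<n + len s] @ [n + len s..<n + len s + len t]"
    by (metis add.assoc le_add1 upt_add_eq_append)
  moreover have "mark n (Nd b s t) (f(x := i)) = Nd b (mark n s (f(x := i))) (unmark x (mark (n + len s) t f))"
    if "i < n + len s" for i using that er_mk[of i "n + len s" t f x] by simp
  moreover have "mark n (Nd b s t) (f(x := i)) = Nd b (unmark x (mark n s f)) (mark (n + len s) t (f(x := i)))"
    if "n + len s \<le> i" for i using that er_mk[of i n s f x] by simp
  ultimately show ?case
    by (auto simp: Nd.IH o_def simp del: fun_upd_apply)
qed

definition hom :: "('a mtrm \<Rightarrow> 's) \<Rightarrow> bool" where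
  "hom h \<longleftrightarrow> (\<exists>ops. \<forall>b m1 m2. h (Nd b m1 m2) = ops b (h m1) (h m2))"

text \<open>A recognizable step function: its value depends only on the class of the marked term in
  a finite congruence. The bound on \<open>f\<close> ensures that every variable marks a
  leaf.\<close>

definition step :: "('a trm \<Rightarrow> (nat \<Rightarrow> nat) \<Rightarrow> 'c) \<Rightarrow> bool" where
  "step F \<longleftrightarrow> (\<exists>(h :: 'a mtrm \<Rightarrow> nat) G. finite (range h) \<and> hom h \<and>
     (\<forall>s f. (\<forall>x. f x < len s) \<longrightarrow> F s f = G (h (mark 0 s f))))"

lemma stepI:
  fixes h :: "'a mtrm \<Rightarrow> 's"
  assumes "finite (range h)" and ops: "\<And>b m1 m2. h (Nd b m1 m2) = ops b (h m1) (h m2)"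
    and F: "\<And>s f. (\<And>x. f x < len s) \<Longrightarrow> F s f = G (h (mark 0 s f))"
  shows "step F"
proof -
  obtain e :: "'s \<Rightarrow> nat" where e: "inj_on e (range h)"
    using finite_imp_inj_to_nat_seg[OF assms(1)] by auto
  define d where "d = inv_into (range h) e"
  have d: "d (e (h m)) = h m" for m using e by (simp add: d_def)
  show ?thesis unfolding step_def
  proof (intro exI[of _ "e \<circ> h"] exI[of _ "G \<circ> d"] conjI)
    show "finite (range (e \<circ> h))" using assms(1) by (simp flip: image_image add: image_comp[symmetric])
    show "hom (e \<circ> h)" unfolding hom_def
      by (intro exI[of _ "\<lambda>b i j. e (ops b (d i) (d j))"]) (simp add: ops d)
  qed (simp add: F d)
qed

lemma step_const: "step (\<lambda>s f. c)"
  by (rule stepI[where h = "\<lambda>_. ()" and ops = "\<lambda>_ _ _. ()" and G = "\<lambda>_. c"]) auto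

lemma step_binop:
  assumes "step F1" "step F2"
  shows "step (\<lambda>s f. c (F1 s f) (F2 s f))"
proof -
  from assms(1) obtain h1 :: "'a mtrm \<Rightarrow> nat" and G1 ops1 where 1: "finite (range h1)"
    "\<And>b m1 m2. h1 (Nd b m1 m2) = ops1 b (h1 m1) (h1 m2)"
    "\<And>s f. (\<And>x. f x < len s) \<Longrightarrow> F1 s f = G1 (h1 (mark 0 s f))"
    unfolding step_def hom_def by metis
  from assms(2) obtain h2 :: "'a mtrm \<Rightarrow> nat" and G2 ops2 where 2: "finite (range h2)"
    "\<And>b m1 m2. h2 (Nd b m1 m2) = ops2 b (h2 m1) (h2 m2)"
    "\<And>s f. (\<And>x. f x < len s) \<Longrightarrow> F2 s f = G2 (h2 (mark 0 s f))"
    unfolding step_def hom_def by metis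
  show ?thesis
  proof (rule stepI[where h = "\<lambda>m. (h1 m, h2 m)" and G = "\<lambda>(i, j). c (G1 i) (G2 j)"
        and ops = "\<lambda>b (i, j) (i', j'). (ops1 b i i', ops2 b j j')"])
    show "finite (range (\<lambda>m. (h1 m, h2 m)))"
      by (rule finite_subset[of _ "range h1 \<times> range h2"]) (use 1(1) 2(1) in auto)
  qed (auto simp: 1 2)
qed

text \<open>A subset construction: the state consists of the class of the term without the mark
  \<open>x\<close> and the set of classes reachable by placing this mark at one leaf.\<close>

lemma step_Ex:
  assumes "step F"
  shows "step (\<lambda>s f. \<exists>i<len s. F s (f(x := i)))"
proof -
  from assms obtain h :: "'a mtrm \<Rightarrow> nat" and G ops where h: "finite (range h)"
    "\<And>b m1 m2. h (Nd b m1 m2) = ops b (h m1) (h m2)"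
    "\<And>s f. (\<And>x. f x < len s) \<Longrightarrow> F s f = G (h (mark 0 s f))"
    unfolding step_def hom_def by metis
  show ?thesis
  proof (rule stepI[where h = "\<lambda>m. (h (unmark x m), h ` set (marks x m))" and G = "\<lambda>(i, S). \<exists>z\<in>S. G z"
        and ops = "\<lambda>b (i, S) (j, T). (ops b i j, (\<lambda>z. ops b z j) ` S \<union> (\<lambda>z. ops b i z) ` T)"])
    show "finite (range (\<lambda>m. (h (unmark x m), h ` set (marks x m))))"
      by (rule finite_subset[of _ "range h \<times> Pow (range h)"]) (use h(1) in auto)
    show "(\<exists>i<len s. F s (f(x := i))) = (case (h (unmark x (mark 0 s f)), h ` set (marks x (mark 0 s f))) of
       (i, S) \<Rightarrow> \<exists>z\<in>S. G z)" if "\<And>x. f x < len s" for s f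
    proof -
      have "F s (f(x := i)) = G (h (mark 0 s (f(x := i))))" if "i < len s" for i
        using that \<open>\<And>x. f x < len s\<close> by (intro h(3)) auto
      then show ?thesis by (auto simp: marks_mk)
    qed
  qed (auto simp: h(2) image_Un image_image)
qed

section \<open>Atomic and first-order formulas on marked terms\<close>

primrec occ :: "nat \<Rightarrow> 'a mtrm \<Rightarrow> bool" where
  "occ x (Lf p) = (x \<in> snd p)"
| "occ x (Nd b s t) = (occ x s \<or> occ x t)"

primrec eq_mark :: "nat \<Rightarrow> nat \<Rightarrow> 'a mtrm \<Rightarrow> bool" where
  "eq_mark x y (Lf p) = (x \<in> snd p \<and> y \<in> snd p)"
| "eq_mark x y (Nd b s t) = (eq_mark x y s \<or> eq_mark x y t)"

primrec lab_mark :: "'a \<Rightarrow> nat \<Rightarrow> 'a mtrm \<Rightarrow> bool" where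
  "lab_mark a x (Lf p) = (fst p = a \<and> x \<in> snd p)"
| "lab_mark a x (Nd b s t) = (lab_mark a x s \<or> lab_mark a x t)"

primrec le1_mark :: "nat \<Rightarrow> nat \<Rightarrow> 'a mtrm \<Rightarrow> bool" where
  "le1_mark x y (Lf p) = (x \<in> snd p \<and> y \<in> snd p)"
| "le1_mark x y (Nd b s t) = (le1_mark x y s \<or> le1_mark x y t \<or> occ x s \<and> occ y t)"

primrec le2_mark :: "nat \<Rightarrow> nat \<Rightarrow> 'a mtrm \<Rightarrow> bool" where
  "le2_mark x y (Lf p) = (x \<in> snd p \<and> y \<in> snd p)"
| "le2_mark x y (Nd b s t) = (le2_mark x y s \<or> le2_mark x y t \<or>
     (if b then occ x s \<and> occ y t else occ y s \<and> occ x t))"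

lemma occ_mk: "occ x (mark n s f) \<longleftrightarrow> n \<le> f x \<and> f x < n + len s"
  by (induction s arbitrary: n) auto

lemma eq_mark_mk: "eq_mark x y (mark n s f) \<longleftrightarrow> f x = f y \<and> n \<le> f x \<and> f x < n + len s"
  by (induction s arbitrary: n) auto

lemma lab_mark_mk: "lab_mark a x (mark n s f) \<longleftrightarrow> n \<le> f x \<and> f x < n + len s \<and> word_of s ! (f x - n) = a"
  by (induction s arbitrary: n) (auto simp: nth_append)

lemma le1_mark_mk: "le1_mark x y (mark n s f) \<longleftrightarrow>
    n \<le> f x \<and> f x < n + len s \<and> n \<le> f y \<and> f y < n + len s \<and> f x \<le> f y"
proof (induction s arbitrary: n)
  case (Nd b s t)
  show ?case unfolding mark.simps le1_mark.simps Nd.IH occ_mk word_of.simps length_append by linarith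
qed auto

lemma le2_mark_mk: "le2_mark x y (mark n s f) \<longleftrightarrow>
    n \<le> f x \<and> n \<le> f y \<and> le2 (snd (text_of s)) (f x - n) (f y - n)"
proof (induction s arbitrary: n)
  case (Lf a)
  then show ?case by (auto simp: le2_def)
next
  case (Nd b s t)
  have *: "le2 (snd (text_of s)) i j \<Longrightarrow> i < len s \<and> j < len s" for i j and s :: "'a trm"
    by (metis le2_in lessThan_iff set_snd_tx)
  consider "f x < n" | "f y < n" | "n \<le> f x" "f x < n + len s" "n \<le> f y" "f y < n + len s"
    | "n + len s \<le> f x" "n + len s \<le> f y" | "n + len s \<le> f x" "n \<le> f y" "f y < n + len s"
    | "n + len s \<le> f y" "n \<le> f x" "f x < n + len s" by linarith
  then show ?case
  proof cases
    case 1
    then show ?thesis by (auto simp: Nd.IH occ_mk)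
  next
    case 2
    then show ?thesis by (auto simp: Nd.IH occ_mk)
  next
    case 3
    then show ?thesis unfolding le2_Nd by (simp add: Nd.IH occ_mk, linarith)
  next
    case 4
    then have "\<not> le2 (snd (text_of s)) (f x - n) (f y - n)" using * by fastforce
    moreover have "len s \<le> f x - n" "len s \<le> f y - n" using 4 by linarith+
    ultimately show ?thesis using 4 unfolding le2_Nd by (simp add: Nd.IH occ_mk)
  next
    case 5
    then have "\<not> le2 (snd (text_of s)) (f x - n) (f y - n)" using *[of s "f x - n" "f y - n"] by linarith
    moreover have "len s \<le> f x - n" "f y - n < len s" "f x - n < len s + len t \<longleftrightarrow> f x < n + len s + len t"
      using 5 by linarith+
    ultimately show ?thesis using 5 unfolding le2_Nd by (auto simp: Nd.IH occ_mk)
  next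
    case 6
    then have "\<not> le2 (snd (text_of s)) (f x - n) (f y - n)" using *[of s "f x - n" "f y - n"] by linarith
    moreover have "len s \<le> f y - n" "f x - n < len s" "f y - n < len s + len t \<longleftrightarrow> f y < n + len s + len t"
      using 6 by linarith+
    ultimately show ?thesis using 6 unfolding le2_Nd by (auto simp: Nd.IH occ_mk)
  qed
qed

text \<open>No set is ever quantified in this fragment, so the set assignment keeps the constant
  value used in \<open>tdo_sem\<close>, and membership atoms are false.\<close>

abbreviation empty_sets :: "nat \<Rightarrow> nat set" where "empty_sets \<equiv> \<lambda>_. {}"

lemma step_atom: "step (\<lambda>s f. asem (text_of s) f empty_sets a)"
proof (cases a)
  case (AEq x y)
  show ?thesis
    by (rule stepI[where h = "eq_mark x y" and ops = "\<lambda>b. (\<or>)" and G = id]) (auto simp: AEq eq_mark_mk)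
next
  case (ALab c x)
  show ?thesis
    by (rule stepI[where h = "lab_mark c x" and ops = "\<lambda>b. (\<or>)" and G = id]) (auto simp: ALab lab_mark_mk)
next
  case (ALe1 x y)
  show ?thesis
    by (rule stepI[where h = "\<lambda>m. (occ x m, occ y m, le1_mark x y m)" and G = "snd \<circ> snd"
          and ops = "\<lambda>b (p, q, r) (p', q', r'). (p \<or> p', q \<or> q', r \<or> r' \<or> p \<and> q')"])
      (auto simp: ALe1 le1_mark_mk)
next
  case (ALe2 x y)
  show ?thesis
    by (rule stepI[where h = "\<lambda>m. (occ x m, occ y m, le2_mark x y m)" and G = "snd \<circ> snd"
          and ops = "\<lambda>b (p, q, r) (p', q', r'). (p \<or> p', q \<or> q', r \<or> r' \<or> (if b then p \<and> q' else q \<and> p'))"])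
      (auto simp: ALe2 le2_mark_mk)
next
  case (AIn x X)
  show ?thesis using step_const[of False] by (simp add: AIn)
qed

primrec fo :: "'a mso \<Rightarrow> bool" where
  "fo (Atm a) = True" | "fo (MOr a b) = (fo a \<and> fo b)" | "fo (MNeg a) = fo a"
| "fo (MEx1 x a) = fo a" | "fo (MEx2 X a) = False"

primrec sat :: "'a ttext \<Rightarrow> (nat \<Rightarrow> nat) \<Rightarrow> 'a mso \<Rightarrow> bool" where
  "sat t f (Atm a) = asem t f empty_sets a"
| "sat t f (MOr a b) = (sat t f a \<or> sat t f b)"
| "sat t f (MNeg a) = (\<not> sat t f a)"
| "sat t f (MEx1 x a) = (\<exists>i<length (fst t). sat t (f(x := i)) a)"
| "sat t f (MEx2 X a) = False"

lemma asem_upd: "abnd1 a < y \<Longrightarrow> asem t (f(y := v)) g a = asem t f g a"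
  by (cases a) auto

lemma sat_upd: "bnd1 a < y \<Longrightarrow> sat t (f(y := v)) a = sat t f a"
proof (induction a arbitrary: f)
  case (MEx1 z a)
  then have "f(y := v, z := i) = f(z := i, y := v)" for i by (intro fun_upd_twist) auto
  moreover have "sat t (f(z := i, y := v)) a = sat t (f(z := i)) a" for i
    using MEx1 by (intro MEx1.IH) simp
  ultimately show ?case by (simp only: sat.simps)
qed (auto simp: asem_upd)

lemma asem_ren1: "abnd1 a < y \<Longrightarrow> asem t f g (aren1 x y a) = asem t (f(x := f y)) g a"
  by (cases a) auto

lemma sat_ren1: "bnd1 a < y \<Longrightarrow> sat t f (ren1 x y a) = sat t (f(x := f y)) a"
proof (induction a arbitrary: f)
  case (MEx1 z a)
  show ?case
  proof (cases "z = x")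
    case False
    have "f(x := f y, z := i) = f(z := i, x := (f(z := i)) y)" for i using MEx1.prems False by auto
    moreover have "sat t (f(z := i)) (ren1 x y a) = sat t (f(z := i, x := (f(z := i)) y)) a" for i
      using MEx1.prems by (intro MEx1.IH) simp
    ultimately show ?thesis using False by (simp only: sat.simps ren1.simps if_False)
  qed (simp only: sat.simps ren1.simps if_True fun_upd_upd simp_thms)
qed (auto simp: asem_ren1)

lemma fo_ren1 [simp]: "fo (ren1 x y a) = fo a"
  by (induction a) auto

lemma sat_conn [simp]:
  "sat t f (MAnd a b) \<longleftrightarrow> sat t f a \<and> sat t f b"
  "sat t f (MImp a b) \<longleftrightarrow> (sat t f a \<longrightarrow> sat t f b)"
  "sat t f (MIff a b) \<longleftrightarrow> (sat t f a \<longleftrightarrow> sat t f b)"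
  "sat t f (MLess x y) \<longleftrightarrow> f x < f y"
  "sat t f (MAll1 x a) \<longleftrightarrow> (\<forall>i<length (fst t). sat t (f(x := i)) a)"
  by (auto simp: MAnd_def MImp_def MIff_def MLess_def MAll1_def)

lemma fo_conn [simp]:
  "fo (MAnd a b) \<longleftrightarrow> fo a \<and> fo b" "fo (MImp a b) \<longleftrightarrow> fo a \<and> fo b" "fo (MIff a b) \<longleftrightarrow> fo a \<and> fo b"
  "fo (MLess x y)" "fo (MAll1 x a) \<longleftrightarrow> fo a"
  by (auto simp: MAnd_def MImp_def MIff_def MLess_def MAll1_def)

lemma prod_indicator:
  "finite A \<Longrightarrow> (\<Prod>i\<in>A. if Q i then 1 else 0 :: 'k::comm_semiring_1) = (if \<forall>i\<in>A. Q i then 1 else 0)"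
  by (induction A rule: finite_induct) auto

text \<open>Only the least witness contributes to an existential quantifier.\<close>

lemma wsem_tr:
  fixes t :: "'a ttext"
  shows "fo \<phi> \<Longrightarrow> wsem t f empty_sets (tr b \<phi> :: ('a, 'k::comm_semiring_1) wf) = (if sat t f \<phi> = b then 1 else 0)"
proof (induction b \<phi> arbitrary: f rule: tr.induct)
  case (6 x a)
  let ?y = "fresh1 x a" and ?n = "length (fst t)"
  have y: "bnd1 a < ?y" "?y \<noteq> x" by (auto simp: fresh1_def)
  have "wsem t (f(x := i)) empty_sets (WAll1 ?y (tr False (MAnd (MLess ?y x) (ren1 x ?y a))) :: ('a, 'k) wf)
      = (if \<forall>j<?n. \<not> (j < i \<and> sat t (f(x := j)) a) then 1 else 0)" for i
  proof -
    have "f(x := i, ?y := j, x := (f(x := i, ?y := j)) ?y) = f(x := j, ?y := j)" for j using y by auto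
    then have "sat t (f(x := i, ?y := j)) (ren1 x ?y a) = sat t (f(x := j)) a" for j
      using sat_ren1[OF y(1), of t "f(x := i, ?y := j)"] sat_upd[OF y(1), of t "f(x := j)" j] by metis
    then have "sat t (f(x := i, ?y := j)) (MAnd (MLess ?y x) (ren1 x ?y a)) \<longleftrightarrow> j < i \<and> sat t (f(x := j)) a" for j
      using y by simp
    moreover have "wsem t (f(x := i, ?y := j)) empty_sets (tr False (MAnd (MLess ?y x) (ren1 x ?y a)) :: ('a, 'k) wf) =
        (if sat t (f(x := i, ?y := j)) (MAnd (MLess ?y x) (ren1 x ?y a)) = False then 1 else 0)" for j
      using 6(3) by (intro 6(2)) simp
    ultimately have "wsem t (f(x := i, ?y := j)) empty_sets (tr False (MAnd (MLess ?y x) (ren1 x ?y a)) :: ('a, 'k) wf) =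
        (if \<not> (j < i \<and> sat t (f(x := j)) a) then 1 else 0)" for j by (simp only: eq_False)
    then show ?thesis by (simp only: wsem.simps prod_indicator[OF finite_lessThan] Ball_def lessThan_iff)
  qed
  then have "wsem t f empty_sets (tr True (MEx1 x a) :: ('a, 'k) wf) = (\<Sum>i<?n. if sat t (f(x := i)) a \<and>
      (\<forall>j<?n. \<not> (j < i \<and> sat t (f(x := j)) a)) then 1 else 0)"
    using 6(1,3) by (auto intro!: sum.cong simp del: wsem.simps(7))
  also have "\<dots> = (if sat t f (MEx1 x a) then 1 else 0)"
  proof (cases "\<exists>i<?n. sat t (f(x := i)) a")
    case True
    define i0 where "i0 = (LEAST i. i < ?n \<and> sat t (f(x := i)) a)"
    have i0: "i0 < ?n \<and> sat t (f(x := i0)) a" unfolding i0_def using True by (rule LeastI_ex)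
    have least: "i0 \<le> j" if "j < ?n" "sat t (f(x := j)) a" for j
      unfolding i0_def using that by (intro Least_le) auto
    have "(\<Sum>i<?n. if sat t (f(x := i)) a \<and> (\<forall>j<?n. \<not> (j < i \<and> sat t (f(x := j)) a)) then 1 else 0)
       = (\<Sum>i<?n. if i = i0 then 1 else 0 :: 'k)"
      using i0 least by (intro sum.cong refl) (auto simp: not_less le_antisym dest: leD)
    then show ?thesis using True i0 by simp
  qed (auto intro!: sum.neutral)
  finally show ?case by simp
qed (auto simp: prod_indicator)

text \<open>The body of a universal quantifier in \<open>sRFO\<close> may be a translated MSO
  formula. Every set quantifier survives the translation as a weighted set quantifier, so its
  absence there forces the original formula to be first-order.\<close>

lemma noSO_tr: "noSO (tr b \<phi>) \<Longrightarrow> fo \<phi>"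
proof (induction \<phi> arbitrary: b)
  case (Atm a) then show ?case by simp
next
  case (MOr a c) then show ?case by (cases b) auto
next
  case (MNeg a) then show ?case by auto
next
  case (MEx1 x a) then show ?case by (cases b) auto
next
  case (MEx2 X a) then show ?case by (cases b) auto
qed

lemma step_sat: "fo \<phi> \<Longrightarrow> step (\<lambda>s f. sat (text_of s) f \<phi>)"
proof (induction \<phi>)
  case (Atm a)
  then show ?case by (simp add: step_atom)
next
  case (MOr a b)
  then show ?case using step_binop[of "\<lambda>s f. sat (text_of s) f a" "\<lambda>s f. sat (text_of s) f b" "(\<or>)"] by simp
next
  case (MNeg a)
  then show ?case
    using step_binop[of "\<lambda>s f. sat (text_of s) f a" "\<lambda>s f. sat (text_of s) f a" "\<lambda>p q. \<not> p"] by simp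
next
  case (MEx1 x a)
  then show ?case using step_Ex[of "\<lambda>s f. sat (text_of s) f a" x] by simp
qed simp

lemma step_aUMSO: "a \<in> aUMSO \<Longrightarrow> noSO a \<Longrightarrow> step (\<lambda>s f. wsem (text_of s) f empty_sets a :: 'k::comm_semiring_1)"
proof (induction rule: aUMSO.induct)
  case (const k)
  then show ?case by (simp add: step_const)
next
  case (unamb \<phi>)
  then have fo: "fo \<phi>" by (rule noSO_tr)
  show ?case
    using step_binop[OF step_sat[OF fo] step_sat[OF fo], of "\<lambda>p q. if p then 1 else 0 :: 'k"]
    by (simp add: wsem_tr[OF fo])
next
  case (conj a b)
  then show ?case using step_binop[of "\<lambda>s f. wsem (text_of s) f empty_sets a" "\<lambda>s f. wsem (text_of s) f empty_sets b" "(*)"] by simp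
next
  case (disj a b)
  then show ?case using step_binop[of "\<lambda>s f. wsem (text_of s) f empty_sets a" "\<lambda>s f. wsem (text_of s) f empty_sets b" "(+)"] by simp
qed

section \<open>Weighted first-order sentences\<close>

text \<open>A weighted bottom-up tree automaton on marked terms: \<open>I\<close> are its states,
  \<open>c\<close> the transition weights, \<open>m\<close> the root weights, and the values of
  \<open>V\<close> at leaves the leaf weights.\<close>

definition wrep :: "('a trm \<Rightarrow> (nat \<Rightarrow> nat) \<Rightarrow> 'k::comm_semiring_1) \<Rightarrow> bool" where
  "wrep F \<longleftrightarrow> (\<exists>(I :: nat set) (V :: 'a mtrm \<Rightarrow> nat \<Rightarrow> 'k) c m. finite I \<and>
     (\<forall>b s t. \<forall>i\<in>I. V (Nd b s t) i = (\<Sum>j\<in>I. \<Sum>k\<in>I. c b i j k * (V s j * V t k))) \<and>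
     (\<forall>s f. (\<forall>x. f x < len s) \<longrightarrow> F s f = (\<Sum>i\<in>I. m i * V (mark 0 s f) i)))"

lemma wrepI:
  fixes I :: "'i set" and V :: "'a mtrm \<Rightarrow> 'i \<Rightarrow> 'k::comm_semiring_1"
  assumes "finite I"
    and V: "\<And>b s t i. i \<in> I \<Longrightarrow> V (Nd b s t) i = (\<Sum>j\<in>I. \<Sum>k\<in>I. c b i j k * (V s j * V t k))"
    and F: "\<And>s f. (\<And>x. f x < len s) \<Longrightarrow> F s f = (\<Sum>i\<in>I. m i * V (mark 0 s f) i)"
  shows "wrep F"
proof -
  obtain e :: "'i \<Rightarrow> nat" where e: "inj_on e I"
    using finite_imp_inj_to_nat_seg[OF assms(1)] by auto
  define d where "d = inv_into I e"
  have d [simp]: "d (e i) = i" if "i \<in> I" for i using that e by (simp add: d_def)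
  show ?thesis unfolding wrep_def
  proof (intro exI[of _ "e ` I"] exI[of _ "\<lambda>s i. V s (d i)"]
      exI[of _ "\<lambda>b i j k. c b (d i) (d j) (d k)"] exI[of _ "\<lambda>i. m (d i)"] conjI allI ballI impI)
    fix b s t i assume "i \<in> e ` I"
    then show "V (Nd b s t) (d i) = (\<Sum>j\<in>e ` I. \<Sum>k\<in>e ` I. c b (d i) (d j) (d k) * (V s (d j) * V t (d k)))"
      using V e by (auto simp: sum.reindex)
  next
    fix s :: "'a trm" and f :: "nat \<Rightarrow> nat" assume "\<forall>x. f x < len s"
    then show "F s f = (\<Sum>i\<in>e ` I. m (d i) * V (mark 0 s f) (d i))"
      using F e by (simp add: sum.reindex)
  qed (use assms in simp)
qed

lemma sum_sum_delta:
  assumes "finite I" "j0 \<in> I" "k0 \<in> I"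
    and "\<And>j k. j \<in> I \<Longrightarrow> k \<in> I \<Longrightarrow> g j k = (if j = j0 \<and> k = k0 then v else 0)"
  shows "(\<Sum>j\<in>I. \<Sum>k\<in>I. g j k) = v"
proof -
  have "(\<Sum>j\<in>I. \<Sum>k\<in>I. g j k) = (\<Sum>j\<in>I. \<Sum>k\<in>I. if j = j0 then if k = k0 then v else 0 else 0)"
    by (rule sum.cong[OF refl], rule sum.cong[OF refl]) (simp add: assms(4))
  also have "\<dots> = (\<Sum>j\<in>I. if j = j0 then \<Sum>k\<in>I. if k = k0 then v else 0 else 0)"
    by (rule sum.cong[OF refl]) simp
  finally show ?thesis using assms by simp
qed

text \<open>A finite congruence is a deterministic automaton: the vector of a term is the unit
  vector of its class, and \<open>G\<close> supplies the root weights.\<close>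

lemma wrep_step:
  fixes F :: "'a trm \<Rightarrow> (nat \<Rightarrow> nat) \<Rightarrow> 'k::comm_semiring_1"
  assumes "step F" shows "wrep F"
proof -
  from assms obtain h :: "'a mtrm \<Rightarrow> nat" and G ops where h: "finite (range h)"
    "\<And>b m1 m2. h (Nd b m1 m2) = ops b (h m1) (h m2)"
    "\<And>s f. (\<And>x. f x < len s) \<Longrightarrow> F s f = G (h (mark 0 s f))"
    unfolding step_def hom_def by metis
  show ?thesis
  proof (rule wrepI[where I = "range h" and V = "\<lambda>m i. if h m = i then 1 else 0"
        and c = "\<lambda>b i j k. if ops b j k = i then 1 else 0" and m = G])
    fix b s t i
    show "(if h (Nd b s t) = i then 1 else 0 :: 'k) = (\<Sum>j\<in>range h. \<Sum>k\<in>range h.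
       (if ops b j k = i then 1 else 0) * ((if h s = j then 1 else 0) * (if h t = k then 1 else 0)))"
      by (rule sum_sum_delta[symmetric, OF h(1), of "h s" "h t"]) (auto simp: h(2))
  next
    fix s :: "'a trm" and f :: "nat \<Rightarrow> nat" assume "\<And>x. f x < len s"
    have "(\<Sum>i\<in>range h. G i * (if h (mark 0 s f) = i then 1 else 0)) =
      (\<Sum>i\<in>range h. if i = h (mark 0 s f) then G i else 0)" by (intro sum.cong) auto
    then show "F s f = (\<Sum>i\<in>range h. G i * (if h (mark 0 s f) = i then 1 else 0))"
      using h \<open>\<And>x. f x < len s\<close> by simp
  qed (rule h(1))
qed

lemma wrep_add:
  fixes F1 F2 :: "'a trm \<Rightarrow> (nat \<Rightarrow> nat) \<Rightarrow> 'k::comm_semiring_1"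
  assumes "wrep F1" "wrep F2" shows "wrep (\<lambda>s f. F1 s f + F2 s f)"
proof -
  from assms(1) obtain I :: "nat set" and V c m where w1_all: "finite I"
    "\<forall>b s t. \<forall>i\<in>I. V (Nd b s t) i = (\<Sum>j\<in>I. \<Sum>k\<in>I. c b i j k * (V s j * V t k))"
    "\<forall>s f. (\<forall>x. f x < len s) \<longrightarrow> F1 s f = (\<Sum>i\<in>I. m i * V (mark 0 s f) i)"
    unfolding wrep_def by blast
  note 1 = w1_all[rule_format]
  from assms(2) obtain J :: "nat set" and W d n where w2_all: "finite J"
    "\<forall>b s t. \<forall>i\<in>J. W (Nd b s t) i = (\<Sum>j\<in>J. \<Sum>k\<in>J. d b i j k * (W s j * W t k))"
    "\<forall>s f. (\<forall>x. f x < len s) \<longrightarrow> F2 s f = (\<Sum>i\<in>J. n i * W (mark 0 s f) i)"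
    unfolding wrep_def by blast
  note 2 = w2_all[rule_format]
  have sp: "(\<Sum>p\<in>I <+> J. g p) = (\<Sum>i\<in>I. g (Inl i)) + (\<Sum>j\<in>J. g (Inr j))" for g :: "nat + nat \<Rightarrow> 'k"
    using 1(1) 2(1) by (simp add: sum.Plus o_def)
  show ?thesis
  proof (rule wrepI[where I = "I <+> J" and V = "\<lambda>s. case_sum (V s) (W s)" and m = "case_sum m n"
       and c = "\<lambda>b i j k. case (i, j, k) of (Inl i, Inl j, Inl k) \<Rightarrow> c b i j k
          | (Inr i, Inr j, Inr k) \<Rightarrow> d b i j k | _ \<Rightarrow> 0"])
    show "case_sum (V (Nd b s t)) (W (Nd b s t)) i = (\<Sum>j\<in>I <+> J. \<Sum>k\<in>I <+> J.
      (case (i, j, k) of (Inl i, Inl j, Inl k) \<Rightarrow> c b i j k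
          | (Inr i, Inr j, Inr k) \<Rightarrow> d b i j k | _ \<Rightarrow> 0) * (case_sum (V s) (W s) j * case_sum (V t) (W t) k))"
      if "i \<in> I <+> J" for b s t i
      unfolding sp using that by (cases i) (auto simp: 1 2)
  qed (use 1 2 in \<open>simp_all add: sp\<close>)
qed

text \<open>The Hadamard product is recognized on pairs of states; commutativity of \<open>K\<close>
  allows the factors of the two automata to be interleaved.\<close>

lemma wrep_mult:
  fixes F1 F2 :: "'a trm \<Rightarrow> (nat \<Rightarrow> nat) \<Rightarrow> 'k::comm_semiring_1"
  assumes "wrep F1" "wrep F2" shows "wrep (\<lambda>s f. F1 s f * F2 s f)"
proof -
  from assms(1) obtain I :: "nat set" and V c m where w1_all: "finite I"
    "\<forall>b s t. \<forall>i\<in>I. V (Nd b s t) i = (\<Sum>j\<in>I. \<Sum>k\<in>I. c b i j k * (V s j * V t k))"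
    "\<forall>s f. (\<forall>x. f x < len s) \<longrightarrow> F1 s f = (\<Sum>i\<in>I. m i * V (mark 0 s f) i)"
    unfolding wrep_def by blast
  note 1 = w1_all[rule_format]
  from assms(2) obtain J :: "nat set" and W d n where w2_all: "finite J"
    "\<forall>b s t. \<forall>i\<in>J. W (Nd b s t) i = (\<Sum>j\<in>J. \<Sum>k\<in>J. d b i j k * (W s j * W t k))"
    "\<forall>s f. (\<forall>x. f x < len s) \<longrightarrow> F2 s f = (\<Sum>i\<in>J. n i * W (mark 0 s f) i)"
    unfolding wrep_def by blast
  note 2 = w2_all[rule_format]
  show ?thesis
  proof (rule wrepI[where I = "I \<times> J" and V = "\<lambda>s p. V s (fst p) * W s (snd p)"
       and m = "\<lambda>p. m (fst p) * n (snd p)"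
       and c = "\<lambda>b i j k. c b (fst i) (fst j) (fst k) * d b (snd i) (snd j) (snd k)"])
    fix b s t and p :: "nat \<times> nat" assume "p \<in> I \<times> J"
    then obtain i j where p: "p = (i, j)" "i \<in> I" "j \<in> J" by auto
    have "V (Nd b s t) i * W (Nd b s t) j =
      (\<Sum>i1\<in>I. \<Sum>i2\<in>I. c b i i1 i2 * (V s i1 * V t i2)) * (\<Sum>j1\<in>J. \<Sum>j2\<in>J. d b j j1 j2 * (W s j1 * W t j2))"
      using 1(2)[OF p(2)] 2(2)[OF p(3)] by simp
    also have "\<dots> = (\<Sum>i1\<in>I. \<Sum>j1\<in>J. \<Sum>i2\<in>I. \<Sum>j2\<in>J.
       (c b i i1 i2 * (V s i1 * V t i2)) * (d b j j1 j2 * (W s j1 * W t j2)))"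
      by (simp only: sum_product)
    also have "\<dots> = (\<Sum>q\<in>I \<times> J. \<Sum>r\<in>I \<times> J.
       (c b i (fst q) (fst r) * (V s (fst q) * V t (fst r))) * (d b j (snd q) (snd r) * (W s (snd q) * W t (snd r))))"
      by (simp only: sum.cartesian_product' fst_conv snd_conv)
    finally show "V (Nd b s t) (fst p) * W (Nd b s t) (snd p) = (\<Sum>q\<in>I \<times> J. \<Sum>r\<in>I \<times> J.
       c b (fst p) (fst q) (fst r) * d b (snd p) (snd q) (snd r) *
       (V s (fst q) * W s (snd q) * (V t (fst r) * W t (snd r))))"
      by (simp add: p ac_simps)
  next
    fix s :: "'a trm" and f :: "nat \<Rightarrow> nat" assume f: "\<And>x. f x < len s"
    have "F1 s f * F2 s f = (\<Sum>i\<in>I. \<Sum>j\<in>J. (m i * V (mark 0 s f) i) * (n j * W (mark 0 s f) j))"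
      using 1(3)[OF f] 2(3)[OF f] by (simp add: sum_product)
    then show "F1 s f * F2 s f = (\<Sum>p\<in>I \<times> J. m (fst p) * n (snd p) * (V (mark 0 s f) (fst p) * W (mark 0 s f) (snd p)))"
      by (simp add: sum.cartesian_product' ac_simps)
  qed (use 1 2 in simp)
qed

lemma sum_marks: "(\<Sum>i<len s. g (mark 0 s (f(x := i)))) = sum_list (map g (marks x (mark 0 s f)))"
  unfolding marks_mk by (simp add: sum_list_distinct_conv_sum_set o_def lessThan_atLeast0)

lemma prod_marks: "(\<Prod>i<len s. g (mark 0 s (f(x := i)))) = prod_list (map g (marks x (mark 0 s f)))"
  unfolding marks_mk by (simp add: prod.distinct_set_conv_list[symmetric] o_def lessThan_atLeast0)

lemma sum_bool: "(\<Sum>p\<in>I \<times> UNIV. g p) = (\<Sum>i\<in>I. g (i, True) + g (i, False))"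
  by (simp add: sum.cartesian_product' UNIV_bool add.commute)

text \<open>The Boolean component tells whether the single mark of \<open>x\<close> lies in the
  subterm; below a marked node exactly one child inherits it. The sum over marks commutes with the
  recursion because the latter is linear in each argument.\<close>

lemma wrep_Ex:
  fixes F :: "'a trm \<Rightarrow> (nat \<Rightarrow> nat) \<Rightarrow> 'k::comm_semiring_1"
  assumes "wrep F" shows "wrep (\<lambda>s f. \<Sum>i<len s. F s (f(x := i)))"
proof -
  from assms obtain I :: "nat set" and V c m where w1_all: "finite I"
    "\<forall>b s t. \<forall>i\<in>I. V (Nd b s t) i = (\<Sum>j\<in>I. \<Sum>k\<in>I. c b i j k * (V s j * V t k))"
    "\<forall>s f. (\<forall>x. f x < len s) \<longrightarrow> F s f = (\<Sum>i\<in>I. m i * V (mark 0 s f) i)"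
    unfolding wrep_def by blast
  note 1 = w1_all[rule_format]
  define M where "M s i = sum_list (map (\<lambda>u. V u i) (marks x s))" for s i
  define V' where "V' s p = (if snd p then M s (fst p) else V (unmark x s) (fst p))" for s and p :: "nat \<times> bool"
  have left: "sum_list (map (\<lambda>u. \<Sum>j\<in>I. \<Sum>k\<in>I. C j k * (V u j * X k)) L) =
      (\<Sum>j\<in>I. \<Sum>k\<in>I. C j k * (sum_list (map (\<lambda>u. V u j) L) * X k))" for C X L
    by (induction L) (simp_all add: sum.distrib algebra_simps)
  have right: "sum_list (map (\<lambda>u. \<Sum>j\<in>I. \<Sum>k\<in>I. C j k * (X j * V u k)) L) =
      (\<Sum>j\<in>I. \<Sum>k\<in>I. C j k * (X j * sum_list (map (\<lambda>u. V u k) L)))" for C X L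
    by (induction L) (simp_all add: sum.distrib algebra_simps)
  have M: "M (Nd b s t) i = (\<Sum>j\<in>I. \<Sum>k\<in>I. c b i j k * (M s j * V (unmark x t) k + V (unmark x s) j * M t k))"
    if "i \<in> I" for b s t i
    unfolding M_def using that by (simp add: 1(2) o_def left right sum.distrib distrib_left)
  show ?thesis
  proof (rule wrepI[where I = "I \<times> UNIV" and V = V' and m = "\<lambda>p. if snd p then m (fst p) else 0"
       and c = "\<lambda>b p q r. if snd p = (snd q \<noteq> snd r) \<and> \<not> (snd q \<and> snd r) then c b (fst p) (fst q) (fst r) else 0"])
    fix b s t and p :: "nat \<times> bool" assume "p \<in> I \<times> UNIV"
    then obtain i B where p: "p = (i, B)" "i \<in> I" by auto
    then show "V' (Nd b s t) p = (\<Sum>q\<in>I \<times> UNIV. \<Sum>r\<in>I \<times> UNIV.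
       (if snd p = (snd q \<noteq> snd r) \<and> \<not> (snd q \<and> snd r) then c b (fst p) (fst q) (fst r) else 0) * (V' s q * V' t r))"
      by (cases B) (simp_all add: sum_bool V'_def M 1(2) sum.distrib distrib_left add.commute)
  next
    fix s :: "'a trm" and f :: "nat \<Rightarrow> nat" assume f: "\<And>x. f x < len s"
    have "(\<Sum>i<len s. F s (f(x := i))) = (\<Sum>i<len s. \<Sum>k\<in>I. m k * V (mark 0 s (f(x := i))) k)"
    proof (rule sum.cong[OF refl])
      fix i assume "i \<in> {..<len s}"
      then have "(f(x := i)) y < len s" for y using f[of y] by simp
      then show "F s (f(x := i)) = (\<Sum>k\<in>I. m k * V (mark 0 s (f(x := i))) k)" by (rule 1(3))
    qed
    also have "\<dots> = (\<Sum>k\<in>I. m k * (\<Sum>i<len s. V (mark 0 s (f(x := i))) k))"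
      by (subst sum.swap) (simp add: sum_distrib_left)
    also have "\<dots> = (\<Sum>k\<in>I. m k * M (mark 0 s f) k)"
      unfolding M_def sum_marks[of "\<lambda>u. V u _"] ..
    finally show "(\<Sum>i<len s. F s (f(x := i))) =
      (\<Sum>p\<in>I \<times> UNIV. (if snd p then m (fst p) else 0) * V' (mark 0 s f) p)"
      by (simp add: sum_bool V'_def)
  qed (use 1 in simp)
qed

text \<open>The state guesses the value \<open>fst p\<close> of the unmarked subterm and, as \<open>snd p\<close>, the weight that the
  context assigns to each value of a marked subterm.\<close>

lemma wrep_All:
  fixes F :: "'a trm \<Rightarrow> (nat \<Rightarrow> nat) \<Rightarrow> 'k::comm_semiring_1"
  assumes "step F" shows "wrep (\<lambda>s f. \<Prod>i<len s. F s (f(x := i)))"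
proof -
  from assms obtain h :: "'a mtrm \<Rightarrow> nat" and G ops where h: "finite (range h)"
    "\<And>b m1 m2. h (Nd b m1 m2) = ops b (h m1) (h m2)"
    "\<And>s f. (\<And>x. f x < len s) \<Longrightarrow> F s f = G (h (mark 0 s f))"
    unfolding step_def hom_def by metis
  let ?A = "range h"
  \<comment> \<open>Passing to a child only reindexes a context weight through \<open>ops\<close>,
    so every weight that arises takes its values among those of \<open>G\<close> on
    \<open>?A\<close>. With value 0 outside \<open>?A\<close> there are finitely many such
    functions; \<open>rs\<close> performs this normalization.\<close>
  define K where "K = {\<kappa>. \<forall>z. (z \<in> ?A \<longrightarrow> \<kappa> z \<in> G ` ?A) \<and> (z \<notin> ?A \<longrightarrow> \<kappa> z = 0)}"
  have finK: "finite K" unfolding K_def using h(1) by (intro finite_set_of_finite_funs) auto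
  define rs where "rs \<kappa> z = (if z \<in> ?A then \<kappa> z else 0)" for \<kappa> :: "nat \<Rightarrow> 'k" and z
  define PV where "PV s \<kappa> = prod_list (map (\<lambda>u. \<kappa> (h u)) (marks x s))" for s and \<kappa> :: "nat \<Rightarrow> 'k"
  have PV_rs: "PV s (rs \<kappa>) = PV s \<kappa>" for s \<kappa> by (simp add: PV_def rs_def)
  define L where "L b a2 \<kappa> = rs (\<lambda>z. \<kappa> (ops b z a2))" for b a2 \<kappa>
  define R where "R b a1 \<kappa> = rs (\<lambda>z. \<kappa> (ops b a1 z))" for b a1 \<kappa>
  have cl: "ops b i j \<in> ?A" if "i \<in> ?A" "j \<in> ?A" for b i j using that h(2) by (metis image_iff rangeI)
  have LK: "L b j \<kappa> \<in> K" and RK: "R b j \<kappa> \<in> K" if "\<kappa> \<in> K" "j \<in> ?A" for b j \<kappa>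
    using that cl by (auto simp: K_def L_def R_def rs_def)
  \<comment> \<open>While the mark runs through one child the other stays unmarked, so its class can
    be absorbed into the context weight: \<open>L\<close> and \<open>R\<close> do this for the left
    and the right child.\<close>
  have PV_Nd: "PV (Nd b s t) \<kappa> = PV s (L b (h (unmark x t)) \<kappa>) * PV t (R b (h (unmark x s)) \<kappa>)" for b s t \<kappa>
    unfolding L_def R_def PV_rs by (simp add: PV_def o_def h(2))
  define V where "V s p = (if h (unmark x s) = fst p then PV s (snd p) else 0)" for s and p :: "nat \<times> (nat \<Rightarrow> 'k)"
  show ?thesis
  proof (rule wrepI[where I = "?A \<times> K" and V = V and m = "\<lambda>p. if snd p = rs G then 1 else 0"
       and c = "\<lambda>b p q r. if ops b (fst q) (fst r) = fst p \<and> snd q = L b (fst r) (snd p)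
          \<and> snd r = R b (fst q) (snd p) then 1 else 0"])
    fix b s t and p :: "nat \<times> (nat \<Rightarrow> 'k)" assume "p \<in> ?A \<times> K"
    then obtain a \<kappa> where p: "p = (a, \<kappa>)" "\<kappa> \<in> K" by auto
    let ?a1 = "h (unmark x s)" and ?a2 = "h (unmark x t)"
    show "V (Nd b s t) p = (\<Sum>q\<in>?A \<times> K. \<Sum>r\<in>?A \<times> K. (if ops b (fst q) (fst r) = fst p \<and>
         snd q = L b (fst r) (snd p) \<and> snd r = R b (fst q) (snd p) then 1 else 0) * (V s q * V t r))"
    proof (rule sum_sum_delta[symmetric, where ?j0.0 = "(?a1, L b ?a2 \<kappa>)" and ?k0.0 = "(?a2, R b ?a1 \<kappa>)"])
      fix q r :: "nat \<times> (nat \<Rightarrow> 'k)"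
      show "(if ops b (fst q) (fst r) = fst p \<and> snd q = L b (fst r) (snd p) \<and> snd r = R b (fst q) (snd p)
          then 1 else 0) * (V s q * V t r) =
          (if q = (?a1, L b ?a2 \<kappa>) \<and> r = (?a2, R b ?a1 \<kappa>) then V (Nd b s t) p else 0)"
        by (cases q; cases r) (auto simp: p V_def PV_Nd h(2))
    qed (use h(1) finK LK RK p in auto)
  next
    fix s :: "'a trm" and f :: "nat \<Rightarrow> nat" assume f: "\<And>x. f x < len s"
    let ?a = "h (unmark x (mark 0 s f))"
    have "rs G \<in> K" by (auto simp: rs_def K_def)
    have "(\<Prod>i<len s. F s (f(x := i))) = (\<Prod>i<len s. G (h (mark 0 s (f(x := i)))))"
    proof (rule prod.cong[OF refl])
      fix i assume "i \<in> {..<len s}"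
      then have "(f(x := i)) y < len s" for y using f[of y] by simp
      then show "F s (f(x := i)) = G (h (mark 0 s (f(x := i))))" by (rule h(3))
    qed
    also have "\<dots> = PV (mark 0 s f) (rs G)"
      unfolding PV_rs unfolding PV_def prod_marks[of "\<lambda>u. G (h u)"] ..
    also have "\<dots> = (\<Sum>p\<in>?A \<times> K. if p = (?a, rs G) then PV (mark 0 s f) (rs G) else 0)"
      using h(1) finK \<open>rs G \<in> K\<close> by simp
    also have "\<dots> = (\<Sum>p\<in>?A \<times> K. (if snd p = rs G then 1 else 0) * V (mark 0 s f) p)"
      by (intro sum.cong refl) (auto simp: V_def)
    finally show "(\<Prod>i<len s. F s (f(x := i))) = \<dots>" .
  qed (use h(1) finK in simp)
qed

lemma wrep_wsem:
  fixes \<phi> :: "('a, 'k::comm_semiring_1) wf"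
  shows "noSO \<phi> \<Longrightarrow> allok \<phi> \<Longrightarrow> wrep (\<lambda>s f. wsem (text_of s) f empty_sets \<phi>)"
proof (induction \<phi>)
  case (WConst k)
  then show ?case by (simp add: wrep_step step_const)
next
  case (WAtm a)
  then show ?case using step_binop[OF step_atom[of a] step_atom[of a], of "\<lambda>p q. if p then 1 else 0 :: 'k"]
    by (simp add: wrep_step)
next
  case (WNAtm a)
  then show ?case using step_binop[OF step_atom[of a] step_atom[of a], of "\<lambda>p q. if p then 0 else 1 :: 'k"]
    by (simp add: wrep_step)
next
  case (WOr a b)
  then show ?case using wrep_add[of "\<lambda>s f. wsem (text_of s) f empty_sets a" "\<lambda>s f. wsem (text_of s) f empty_sets b"] by simp
next
  case (WAnd a b)
  then show ?case using wrep_mult[of "\<lambda>s f. wsem (text_of s) f empty_sets a" "\<lambda>s f. wsem (text_of s) f empty_sets b"] by simp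
next
  case (WEx1 x a)
  then show ?case using wrep_Ex[of "\<lambda>s f. wsem (text_of s) f empty_sets a" x] by simp
next
  case (WAll1 x a)
  then show ?case using wrep_All[OF step_aUMSO, of a x] by simp
qed simp_all

lemma mk_unmarked: "0 < n \<Longrightarrow> mark n s (\<lambda>_. 0) = map_trm (\<lambda>a. (a, {})) s"
  by (induction s arbitrary: n) auto

text \<open>The initial assignment sends every variable to position 0, so the leftmost leaf carries
  all marks and the others none. The Boolean component records whether a subterm contains the
  leftmost leaf; only left children inherit it.\<close>

lemma wrep_algebraic:
  fixes F :: "'a::finite trm \<Rightarrow> (nat \<Rightarrow> nat) \<Rightarrow> 'k::comm_semiring_1"
  assumes "wrep F" shows "algebraic (\<lambda>w. \<Sum>s\<in>canon_terms w. F s (\<lambda>_. 0))"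
proof -
  from assms obtain I :: "nat set" and V c m where w1_all: "finite I"
    "\<forall>b s t. \<forall>i\<in>I. V (Nd b s t) i = (\<Sum>j\<in>I. \<Sum>k\<in>I. c b i j k * (V s j * V t k))"
    "\<forall>s f. (\<forall>x. f x < len s) \<longrightarrow> F s f = (\<Sum>i\<in>I. m i * V (mark 0 s f) i)"
    unfolding wrep_def by blast
  note 1 = w1_all[rule_format]
  define V' where "V' s p = V (if snd p then mark 0 s (\<lambda>_. 0) else map_trm (\<lambda>a. (a, {})) s) (fst p)" for s and p :: "nat \<times> bool"
  have "algebraic (\<lambda>w. \<Sum>s\<in>canon_terms w. \<Sum>p\<in>I \<times> UNIV. (if snd p then m (fst p) else 0) * V' s p)"
  proof (rule bilinear_algebraic[where c = "\<lambda>b p q r. if snd q = snd p \<and> \<not> snd r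
        then c b (fst p) (fst q) (fst r) else 0"])
    fix b s t and p :: "nat \<times> bool" assume "p \<in> I \<times> UNIV"
    then show "V' (Nd b s t) p = (\<Sum>q\<in>I \<times> UNIV. \<Sum>r\<in>I \<times> UNIV. (if snd q = snd p \<and> \<not> snd r
        then c b (fst p) (fst q) (fst r) else 0) * (V' s q * V' t r))"
      by (cases p; cases "snd p") (simp_all add: sum_bool V'_def 1(2) mk_unmarked)
  qed (use 1 in simp)
  moreover have "(\<Sum>p\<in>I \<times> UNIV. (if snd p then m (fst p) else 0) * V' s p) = F s (\<lambda>_. 0)" for s
    using 1(3)[of "\<lambda>_. 0" s] by (simp add: sum_bool V'_def)
  ultimately show ?thesis by simp
qed

theorem tdo_sem_algebraic:
  fixes \<phi> :: "('a::finite, 'k::comm_semiring_1) wf"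
  assumes "\<phi> \<in> sRFO" shows "algebraic (tdo_sem \<phi>)"
  using wrep_algebraic[OF wrep_wsem, of \<phi>] assms by (simp add: sRFO_def flip: tdo_sem_CT)

section \<open>Left derivatives of algebraic series\<close>

text \<open>A type of its own, so that the Cauchy product can become the multiplication of a
  \<open>semiring_1\<close> instance.\<close>

datatype ('a, 'k) ser = Ser (coef: "'a list \<Rightarrow> 'k")

lemma ser_eqI: "(\<And>w. coef S w = coef T w) \<Longrightarrow> S = T"
  by (cases S; cases T) auto

definition der :: "'a \<Rightarrow> ('a, 'k) ser \<Rightarrow> ('a, 'k) ser" where
  "der a S = Ser (\<lambda>w. coef S (a # w))"

lemma coef_der [simp]: "coef (der a S) w = coef S (a # w)"
  by (simp add: der_def)

text \<open>The product rule for left derivatives. It lets \<open>cauchy_assoc\<close> be proved by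
  induction on the word, with a derivative as the new left factor, instead of by rearranging double
  sums.\<close>

lemma cauchy_Cons: "cauchy p q (a # w) = p [] * q (a # w) + cauchy (\<lambda>w. p (a # w)) q w"
  for p q :: "'b list \<Rightarrow> 'c::comm_semiring_1"
proof -
  have "cauchy p q (a # w) = (\<Sum>i\<le>Suc (length w). p (take i (a # w)) * q (drop i (a # w)))"
    by (simp add: cauchy_def)
  also have "\<dots> = p [] * q (a # w) + (\<Sum>i\<le>length w. p (take (Suc i) (a # w)) * q (drop (Suc i) (a # w)))"
    by (subst sum.atMost_Suc_shift) simp
  finally show ?thesis by (simp add: cauchy_def)
qed

lemma cauchy_add_left: "cauchy (\<lambda>w. p w + p' w) q w = cauchy p q w + cauchy p' q w"
  and cauchy_add_right: "cauchy p (\<lambda>w. q w + q' w) w = cauchy p q w + cauchy p q' w"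
  and cauchy_scale: "cauchy (\<lambda>w. k * p w) q w = k * cauchy p q w"
  for p q :: "'b list \<Rightarrow> 'c::comm_semiring_1"
  by (simp_all add: cauchy_def distrib_right distrib_left sum.distrib sum_distrib_left mult.assoc)

lemma cauchy_assoc: "cauchy (cauchy p q) r w = cauchy p (cauchy q r) w"
  for p q r :: "'b list \<Rightarrow> 'c::comm_semiring_1"
proof (induction w arbitrary: p)
  case Nil
  then show ?case by (simp add: cauchy_def mult.assoc)
next
  case (Cons a w)
  have "cauchy (cauchy p q) r (a # w) = cauchy p q [] * r (a # w) +
      cauchy (\<lambda>w. p [] * q (a # w) + cauchy (\<lambda>w. p (a # w)) q w) r w"
    by (simp add: cauchy_Cons)
  also have "\<dots> = p [] * (q [] * r (a # w) + cauchy (\<lambda>w. q (a # w)) r w) +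
      cauchy (\<lambda>w. p (a # w)) (cauchy q r) w"
    unfolding cauchy_add_left cauchy_scale Cons.IH by (simp add: cauchy_def[of _ _ "[]"] algebra_simps)
  also have "\<dots> = cauchy p (cauchy q r) (a # w)"
    by (simp add: cauchy_Cons)
  finally show ?case .
qed

lemma cauchy_one: "cauchy (charser []) q w = q w"
  for q :: "'b list \<Rightarrow> 'c::comm_semiring_1"
proof (cases w)
  case (Cons a v)
  have "cauchy (\<lambda>w. charser [] (a # w) :: 'c) q v = 0"
    by (simp add: cauchy_def charser_def)
  then show ?thesis by (simp add: Cons cauchy_Cons) (simp add: charser_def)
qed (simp add: cauchy_def charser_def)

instantiation ser :: (type, comm_semiring_1) semiring_1
begin
definition "0 = Ser (\<lambda>_. 0)"
definition "1 = Ser (charser [])"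
definition "S + T = Ser (\<lambda>w. coef S w + coef T w)"
definition "S * T = Ser (cauchy (coef S) (coef T))"

instance
proof
  fix S T V :: "('a, 'b) ser"
  show "S + T + V = S + (T + V)" "S + T = T + S" "0 + S = S"
    by (simp_all add: plus_ser_def zero_ser_def ac_simps)
  show "S * T * V = S * (T * V)"
    by (rule ser_eqI) (simp add: times_ser_def cauchy_assoc)
  show "1 * S = S" by (rule ser_eqI) (simp add: times_ser_def one_ser_def cauchy_one)
  show "S * 1 = S" by (rule ser_eqI) (simp add: times_ser_def one_ser_def)
  show "0 * S = 0" "S * 0 = 0" by (simp_all add: times_ser_def zero_ser_def cauchy_def fun_eq_iff)
  show "(S + T) * V = S * V + T * V" "S * (T + V) = S * T + S * V"
    by (simp_all add: times_ser_def plus_ser_def cauchy_add_left cauchy_add_right fun_eq_iff)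
  have "coef (0 :: ('a, 'b) ser) [] \<noteq> coef 1 []" by (simp add: zero_ser_def one_ser_def charser_def)
  then show "(0 :: ('a, 'b) ser) \<noteq> 1" by metis
qed

end

lemma coef_simps [simp]: "coef 0 w = 0" "coef 1 w = (if w = [] then 1 else 0)"
  "coef (S + T) w = coef S w + coef T w"
  by (simp_all add: zero_ser_def one_ser_def plus_ser_def charser_def)

lemma coef_mult: "coef (S * T) w = cauchy (coef S) (coef T) w"
  by (simp add: times_ser_def)

lemma coef_mult_Nil [simp]: "coef (S * T) [] = coef S [] * coef T []"
  by (simp add: coef_mult cauchy_def)

lemma coef_sum: "coef (sum f A) w = (\<Sum>x\<in>A. coef (f x) w)"
  by (induction A rule: infinite_finite_induct) auto

definition const_ser :: "'k \<Rightarrow> ('a, 'k::comm_semiring_1) ser" where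
  "const_ser k = Ser (\<lambda>w. if w = [] then k else 0)"

definition lt :: "'a \<Rightarrow> ('a, 'k::comm_semiring_1) ser" where
  "lt a = Ser (charser [a])"

lemma coef_cst [simp]: "coef (const_ser k) w = (if w = [] then k else 0)"
  by (simp add: const_ser_def)

lemma coef_lt [simp]: "coef (lt a) w = (if w = [a] then 1 else 0)"
  by (simp add: lt_def charser_def)

lemma der_simps [simp]: "der a 0 = 0" "der a 1 = 0" "der a (S + T) = der a S + der a T"
  "der a (const_ser k) = 0" "der a (lt b) = (if a = b then 1 else 0)"
  by (rule ser_eqI, simp)+

lemma coef_cst_mult [simp]: "coef (const_ser k * S) w = k * coef S w"
proof -
  have "coef (const_ser k * S) w = (\<Sum>i\<le>length w. if i = 0 then k * coef S w else 0)"
    unfolding coef_mult cauchy_def by (rule sum.cong) auto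
  then show ?thesis by simp
qed

lemma der_mult: "der a (S * T) = const_ser (coef S []) * der a T + der a S * T"
  by (rule ser_eqI) (simp add: coef_mult[of "der a S"], simp add: coef_mult cauchy_Cons der_def)

lemma der_sum: "der a (sum f A) = (\<Sum>x\<in>A. der a (f x))"
  by (rule ser_eqI) (simp add: coef_sum)

lemma cst_0 [simp]: "const_ser 0 = 0" and cst_1 [simp]: "const_ser 1 = 1"
  and cst_mult: "const_ser (k * l) = const_ser k * const_ser l" and cst_add: "const_ser (k + l) = const_ser k + const_ser l"
  by (rule ser_eqI, simp)+

text \<open>Series do not commute, but constants are central, because \<open>K\<close> is
  commutative; this is what moves coefficients to the front of monomials.\<close>

lemma cst_comm: "S * const_ser k = const_ser k * S"
proof (rule ser_eqI)
  fix w
  have "coef (S * const_ser k) w = (\<Sum>i\<le>length w. if i = length w then k * coef S w else 0)"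
    unfolding coef_mult cauchy_def by (rule sum.cong) (auto simp: mult.commute)
  then show "coef (S * const_ser k) w = coef (const_ser k * S) w" by simp
qed

section \<open>Algebras of series generated by finitely many elements\<close>

definition monomial :: "('g \<Rightarrow> ('a, 'k::comm_semiring_1) ser) \<Rightarrow> 'g list \<Rightarrow> ('a, 'k) ser" where
  "monomial \<rho> \<beta> = prod_list (map \<rho> \<beta>)"

lemma mon_simps [simp]: "monomial \<rho> [] = 1" "monomial \<rho> (g # \<beta>) = \<rho> g * monomial \<rho> \<beta>"
  "monomial \<rho> (\<beta> @ \<beta>') = monomial \<rho> \<beta> * monomial \<rho> \<beta>'"
  by (simp_all add: monomial_def)

text \<open>The linear span of the monomials in the generators. Adding one term at a time gives an
  induction without explicit coefficient families; \<open>Sp_expand\<close> recovers these where a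
  grammar is extracted.\<close>

inductive_set subalg :: "('g \<Rightarrow> ('a, 'k::comm_semiring_1) ser) \<Rightarrow> 'g set \<Rightarrow> ('a, 'k) ser set"
  for \<rho> G where
  zero: "0 \<in> subalg \<rho> G"
| plus: "set \<beta> \<subseteq> G \<Longrightarrow> T \<in> subalg \<rho> G \<Longrightarrow> const_ser k * monomial \<rho> \<beta> + T \<in> subalg \<rho> G"

lemma Sp_add: "S \<in> subalg \<rho> G \<Longrightarrow> T \<in> subalg \<rho> G \<Longrightarrow> S + T \<in> subalg \<rho> G"
  by (induction rule: subalg.induct) (auto simp: add.assoc intro: subalg.plus)

lemma Sp_cst_mon: "set \<beta> \<subseteq> G \<Longrightarrow> const_ser k * monomial \<rho> \<beta> \<in> subalg \<rho> G"
  using subalg.plus[OF _ subalg.zero, of \<beta> G k \<rho>] by simp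

lemma Sp_mon: "set \<beta> \<subseteq> G \<Longrightarrow> monomial \<rho> \<beta> \<in> subalg \<rho> G"
  using Sp_cst_mon[of \<beta> G 1 \<rho>] by simp

lemma Sp_cst: "const_ser k \<in> subalg \<rho> G"
  using Sp_cst_mon[of "[]" G k \<rho>] by simp

lemma Sp_one: "1 \<in> subalg \<rho> G"
  using Sp_cst[of 1] by simp

lemma Sp_gen: "g \<in> G \<Longrightarrow> \<rho> g \<in> subalg \<rho> G"
  using Sp_mon[of "[g]" G \<rho>] by simp

lemma Sp_mult: "S \<in> subalg \<rho> G \<Longrightarrow> T \<in> subalg \<rho> G \<Longrightarrow> S * T \<in> subalg \<rho> G"
proof (induction rule: subalg.induct)
  case zero
  then show ?case by (simp add: subalg.zero)
next
  case (plus \<beta> V k)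
  have "const_ser k * monomial \<rho> \<beta> * T \<in> subalg \<rho> G" using plus(4)
  proof (induction rule: subalg.induct)
    case zero
    then show ?case by (simp add: subalg.zero)
  next
    case (plus \<beta>' V' k')
    have "const_ser k * monomial \<rho> \<beta> * (const_ser k' * monomial \<rho> \<beta>') = const_ser (k * k') * monomial \<rho> (\<beta> @ \<beta>')"
    proof -
      have "const_ser k * monomial \<rho> \<beta> * (const_ser k' * monomial \<rho> \<beta>') = const_ser k * (monomial \<rho> \<beta> * const_ser k') * monomial \<rho> \<beta>'"
        by (simp only: mult.assoc)
      also have "\<dots> = const_ser (k * k') * monomial \<rho> (\<beta> @ \<beta>')"
        by (simp only: cst_comm[of "monomial \<rho> \<beta>"] cst_mult mon_simps mult.assoc)
      finally show ?thesis .
    qed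
    then show ?case using plus \<open>set \<beta> \<subseteq> G\<close> subalg.plus[of "\<beta> @ \<beta>'" G] by (simp add: distrib_left)
  qed
  then show ?case using plus by (simp add: distrib_right Sp_add)
qed

lemma Sp_sum: "(\<And>x. x \<in> A \<Longrightarrow> f x \<in> subalg \<rho> G) \<Longrightarrow> sum f A \<in> subalg \<rho> G"
  by (induction A rule: infinite_finite_induct) (auto intro: Sp_add subalg.zero)

lemma Sp_expand:
  assumes "T \<in> subalg \<rho> G"
  shows "\<exists>B c. finite B \<and> (\<forall>\<beta>\<in>B. set \<beta> \<subseteq> G) \<and> T = (\<Sum>\<beta>\<in>B. const_ser (c \<beta>) * monomial \<rho> \<beta>)"
  using assms
proof induction
  case zero
  then show ?case by (intro exI[of _ "{}"]) auto
next
  case (plus \<beta> T k)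
  then obtain B c where B: "finite B" "\<forall>\<beta>\<in>B. set \<beta> \<subseteq> G" "T = (\<Sum>\<beta>\<in>B. const_ser (c \<beta>) * monomial \<rho> \<beta>)" by blast
  define c' where "c' = (\<lambda>\<gamma>. if \<gamma> \<in> B then c \<gamma> else 0)"
  have T: "T = (\<Sum>\<gamma>\<in>insert \<beta> B. const_ser (c' \<gamma>) * monomial \<rho> \<gamma>)"
    unfolding B(3) using B(1) by (intro sum.mono_neutral_cong_left) (auto simp: c'_def)
  have "(\<Sum>\<gamma>\<in>insert \<beta> B. const_ser (if \<gamma> = \<beta> then k else 0) * monomial \<rho> \<gamma>) = const_ser k * monomial \<rho> \<beta>"
    using B(1) by (subst sum.remove[of _ \<beta>]) (auto intro!: sum.neutral)
  then have "const_ser k * monomial \<rho> \<beta> + T = (\<Sum>\<gamma>\<in>insert \<beta> B. const_ser ((if \<gamma> = \<beta> then k else 0) + c' \<gamma>) * monomial \<rho> \<gamma>)"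
    unfolding T by (simp only: cst_add distrib_right sum.distrib)
  then show ?case using B plus(1)
    by (intro exI[of _ "insert \<beta> B"] exI[of _ "\<lambda>\<gamma>. (if \<gamma> = \<beta> then k else 0) + c' \<gamma>"]) auto
qed

lemma Sp_subst:
  assumes "\<And>g. g \<in> G \<Longrightarrow> \<rho> g \<in> subalg \<nu> H" "T \<in> subalg \<rho> G" shows "T \<in> subalg \<nu> H"
  using assms(2)
proof induction
  case (plus \<beta> T k)
  from \<open>set \<beta> \<subseteq> G\<close> have "monomial \<rho> \<beta> \<in> subalg \<nu> H"
    by (induction \<beta>) (auto intro: Sp_one Sp_mult assms(1))
  then show ?case using plus by (auto intro: Sp_add Sp_mult Sp_cst)
qed (rule subalg.zero)

text \<open>By the product rule a derivative of a monomial is a combination of products in which one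
  generator is derived and the preceding ones are replaced by their constant terms; closure on the
  generators is therefore enough.\<close>

lemma Sp_der:
  assumes "\<And>g. g \<in> G \<Longrightarrow> der a (\<rho> g) \<in> subalg \<rho> G" "T \<in> subalg \<rho> G" shows "der a T \<in> subalg \<rho> G"
  using assms(2)
proof induction
  case (plus \<beta> T k)
  from \<open>set \<beta> \<subseteq> G\<close> have "der a (monomial \<rho> \<beta>) \<in> subalg \<rho> G"
    by (induction \<beta>) (auto simp: der_mult intro!: subalg.zero Sp_add Sp_mult Sp_cst Sp_mon assms(1))
  then show ?case using plus by (auto simp: der_mult intro!: Sp_add Sp_mult Sp_cst)
qed (simp add: subalg.zero)

lemma cauchy_cong:
  "(\<And>i. i \<le> length w \<Longrightarrow> q (drop i w) = q' (drop i w)) \<Longrightarrow> cauchy p q w = cauchy p q' w"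
  by (simp add: cauchy_def)

section \<open>Elimination of left recursion and closure under derivatives\<close>

context alg_sys
begin

definition F :: "nat \<Rightarrow> ('a, 'k) ser" where "F X = Ser (\<sigma> X)"

definition \<rho>0 :: "'a + nat \<Rightarrow> ('a, 'k) ser" where
  "\<rho>0 x = (case x of Inl a \<Rightarrow> lt a | Inr X \<Rightarrow> F X)"

abbreviation supp :: "nat \<Rightarrow> ('a + nat) list set" where "supp X \<equiv> {u. P X u \<noteq> 0}"

lemma supp_vars: "X \<in> Xs \<Longrightarrow> u \<in> supp X \<Longrightarrow> Inr Y \<in> set u \<Longrightarrow> Y \<in> Xs"
  using sys by (auto simp: alg_system_def)

lemma coef_mon: "coef (monomial \<rho>0 u) = evalw \<sigma> u"
proof (induction u)
  case Nil
  then show ?case by (simp add: one_ser_def del: coef_simps)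
next
  case (Cons x u)
  then show ?case by (cases x) (auto simp: \<rho>0_def F_def lt_def times_ser_def)
qed

lemma F_eq: "X \<in> Xs \<Longrightarrow> F X = (\<Sum>u\<in>supp X. const_ser (P X u) * monomial \<rho>0 u)"
  by (rule ser_eqI) (use sol in \<open>auto simp: coef_sum coef_mon F_def is_solution_def\<close>)

lemma F_Nil: "X \<in> Xs \<Longrightarrow> coef (F X) [] = 0"
  by (simp add: F_def quasi)

definition suppL :: "nat \<Rightarrow> ('a + nat) list set" where
  "suppL X = {u \<in> supp X. \<exists>a u'. u = Inl a # u'}"

definition suppV :: "nat \<Rightarrow> nat \<Rightarrow> ('a + nat) list set" where
  "suppV Y X = {u \<in> supp X. \<exists>u'. u = Inr Y # u'}"

text \<open>The system is read as a linear equation F = B + F M for row vectors. \<open>Bs\<close>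
  collects the productions that start with a letter, and the matrix \<open>Ms\<close> has as entry
  (Y, X) the tails of the productions of X that start with Y; these tails may again contain
  variables.\<close>

definition Bs :: "nat \<Rightarrow> ('a, 'k) ser" where
  "Bs X = (\<Sum>u\<in>suppL X. const_ser (P X u) * monomial \<rho>0 u)"

definition Ms :: "nat \<Rightarrow> nat \<Rightarrow> ('a, 'k) ser" where
  "Ms Y X = (\<Sum>u\<in>suppV Y X. const_ser (P X u) * monomial \<rho>0 (tl u))"

lemma F_lin:
  assumes X: "X \<in> Xs"
  shows "F X = Bs X + (\<Sum>Y\<in>Xs. F Y * Ms Y X)"
proof -
  let ?t = "\<lambda>u. const_ser (P X u) * monomial \<rho>0 u"
  have P0: "P X [] = 0" using propr X by (simp add: proper_system_def)
  have "supp X = suppL X \<union> (\<Union>Y\<in>Xs. suppV Y X)"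
  proof (intro equalityI subsetI)
    fix u assume u: "u \<in> supp X"
    then obtain x u' where "u = x # u'" using P0 by (cases u) auto
    then show "u \<in> suppL X \<union> (\<Union>Y\<in>Xs. suppV Y X)"
      using u supp_vars[OF X u] by (cases x) (auto simp: suppL_def suppV_def)
  qed (auto simp: suppL_def suppV_def)
  then have "F X = (\<Sum>u\<in>suppL X \<union> (\<Union>Y\<in>Xs. suppV Y X). ?t u)" using F_eq[OF X] by simp
  also have "\<dots> = Bs X + (\<Sum>u\<in>(\<Union>Y\<in>Xs. suppV Y X). ?t u)"
    unfolding Bs_def using finite_supp[OF X] sys
    by (intro sum.union_disjoint) (auto simp: suppL_def suppV_def alg_system_def)
  also have "(\<Sum>u\<in>(\<Union>Y\<in>Xs. suppV Y X). ?t u) = (\<Sum>Y\<in>Xs. \<Sum>u\<in>suppV Y X. ?t u)"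
    using finite_supp[OF X] sys by (intro sum.UNION_disjoint) (auto simp: suppV_def alg_system_def)
  also have "\<dots> = (\<Sum>Y\<in>Xs. F Y * Ms Y X)"
    unfolding Ms_def sum_distrib_left
  proof (intro sum.cong refl)
    fix Y u assume "u \<in> suppV Y X"
    then have "monomial \<rho>0 u = F Y * monomial \<rho>0 (tl u)" by (auto simp: suppV_def \<rho>0_def)
    then show "?t u = F Y * (const_ser (P X u) * monomial \<rho>0 (tl u))"
      by (simp add: mult.assoc[symmetric] cst_comm[of "F Y"])
  qed
  finally show ?thesis .
qed

lemma \<rho>0_Nil: "X \<in> Xs \<Longrightarrow> u \<in> supp X \<Longrightarrow> x \<in> set u \<Longrightarrow> coef (\<rho>0 x) [] = 0"
  using supp_vars F_Nil by (cases x) (auto simp: \<rho>0_def)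

lemma Bs_Nil: "X \<in> Xs \<Longrightarrow> coef (Bs X) [] = 0"
  by (auto simp: Bs_def coef_sum suppL_def \<rho>0_def intro!: sum.neutral)

text \<open>Properness forbids a production that is a single variable, so the tail is nonempty, and
  none of its symbols derives the empty word.\<close>

lemma Ms_Nil:
  assumes X: "X \<in> Xs" shows "coef (Ms Y X) [] = 0"
proof -
  have "coef (monomial \<rho>0 (tl u)) [] = 0" if u_in: "u \<in> suppV Y X" for u
  proof -
    obtain u' where u: "u = Inr Y # u'" "u \<in> supp X" using u_in unfolding suppV_def by blast
    have "Y \<in> Xs" using supp_vars[OF X u(2)] u(1) by simp
    then have "u' \<noteq> []" using u propr X by (auto simp: proper_system_def)
    then obtain x u'' where "u' = x # u''" by (cases u') auto
    then show ?thesis using \<rho>0_Nil[OF X u(2), of x] u by simp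
  qed
  then show ?thesis by (simp add: Ms_def coef_sum)
qed

primrec Mp :: "nat \<Rightarrow> nat \<Rightarrow> nat \<Rightarrow> ('a, 'k) ser" where
  "Mp 0 Y X = (if Y = X then 1 else 0)"
| "Mp (Suc k) Y X = (\<Sum>Z\<in>Xs. Ms Y Z * Mp k Z X)"

lemma finite_Xs: "finite Xs" using sys by (simp add: alg_system_def)

lemma Mp_1:
  assumes "X \<in> Xs" shows "Mp (Suc 0) Y X = Ms Y X"
proof -
  have "Mp (Suc 0) Y X = (\<Sum>Z\<in>Xs. if Z = X then Ms Y Z else 0)"
    by (auto intro!: sum.cong)
  then show ?thesis using assms finite_Xs by simp
qed

text \<open>Each factor in a power of the matrix consumes at least one letter.\<close>

lemma Mp_vanish: "X \<in> Xs \<Longrightarrow> length w < k \<Longrightarrow> coef (Mp k Y X) w = 0"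
proof (induction k arbitrary: Y w)
  case (Suc k)
  have "cauchy (coef (Ms Y Z)) (coef (Mp k Z X)) w = 0" if "Z \<in> Xs" for Z
    unfolding cauchy_def
  proof (rule sum.neutral, rule ballI)
    fix i assume "i \<in> {..length w}"
    then show "coef (Ms Y Z) (take i w) * coef (Mp k Z X) (drop i w) = 0"
      using Ms_Nil[OF that] Suc by (cases "i = 0 \<or> w = []") (auto intro!: Suc.IH)
  qed
  then show ?case by (simp add: coef_sum coef_mult)
qed simp

text \<open>The entries of the sum of all positive powers of \<open>Ms\<close>. The sum is locally
  finite: at \<open>w\<close> powers beyond \<open>length w\<close> vanish, so it may be truncated
  there or at any larger bound.\<close>

definition R :: "nat \<Rightarrow> nat \<Rightarrow> ('a, 'k) ser" where
  "R Y X = Ser (\<lambda>w. \<Sum>k=1..length w. coef (Mp k Y X) w)"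

lemma R_trunc:
  assumes "X \<in> Xs" "length w \<le> N"
  shows "coef (R Y X) w = coef (\<Sum>k=1..N. Mp k Y X) w"
  unfolding R_def coef_sum ser.sel using assms
  by (intro sum.mono_neutral_left) (auto intro!: Mp_vanish)

lemma coef_mult_R:
  assumes "X \<in> Xs"
  shows "coef (T * R Z X) w = coef (T * (\<Sum>k=1..length w. Mp k Z X)) w"
  unfolding coef_mult by (rule cauchy_cong, rule R_trunc) (use assms in auto)

lemma R_eq:
  assumes X: "X \<in> Xs"
  shows "R Y X = Ms Y X + (\<Sum>Z\<in>Xs. Ms Y Z * R Z X)"
proof (rule ser_eqI)
  fix w :: "'a list"
  let ?N = "length w"
  have "coef (\<Sum>Z\<in>Xs. Ms Y Z * R Z X) w = coef (\<Sum>Z\<in>Xs. \<Sum>k=1..?N. Ms Y Z * Mp k Z X) w"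
    unfolding coef_sum[of _ Xs] coef_mult_R[OF X] sum_distrib_left ..
  also have "(\<Sum>Z\<in>Xs. \<Sum>k=1..?N. Ms Y Z * Mp k Z X) = (\<Sum>k=1..?N. Mp (Suc k) Y X)"
    by (subst sum.swap) simp
  also have "\<dots> = (\<Sum>k=Suc 1..Suc ?N. Mp k Y X)"
    by (rule sum.shift_bounds_cl_Suc_ivl[symmetric])
  finally have "coef (Ms Y X + (\<Sum>Z\<in>Xs. Ms Y Z * R Z X)) w = coef (Mp (Suc 0) Y X + (\<Sum>k=Suc 1..Suc ?N. Mp k Y X)) w"
    unfolding Mp_1[OF X] by simp
  also have "Mp (Suc 0) Y X + (\<Sum>k=Suc 1..Suc ?N. Mp k Y X) = (\<Sum>k=1..Suc ?N. Mp k Y X)"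
    by (subst sum.atLeast_Suc_atMost[of 1]) simp_all
  finally show "coef (R Y X) w = coef (Ms Y X + (\<Sum>Z\<in>Xs. Ms Y Z * R Z X)) w"
    using R_trunc[OF X, of w "Suc ?N" Y] by simp
qed

text \<open>The equation F = B + F M is substituted into itself \<open>N\<close> times; the
  remainder contains a power that vanishes on words of length at most \<open>N\<close>.\<close>

lemma F_iter:
  assumes X: "X \<in> Xs"
  shows "F X = (\<Sum>Y\<in>Xs. Bs Y * (\<Sum>k\<le>N. Mp k Y X)) + (\<Sum>Y\<in>Xs. F Y * Mp (Suc N) Y X)"
proof (induction N)
  case 0
  have "(\<Sum>Y\<in>Xs. Bs Y * Mp 0 Y X) = (\<Sum>Y\<in>Xs. if Y = X then Bs Y else 0)"
    by (auto intro!: sum.cong)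
  also have "\<dots> = Bs X" using X finite_Xs by simp
  finally show ?case using F_lin[OF X] by (simp only: Mp_1[OF X]) simp
next
  case (Suc N)
  have "(\<Sum>Y\<in>Xs. F Y * Mp (Suc N) Y X) = (\<Sum>Y\<in>Xs. (Bs Y + (\<Sum>Z\<in>Xs. F Z * Ms Z Y)) * Mp (Suc N) Y X)"
    using F_lin by (intro sum.cong refl) (metis)
  also have "\<dots> = (\<Sum>Y\<in>Xs. Bs Y * Mp (Suc N) Y X) + (\<Sum>Y\<in>Xs. \<Sum>Z\<in>Xs. F Z * (Ms Z Y * Mp (Suc N) Y X))"
    by (simp only: distrib_right sum.distrib sum_distrib_right mult.assoc)
  also have "(\<Sum>Y\<in>Xs. \<Sum>Z\<in>Xs. F Z * (Ms Z Y * Mp (Suc N) Y X)) = (\<Sum>Z\<in>Xs. F Z * Mp (Suc (Suc N)) Z X)"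
    by (subst sum.swap) (simp only: Mp.simps(2)[of "Suc N"] sum_distrib_left)
  finally have eq: "(\<Sum>Y\<in>Xs. F Y * Mp (Suc N) Y X) = (\<Sum>Y\<in>Xs. Bs Y * Mp (Suc N) Y X) +
     (\<Sum>Z\<in>Xs. F Z * Mp (Suc (Suc N)) Z X)" .
  have "F X = (\<Sum>Y\<in>Xs. Bs Y * (\<Sum>k\<le>N. Mp k Y X)) + (\<Sum>Y\<in>Xs. Bs Y * Mp (Suc N) Y X) +
     (\<Sum>Z\<in>Xs. F Z * Mp (Suc (Suc N)) Z X)"
    using Suc unfolding eq by (simp only: add.assoc)
  then show ?case by (simp only: sum.atMost_Suc distrib_left sum.distrib)
qed

text \<open>Greibach's trick: eliminating the left recursion \<open>F = B + F M\<close> gives \<open>F = B + B M\<^sup>+\<close>.\<close>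

lemma F_Bs_R:
  assumes X: "X \<in> Xs"
  shows "F X = Bs X + (\<Sum>Y\<in>Xs. Bs Y * R Y X)"
proof (rule ser_eqI)
  fix w :: "'a list"
  let ?N = "length w"
  have "coef (F Y * Mp (Suc ?N) Y X) w = 0" for Y
    unfolding coef_mult cauchy_def by (intro sum.neutral ballI) (use Mp_vanish[OF X] in \<open>simp del: Mp.simps\<close>)
  then have "coef (F X) w = coef (\<Sum>Y\<in>Xs. Bs Y * (\<Sum>k\<le>?N. Mp k Y X)) w"
    by (subst F_iter[OF X, of ?N]) (simp add: coef_sum del: Mp.simps)
  also have "(\<Sum>k\<le>?N. Mp k Y X) = Mp 0 Y X + (\<Sum>k=1..?N. Mp k Y X)" for Y
    unfolding atMost_atLeast0 by (subst sum.atLeast_Suc_atMost[of 0]) simp_all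
  then have "(\<Sum>Y\<in>Xs. Bs Y * (\<Sum>k\<le>?N. Mp k Y X)) =
     (\<Sum>Y\<in>Xs. Bs Y * Mp 0 Y X) + (\<Sum>Y\<in>Xs. Bs Y * (\<Sum>k=1..?N. Mp k Y X))"
    by (simp only: distrib_left sum.distrib)
  also have "(\<Sum>Y\<in>Xs. Bs Y * Mp 0 Y X) = (\<Sum>Y\<in>Xs. if Y = X then Bs Y else 0)"
    by (auto intro!: sum.cong)
  also have "\<dots> = Bs X" using X finite_Xs by simp
  finally show "coef (F X) w = coef (Bs X + (\<Sum>Y\<in>Xs. Bs Y * R Y X)) w"
    by (simp only: coef_simps coef_sum[of _ Xs] coef_mult_R[OF X])
qed

definition \<rho> :: "('a + nat) + (nat \<times> nat) \<Rightarrow> ('a, 'k) ser" where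
  "\<rho> g = (case g of Inl x \<Rightarrow> \<rho>0 x | Inr (Y, X) \<Rightarrow> R Y X)"

definition G :: "(('a + nat) + (nat \<times> nat)) set" where
  "G = Inl ` (range Inl \<union> Inr ` Xs) \<union> Inr ` (Xs \<times> Xs)"

lemma mon_Sp:
  assumes "\<And>Y. Inr Y \<in> set u \<Longrightarrow> Y \<in> Xs" shows "monomial \<rho>0 u \<in> subalg \<rho> G"
proof -
  have "monomial \<rho>0 u = monomial \<rho> (map Inl u)" by (simp add: monomial_def \<rho>_def o_def)
  moreover have "set (map Inl u) \<subseteq> G"
  proof
    fix g :: "('a + nat) + (nat \<times> nat)" assume "g \<in> set (map Inl u)"
    then obtain x where x: "g = Inl x" "x \<in> set u" by auto
    then show "g \<in> G" using assms by (cases x) (auto simp: G_def)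
  qed
  ultimately show ?thesis by (simp add: Sp_mon)
qed

lemma R_Sp: "X \<in> Xs \<Longrightarrow> Y \<in> Xs \<Longrightarrow> R Y X \<in> subalg \<rho> G"
  using Sp_gen[of "Inr (Y, X)" G \<rho>] by (auto simp: \<rho>_def G_def)

lemma der_Bs: "X \<in> Xs \<Longrightarrow> der a (Bs X) \<in> subalg \<rho> G"
  unfolding Bs_def der_sum
proof (rule Sp_sum)
  fix u assume X: "X \<in> Xs" and "u \<in> suppL X"
  then obtain b u' where u: "u = Inl b # u'" "u \<in> supp X" by (auto simp: suppL_def)
  have "monomial \<rho>0 u' \<in> subalg \<rho> G" using supp_vars[OF X u(2)] u(1) by (intro mon_Sp) auto
  then show "der a (const_ser (P X u) * monomial \<rho>0 u) \<in> subalg \<rho> G"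
    unfolding u(1) by (auto simp: der_mult \<rho>0_def intro!: Sp_mult Sp_cst subalg.zero)
qed

text \<open>After the elimination every summand begins with some \<open>Bs Y\<close>, that is, with
  a letter. The derivative strikes this letter and leaves a polynomial in the generators.\<close>

lemma der_F: "X \<in> Xs \<Longrightarrow> der a (F X) \<in> subalg \<rho> G"
  by (subst F_Bs_R) (auto simp: der_sum der_mult Bs_Nil intro!: Sp_add Sp_sum Sp_mult der_Bs R_Sp)

lemma der_\<rho>0: "(\<And>Y. x = Inr Y \<Longrightarrow> Y \<in> Xs) \<Longrightarrow> der a (\<rho>0 x) \<in> subalg \<rho> G"
  by (cases x) (auto simp: \<rho>0_def intro: der_F Sp_one subalg.zero)

text \<open>The tails may start with a variable, but its derivative is already known from
  \<open>der_F\<close>, and its zero constant term keeps the rest of the tail from being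
  derived.\<close>

lemma der_Ms: "X \<in> Xs \<Longrightarrow> der a (Ms Y X) \<in> subalg \<rho> G"
  unfolding Ms_def der_sum
proof (rule Sp_sum)
  fix u assume X: "X \<in> Xs" and "u \<in> suppV Y X"
  then obtain u' where u: "u = Inr Y # u'" "u \<in> supp X" by (auto simp: suppV_def)
  have "der a (monomial \<rho>0 u') \<in> subalg \<rho> G"
  proof (cases u')
    case (Cons x v)
    have "monomial \<rho>0 v \<in> subalg \<rho> G" "der a (\<rho>0 x) \<in> subalg \<rho> G" "coef (\<rho>0 x) [] = 0"
      using supp_vars[OF X u(2)] \<rho>0_Nil[OF X u(2), of x] u(1) Cons by (auto intro!: mon_Sp der_\<rho>0)
    then show ?thesis by (simp add: Cons der_mult Sp_mult)
  qed (simp add: subalg.zero)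
  then show "der a (const_ser (P X u) * monomial \<rho>0 (tl u)) \<in> subalg \<rho> G"
    unfolding u(1) by (auto simp: der_mult intro!: Sp_mult Sp_cst)
qed

lemma der_R: "X \<in> Xs \<Longrightarrow> der a (R Y X) \<in> subalg \<rho> G" if "Y \<in> Xs"
  by (subst R_eq) (auto simp: der_sum der_mult Ms_Nil intro!: Sp_add Sp_sum Sp_mult der_Ms R_Sp)

lemma R_Nil: "coef (R Y X) [] = 0"
  by (simp add: R_def)

lemma der_closed:
  "finite G \<and> Inl (Inr X0) \<in> G \<and> \<sigma> X0 = coef (\<rho> (Inl (Inr X0))) \<and>
   (\<forall>g\<in>G. coef (\<rho> g) [] = 0 \<and> (\<forall>a. der a (\<rho> g) \<in> subalg \<rho> G))"
proof (intro conjI ballI)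
  fix g assume "g \<in> G"
  then consider a where "g = Inl (Inl a)" | X where "g = Inl (Inr X)" "X \<in> Xs"
    | Y X where "g = Inr (Y, X)" "X \<in> Xs" "Y \<in> Xs"
    by (auto simp: G_def)
  then have "coef (\<rho> g) [] = 0 \<and> (\<forall>a. der a (\<rho> g) \<in> subalg \<rho> G)"
    by cases (auto simp: \<rho>_def \<rho>0_def R_Nil F_Nil intro: der_F der_R Sp_one subalg.zero)
  then show "coef (\<rho> g) [] = 0" "\<forall>a. der a (\<rho> g) \<in> subalg \<rho> G" by auto
qed (use finite_Xs X0 in \<open>auto simp: G_def \<rho>_def \<rho>0_def F_def\<close>)

end

lemma algebraic_der_closed:
  fixes S :: "'a::finite list \<Rightarrow> 'k::comm_semiring_1"
  assumes "algebraic S"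
  shows "\<exists>(\<rho> :: ('a + nat) + (nat \<times> nat) \<Rightarrow> ('a, 'k) ser) G g. finite G \<and> g \<in> G \<and> S = coef (\<rho> g) \<and>
    (\<forall>g\<in>G. coef (\<rho> g) [] = 0 \<and> (\<forall>a. der a (\<rho> g) \<in> subalg \<rho> G))"
proof -
  from assms obtain Xs P \<sigma> X0 where *: "alg_system Xs P" "proper_system Xs P" "is_solution Xs P \<sigma>"
     "\<forall>X\<in>Xs. \<sigma> X [] = 0" "X0 \<in> Xs" "S = \<sigma> X0"
    unfolding algebraic_def by blast
  interpret alg_sys Xs P \<sigma> X0 using * by unfold_locales auto
  show ?thesis using der_closed *(6) by blast
qed

section \<open>Encoding derivations by texts\<close>

definition symbol_ser :: "(nat \<Rightarrow> ('a, 'k::comm_semiring_1) ser) \<Rightarrow> 'a + nat \<Rightarrow> ('a, 'k) ser" where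
  "symbol_ser L x = (case x of Inl a \<Rightarrow> lt a | Inr j \<Rightarrow> L j)"

text \<open>A grammar in which the length \<open>j\<close> of the terminal prefix \<open>u\<close> of a right-hand side
  \<open>u \<gamma>\<close> determines its left-hand side, the nonterminal \<open>j\<close>.\<close>

locale pieces =
  fixes J :: "nat set" and L :: "nat \<Rightarrow> ('a::finite, 'k::comm_semiring_1) ser"
    and C :: "nat \<Rightarrow> 'a list \<Rightarrow> ('a + nat) list \<Rightarrow> 'k" and \<Gamma> :: "('a + nat) list set"
  assumes finJ: "finite J" and J2: "j \<in> J \<Longrightarrow> 2 \<le> j" and fin\<Gamma>: "finite \<Gamma>"
    and \<Gamma>_ne: "\<gamma> \<in> \<Gamma> \<Longrightarrow> \<gamma> \<noteq> []" and \<Gamma>_J: "\<gamma> \<in> \<Gamma> \<Longrightarrow> Inr j \<in> set \<gamma> \<Longrightarrow> j \<in> J"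
    and C_out: "\<gamma> \<notin> \<Gamma> \<Longrightarrow> C j u \<gamma> = 0" and C_J: "j \<notin> J \<Longrightarrow> C j u \<gamma> = 0"
    and L_short: "j \<in> J \<Longrightarrow> length w \<le> j \<Longrightarrow> coef (L j) w = 0"
    and L_eq: "j \<in> J \<Longrightarrow> length u = j \<Longrightarrow> v \<noteq> [] \<Longrightarrow>
      coef (L j) (u @ v) = (\<Sum>\<gamma>\<in>\<Gamma>. C j u \<gamma> * coef (monomial (symbol_ser L) \<gamma>) v)"

section \<open>From a derivative-closed algebra to a grammar indexed by prefix lengths\<close>

primrec ders :: "'a list \<Rightarrow> ('a, 'k) ser \<Rightarrow> ('a, 'k) ser" where
  "ders [] T = T"
| "ders (a # u) T = ders u (der a T)"

lemma coef_ders: "coef (ders u T) v = coef T (u @ v)"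
  by (induction u arbitrary: T) auto

lemma Sp_ders:
  assumes "\<And>g a. g \<in> G \<Longrightarrow> der a (\<rho> g) \<in> subalg \<rho> G" "T \<in> subalg \<rho> G" shows "ders u T \<in> subalg \<rho> G"
  using assms(2) by (induction u arbitrary: T) (auto intro: Sp_der assms(1))

lemma coef_lt_mult: "coef (lt a * T) v = (if v \<noteq> [] \<and> hd v = a then coef T (tl v) else 0)"
proof (cases v)
  case (Cons b w)
  have "coef (lt a * T) (b # w) = coef (der b (lt a * T)) w" by simp
  also have "\<dots> = (if b = a then coef T w else 0)" by (simp only: der_mult) simp
  finally show ?thesis using Cons by simp
qed simp

lemma coef_mon_letters: "coef (monomial (symbol_ser L) (map Inl w)) v = (if v = w then 1 else 0)"
proof (induction w arbitrary: v)
  case (Cons a w)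
  have "symbol_ser L (Inl a) = lt a" by (simp add: symbol_ser_def)
  then show ?case by (cases v) (simp_all add: coef_lt_mult Cons)
qed auto

text \<open>One nonterminal in a monomial already needs \<open>M\<close> letters.\<close>

lemma coef_mon_short:
  assumes L: "\<And>w. length w < M \<Longrightarrow> coef (L j) w = 0" and "Inr j \<in> set \<gamma>" "length v < M"
  shows "coef (monomial (symbol_ser L) \<gamma>) v = 0"
  using assms(2,3)
proof (induction \<gamma> arbitrary: v)
  case (Cons x \<gamma>)
  show ?case unfolding mon_simps coef_mult cauchy_def
  proof (intro sum.neutral ballI)
    fix i assume "i \<in> {..length v}"
    then show "coef (symbol_ser L x) (take i v) * coef (monomial (symbol_ser L) \<gamma>) (drop i v) = 0"
    proof (cases "x = Inr j")
      case True
      then show ?thesis using Cons.prems L by (simp add: symbol_ser_def)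
    next
      case False
      then have "coef (monomial (symbol_ser L) \<gamma>) (drop i v) = 0" using Cons.prems by (intro Cons.IH) auto
      then show ?thesis by simp
    qed
  qed
qed simp

lemma letters_or_hole: "(\<exists>w. \<gamma> = map Inl w) \<or> (\<exists>j. Inr j \<in> set \<gamma>)"
proof (induction \<gamma>)
  case (Cons x \<gamma>)
  then show ?case by (cases x) (auto intro: exI[of _ "_ # _"])
qed simp

text \<open>Each generator is its truncation \<open>L\<close> to words of length at least
  \<open>M\<close> plus a polynomial of short words. The truncations together with the letters
  therefore generate all generators, hence all their derivatives, and expanding the derivative by a
  word \<open>u\<close> of length \<open>j\<close> yields the productions with prefix
  \<open>u\<close>.\<close>

theorem algebraic_pieces:
  fixes S :: "'a::finite list \<Rightarrow> 'k::comm_semiring_1"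
  assumes "algebraic S"
  shows "\<exists>J L C \<Gamma> M j0. pieces J (L :: nat \<Rightarrow> ('a, 'k) ser) C \<Gamma> \<and> j0 \<in> J \<and>
     (\<forall>w. coef (L j0) w = (if M \<le> length w then S w else 0))"
proof -
  \<comment> \<open>Within this proof \<open>empty_sets\<close> is a locally fixed generator, the
    one whose series is \<open>S\<close>.\<close>
  obtain \<rho> :: "('a + nat) + (nat \<times> nat) \<Rightarrow> ('a, 'k) ser" and G empty_sets where G: "finite G" "empty_sets \<in> G"
    "S = coef (\<rho> empty_sets)" "\<forall>g\<in>G. coef (\<rho> g) [] = 0 \<and> (\<forall>a. der a (\<rho> g) \<in> subalg \<rho> G)"
    using algebraic_der_closed[OF assms] by blast
  obtain e :: "('a + nat) + (nat \<times> nat) \<Rightarrow> nat" where e: "inj_on e G"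
    using finite_imp_inj_to_nat_seg[OF G(1)] by auto
  \<comment> \<open>The offset 2 keeps the code of a generator distinguishable from a single leaf
    and from the default value 0 of \<open>head\<close>.\<close>
  define hd' where "hd' g = e g + 2" for g
  define gn where "gn = inv_into G hd'"
  have inj: "inj_on hd' G" using e by (auto simp: hd'_def inj_on_def)
  have gn: "gn (hd' g) = g" if "g \<in> G" for g using inj that by (simp add: gn_def)
  define J where "J = hd' ` G"
  have gnG: "gn j \<in> G" if "j \<in> J" for j using that gn by (auto simp: J_def)
  have finJ: "finite J" using G(1) by (simp add: J_def)
  \<comment> \<open>The bound exceeds every code, so a word of \<open>L j\<close> always has letters
    left after its prefix of length \<open>j\<close>. It is common to all generators: a monomial
    with a nonterminal then vanishes below \<open>M\<close> automatically.\<close>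
  define M where "M = Suc (Max J)"
  have JM: "j < M" if "j \<in> J" for j using finJ that by (simp add: M_def less_Suc_eq_le)
  define L where "L j = Ser (\<lambda>w. if M \<le> length w then coef (\<rho> (gn j)) w else 0)" for j
  define H :: "('a + nat) set" where "H = range Inl \<union> Inr ` J"
  have L0: "coef (L j) w = 0" if "length w < M" for j w using that by (simp add: L_def)
  have gen: "\<rho> g \<in> subalg (symbol_ser L) H" if "g \<in> G" for g
  proof -
    let ?W = "{w :: 'a list. length w < M}"
    have finW: "finite ?W" using finite_lists_length_le[of "UNIV :: 'a set" M]
      by (rule finite_subset[rotated]) auto
    have eq: "\<rho> g = L (hd' g) + (\<Sum>w\<in>?W. const_ser (coef (\<rho> g) w) * monomial (symbol_ser L) (map Inl w))"
    proof (rule ser_eqI)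
      fix v
      have "(\<Sum>w\<in>?W. coef (\<rho> g) w * (if v = w then 1 else 0)) = (\<Sum>w\<in>?W. if w = v then coef (\<rho> g) w else 0)"
        by (intro sum.cong) auto
      then show "coef (\<rho> g) v = coef (L (hd' g) + (\<Sum>w\<in>?W. const_ser (coef (\<rho> g) w) * monomial (symbol_ser L) (map Inl w))) v"
        using finW gn[OF that] by (simp add: coef_sum coef_mon_letters L_def)
    qed
    have 2: "L (hd' g) \<in> subalg (symbol_ser L) H"
      using Sp_gen[of "Inr (hd' g)" H "symbol_ser L"] that by (simp add: H_def J_def symbol_ser_def)
    have 3: "monomial (symbol_ser L) (map Inl w) \<in> subalg (symbol_ser L) H" for w
      by (rule Sp_mon) (auto simp: H_def)
    show ?thesis by (subst eq) (intro Sp_add[OF 2] Sp_sum Sp_mult Sp_cst 3)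
  qed
  have ders: "ders u (\<rho> g) \<in> subalg (symbol_ser L) H" if "g \<in> G" for u g
  proof (rule Sp_subst)
    show "ders u (\<rho> g) \<in> subalg \<rho> G" using G(4) that by (intro Sp_ders Sp_gen) auto
  qed (rule gen)
  define expands where "expands j u p \<longleftrightarrow> finite (fst p) \<and> (\<forall>\<beta>\<in>fst p. set \<beta> \<subseteq> H) \<and>
     ders u (\<rho> (gn j)) = (\<Sum>\<beta>\<in>fst p. const_ser (snd p \<beta>) * monomial (symbol_ser L) \<beta>)" for j u p
  define B where "B j u = fst (SOME p. expands j u p)" for j u
  define c where "c j u = snd (SOME p. expands j u p)" for j u
  have "expands j u (B j u, c j u)" if "j \<in> J" for j u
  proof -
    have "\<exists>p. expands j u p"
      using Sp_expand[OF ders[OF gnG[OF that]], of u] by (auto simp: expands_def)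
    then have "expands j u (SOME p. expands j u p)" by (rule someI_ex)
    then show ?thesis by (simp add: B_def c_def)
  qed
  then have B: "\<And>j u. j \<in> J \<Longrightarrow> finite (B j u)" "\<And>j u \<beta>. j \<in> J \<Longrightarrow> \<beta> \<in> B j u \<Longrightarrow> set \<beta> \<subseteq> H"
     "\<And>j u. j \<in> J \<Longrightarrow> ders u (\<rho> (gn j)) = (\<Sum>\<beta>\<in>B j u. const_ser (c j u \<beta>) * monomial (symbol_ser L) \<beta>)"
    by (simp_all add: expands_def)
  define \<Gamma> where "\<Gamma> = (\<Union>j\<in>J. \<Union>u\<in>{u. length u = j}. B j u) - {[]}"
  have fin\<Gamma>: "finite \<Gamma>"
  proof -
    have "finite {u :: 'a list. length u = j}" for j
      using finite_lists_length_eq[of "UNIV :: 'a set" j] by simp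
    then show ?thesis unfolding \<Gamma>_def using finJ B(1) by (intro finite_Diff finite_UN_I) auto
  qed
  \<comment> \<open>Truncation affects only monomials consisting of letters; those whose word
    together with the prefix is shorter than \<open>M\<close> are dropped. The empty monomial does
    not contribute to a nonempty remainder \<open>v\<close>.\<close>
  define C where "C j u \<gamma> = (if j \<in> J \<and> length u = j \<and> \<gamma> \<in> B j u \<and> \<gamma> \<noteq> [] \<and>
     \<not> ((\<exists>w. \<gamma> = map Inl w) \<and> length \<gamma> + j < M) then c j u \<gamma> else 0)" for j u \<gamma>
  have "pieces J L C \<Gamma>"
  proof
    show "2 \<le> j" if "j \<in> J" for j using that by (auto simp: J_def hd'_def)
    show "\<gamma> \<noteq> []" if "\<gamma> \<in> \<Gamma>" for \<gamma> using that by (auto simp: \<Gamma>_def)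
    show "j \<in> J" if "\<gamma> \<in> \<Gamma>" "Inr j \<in> set \<gamma>" for \<gamma> j
      using that B(2) by (fastforce simp: \<Gamma>_def H_def)
    show "C j u \<gamma> = 0" if "\<gamma> \<notin> \<Gamma>" for j u \<gamma>
      using that by (auto simp: \<Gamma>_def C_def)
    show "C j u \<gamma> = 0" if "j \<notin> J" for j u \<gamma>
      using that by (simp add: C_def)
    show "coef (L j) w = 0" if "j \<in> J" "length w \<le> j" for j w
      using that JM[of j] by (intro L0) simp
    fix j and u v :: "'a list" assume j: "j \<in> J" and u: "length u = j" and v: "v \<noteq> []"
    let ?m = "\<lambda>\<gamma>. coef (monomial (symbol_ser L) \<gamma>) v"
    have "(\<Sum>\<gamma>\<in>\<Gamma>. C j u \<gamma> * ?m \<gamma>) = (\<Sum>\<gamma>\<in>B j u - {[]}. C j u \<gamma> * ?m \<gamma>)"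
      using j u fin\<Gamma> by (intro sum.mono_neutral_right) (auto simp: \<Gamma>_def C_def)
    also have "\<dots> = (if M \<le> length (u @ v) then (\<Sum>\<gamma>\<in>B j u - {[]}. c j u \<gamma> * ?m \<gamma>) else 0)"
    proof (cases "M \<le> length (u @ v)")
      case True
      have "C j u \<gamma> * ?m \<gamma> = c j u \<gamma> * ?m \<gamma>" if "\<gamma> \<in> B j u - {[]}" for \<gamma>
        using that j u True by (auto simp: C_def coef_mon_letters split: if_splits)
      then show ?thesis using True by simp
    next
      case False
      have "C j u \<gamma> * ?m \<gamma> = 0" for \<gamma>
      proof -
        consider w where "\<gamma> = map Inl w" | i where "Inr i \<in> set \<gamma>" using letters_or_hole by blast
        then show ?thesis
        proof cases
          case 1
          then show ?thesis using False u by (auto simp: C_def coef_mon_letters)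
        next
          case 2
          then show ?thesis using False by (subst coef_mon_short[where M = M and j = i]) (auto simp: L0)
        qed
      qed
      then show ?thesis using False by simp
    qed
    also have "(\<Sum>\<gamma>\<in>B j u - {[]}. c j u \<gamma> * ?m \<gamma>) = (\<Sum>\<gamma>\<in>B j u. c j u \<gamma> * ?m \<gamma>)"
      using B(1)[OF j] v by (intro sum.mono_neutral_left) auto
    also have "\<dots> = coef (ders u (\<rho> (gn j))) v"
      by (simp add: B(3)[OF j] coef_sum)
    also have "\<dots> = coef (\<rho> (gn j)) (u @ v)" by (rule coef_ders)
    finally have "(\<Sum>\<gamma>\<in>\<Gamma>. C j u \<gamma> * ?m \<gamma>) = (if M \<le> length (u @ v) then coef (\<rho> (gn j)) (u @ v) else 0)" .
    then show "coef (L j) (u @ v) = (\<Sum>\<gamma>\<in>\<Gamma>. C j u \<gamma> * ?m \<gamma>)"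
      by (simp only: L_def[of j] ser.sel)
  qed (use finJ fin\<Gamma> in auto)
  moreover have "hd' empty_sets \<in> J" using G(2) by (simp add: J_def)
  moreover have "coef (L (hd' empty_sets)) w = (if M \<le> length w then S w else 0)" for w
    using gn[OF G(2)] G(3) by (simp add: L_def)
  ultimately show ?thesis by blast
qed

section \<open>Weights of canonical terms as weights of derivations\<close>

primrec leaf_group :: "bool \<Rightarrow> 'a trm \<Rightarrow> bool" where
  "leaf_group b (Lf a) = True"
| "leaf_group b (Nd b' s t) = (b' = b \<and> root_op s = None \<and> leaf_group b t)"

text \<open>The name of the nonterminal expanded at the root: the number of leaves of its first
  child. Such a child has at least two leaves, so 0 can stand for a node that encodes no
  production.\<close>

primrec head :: "'a trm \<Rightarrow> nat" where
  "head (Lf a) = 0"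
| "head (Nd b s t) = (if root_op s \<noteq> None \<and> leaf_group (\<not> b) s then len s else 0)"

text \<open>Right-nested \<open>b\<close>-nodes are flattened into the children of one unranked
  node, read as the tail of a production: leaves are letters, and nodes of the other type are
  nonterminals.\<close>

primrec pattern :: "bool \<Rightarrow> 'a trm \<Rightarrow> ('a + nat) list" where
  "pattern b (Lf a) = [Inl a]"
| "pattern b (Nd b' s t) = (if b' = b then pattern b s @ pattern b t else [Inr (head (Nd b' s t))])"

lemma pat_ne [simp]: "pattern b s \<noteq> []"
  by (induction s) auto

lemma pat_single: "root_op s \<noteq> Some b \<Longrightarrow> \<exists>x. pattern b s = [x]"
  by (cases s) auto

lemma pat_singleD: "pattern b s = [x] \<Longrightarrow> root_op s \<noteq> Some b"
proof
  assume *: "pattern b s = [x]" "root_op s = Some b"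
  then obtain s1 s2 where "s = Nd b s1 s2" by (cases s) auto
  then have "length (pattern b s1) + length (pattern b s2) = 1" using arg_cong[OF *(1), of length] by simp
  moreover have "0 < length (pattern b s1)" "0 < length (pattern b s2)" by simp_all
  ultimately show False by linarith
qed

lemma pat_Inl: "pattern b s = [Inl a] \<longleftrightarrow> s = Lf a"
proof (cases s)
  case (Nd b' u v)
  show ?thesis
  proof (cases "b' = b")
    case True
    then have "root_op s = Some b" using Nd by simp
    then have ne: "pattern b s \<noteq> [Inl a]" using pat_singleD by blast
    have "s \<noteq> Lf a" using Nd by simp
    then show ?thesis using ne by blast
  qed (simp add: Nd)
qed auto

lemma pat_Inr: "j \<noteq> 0 \<Longrightarrow> pattern b s = [Inr j] \<longleftrightarrow> root_op s = Some (\<not> b) \<and> head s = j"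
proof (cases s)
  case (Nd b' u v)
  show ?thesis
  proof (cases "b' = b")
    case True
    then have "root_op s = Some b" using Nd by simp
    then have ne: "pattern b s \<noteq> [Inr j]" using pat_singleD by blast
    have "root_op s \<noteq> Some (\<not> b)" using Nd True by simp
    then show ?thesis using ne by blast
  next
    case False
    then have "b' = (\<not> b)" by auto
    then show ?thesis using Nd by (simp del: head.simps)
  qed
qed auto

lemma rt_None: "root_op s = None \<longleftrightarrow> (\<exists>a. s = Lf a)"
  by (cases s) auto

text \<open>With its operation fixed, a leaf group is determined by its word; together with
  \<open>grp_exists\<close> this encodes every terminal prefix exactly once.\<close>

lemma grp_unique: "leaf_group b s \<Longrightarrow> leaf_group b t \<Longrightarrow> word_of s = word_of t \<Longrightarrow> s = t"
proof (induction s arbitrary: t)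
  case (Lf a)
  then show ?case by (cases t) (auto simp: rt_None eq_commute[of "[]"])
next
  case (Nd b' s1 s2)
  then show ?case by (cases t) (auto simp: rt_None)
qed

lemma grp_exists: "w \<noteq> [] \<Longrightarrow> \<exists>s. leaf_group b s \<and> canon s \<and> word_of s = w"
proof (induction w)
  case (Cons a w)
  show ?case
  proof (cases "w = []")
    case True
    then show ?thesis by (intro exI[of _ "Lf a"]) simp
  next
    case False
    then obtain s where "leaf_group b s" "canon s" "word_of s = w" using Cons by blast
    then show ?thesis by (intro exI[of _ "Nd b (Lf a) s"]) simp
  qed
qed simp

context pieces
begin

text \<open>A leaf group has value 1, because its letters are charged to the production at its
  parent. Any other node must have a leaf group of at least two leaves as first child. A leaf group
  in a later place has head 0, which occurs in no tail from \<open>\<Gamma>\<close>, so the parent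
  gets value 0.\<close>

definition node_value :: "bool \<Rightarrow> 'a trm \<Rightarrow> 'a trm \<Rightarrow> 'k" where
  "node_value b s t = (if leaf_group b (Nd b s t) then 1
     else if root_op s \<noteq> None \<and> leaf_group (\<not> b) s then C (len s) (word_of s) (pattern b t) else 0)"

text \<open>The product of the values of all inner nodes of the unranked tree of a canonical term;
  \<open>c\<close> is the type of the parent node.\<close>

primrec node_product :: "bool \<Rightarrow> 'a trm \<Rightarrow> 'k" where
  "node_product c (Lf a) = 1"
| "node_product c (Nd b s t) = (if c = b then 1 else node_value b s t) * (node_product b s * node_product b t)"

lemma pw_grp: "leaf_group b s \<Longrightarrow> node_product c s = 1"
  by (induction s arbitrary: c) (auto simp: node_value_def rt_None)

lemma mon_Nil:
  assumes "\<gamma> \<noteq> []" "\<And>j. Inr j \<in> set \<gamma> \<Longrightarrow> j \<in> J"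
  shows "coef (monomial (symbol_ser L) \<gamma>) [] = 0"
proof -
  obtain x \<gamma>' where \<gamma>: "\<gamma> = x # \<gamma>'" using assms(1) by (cases \<gamma>) auto
  then have "coef (symbol_ser L x) [] = 0" using assms(2) by (cases x) (auto simp: symbol_ser_def L_short)
  then show ?thesis by (simp add: \<gamma>)
qed

text \<open>For nodes with head \<open>j\<close> the prefix is split off, and the second statement
  applies to the shorter rest. For forests, a singleton \<open>[Inr j]\<close> is the first
  statement at the same word with the other operation, and a longer pattern is divided after its
  first child into two nonempty parts.\<close>

lemma sum_pw:
  "(\<forall>b j. j \<in> J \<longrightarrow> (\<Sum>s\<in>{s \<in> canon_terms w. root_op s = Some b \<and> head s = j}. node_product (\<not> b) s) = coef (L j) w) \<and>
   (\<forall>b \<gamma>. \<gamma> \<noteq> [] \<longrightarrow> (\<forall>j. Inr j \<in> set \<gamma> \<longrightarrow> j \<in> J) \<longrightarrow>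
     (\<Sum>s\<in>{s \<in> canon_terms w. pattern b s = \<gamma>}. node_product b s) = coef (monomial (symbol_ser L) \<gamma>) w)"
proof (induction w rule: length_induct)
  case (1 w)
  have IH: "(\<Sum>s\<in>{s \<in> canon_terms v. pattern b s = \<gamma>}. node_product b s) = coef (monomial (symbol_ser L) \<gamma>) v"
    if "length v < length w" "\<gamma> \<noteq> []" "\<And>j. Inr j \<in> set \<gamma> \<Longrightarrow> j \<in> J" for v b \<gamma>
    using 1 that by blast
  have A: "(\<Sum>s\<in>{s \<in> canon_terms w. root_op s = Some b \<and> head s = j}. node_product (\<not> b) s) = coef (L j) w" if j: "j \<in> J" for b j
  proof (cases "length w \<le> j")
    case True
    have "head s < length w" if "s \<in> canon_terms w" "root_op s = Some b" for s
      using that by (cases s) (auto simp: canon_terms_def)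
    then have "{s \<in> canon_terms w. root_op s = Some b \<and> head s = j} = {}" using True by fastforce
    then show ?thesis using L_short[OF j True] by (simp only: sum.empty)
  next
    case False
    have j2: "2 \<le> j" using J2[OF j] .
    let ?u = "take j w" and ?v = "drop j w"
    have "?u \<noteq> []" using False j2 by auto
    \<comment> \<open>The only possible first child over the prefix; the sum over first children
      collapses to this term.\<close>
    then obtain g where g: "leaf_group (\<not> b) g" "canon g" "word_of g = ?u" using grp_exists by blast
    have leng: "len g = j" using g(3) False by simp
    have rtg: "root_op g = Some (\<not> b)" using g(1) leng j2 by (cases g) auto
    let ?c = "\<lambda>s1. root_op s1 \<noteq> None \<and> leaf_group (\<not> b) s1 \<and> len s1 = j"
    have "(\<Sum>s\<in>{s \<in> canon_terms w. root_op s = Some b \<and> head s = j}. node_product (\<not> b) s) =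
        (\<Sum>s\<in>{s \<in> {s \<in> canon_terms w. root_op s = Some b}. head s = j}. node_product (\<not> b) s)"
      by (rule sum.cong) auto
    also have "\<dots> = (\<Sum>s\<in>{s \<in> canon_terms w. root_op s = Some b}. if head s = j then node_product (\<not> b) s else 0)"
      by (rule sum.inter_filter) simp
    also have "\<dots> = (\<Sum>s\<in>{s \<in> canon_terms w. root_op s = Some b}. case s of Nd _ s1 s2 \<Rightarrow>
        (if ?c s1 then C j (word_of s1) (pattern b s2) * node_product b s2 else 0) | _ \<Rightarrow> 0)"
    proof (intro sum.cong refl)
      fix s assume "s \<in> {s \<in> canon_terms w. root_op s = Some b}"
      then obtain s1 s2 where s: "s = Nd b s1 s2" by (cases s) auto
      show "(if head s = j then node_product (\<not> b) s else 0) = (case s of Nd _ s1 s2 \<Rightarrow>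
        (if ?c s1 then C j (word_of s1) (pattern b s2) * node_product b s2 else 0) | _ \<Rightarrow> 0)"
        using j2 pw_grp[of "\<not> b" s1 b] by (auto simp: s node_value_def)
    qed
    also have "\<dots> = (\<Sum>i\<le>length w. \<Sum>s1\<in>{s \<in> canon_terms (take i w). root_op s \<noteq> Some b}. \<Sum>s2\<in>canon_terms (drop i w).
        if ?c s1 then C j (word_of s1) (pattern b s2) * node_product b s2 else 0)"
      by (rule sum_CT_Nd)
    also have "\<dots> = (\<Sum>i\<le>length w. if i = j then (\<Sum>s1\<in>{s \<in> canon_terms ?u. root_op s \<noteq> Some b}. \<Sum>s2\<in>canon_terms ?v.
        if ?c s1 then C j (word_of s1) (pattern b s2) * node_product b s2 else 0) else 0)"
      by (intro sum.cong refl) (auto simp: canon_terms_def intro!: sum.neutral)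
    also have "\<dots> = (\<Sum>s1\<in>{s \<in> canon_terms ?u. root_op s \<noteq> Some b}. \<Sum>s2\<in>canon_terms ?v.
        if ?c s1 then C j (word_of s1) (pattern b s2) * node_product b s2 else 0)"
      using False by simp
    also have "\<dots> = (\<Sum>s1\<in>{s \<in> canon_terms ?u. root_op s \<noteq> Some b}. if s1 = g then
        (\<Sum>s2\<in>canon_terms ?v. C j ?u (pattern b s2) * node_product b s2) else 0)"
    proof (intro sum.cong refl)
      fix s1 assume "s1 \<in> {s \<in> canon_terms ?u. root_op s \<noteq> Some b}"
      then have s1: "word_of s1 = ?u" by (simp add: canon_terms_def)
      then have "?c s1 \<longleftrightarrow> s1 = g" using grp_unique[of "\<not> b" s1 g] g rtg leng by auto
      then show "(\<Sum>s2\<in>canon_terms ?v. if ?c s1 then C j (word_of s1) (pattern b s2) * node_product b s2 else 0) =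
        (if s1 = g then (\<Sum>s2\<in>canon_terms ?v. C j ?u (pattern b s2) * node_product b s2) else 0)"
        using s1 by (simp only: sum_if_const)
    qed
    also have "\<dots> = (\<Sum>s2\<in>canon_terms ?v. C j ?u (pattern b s2) * node_product b s2)"
      using g rtg by (simp add: canon_terms_def[of ?u])  (simp add: finite_wd)
    also have "\<dots> = (\<Sum>s2\<in>{s \<in> canon_terms ?v. pattern b s \<in> \<Gamma>}. C j ?u (pattern b s2) * node_product b s2)"
      by (rule sum.mono_neutral_right) (auto simp: C_out)
    also have "\<dots> = (\<Sum>\<gamma>\<in>\<Gamma>. \<Sum>s\<in>{s \<in> {s \<in> canon_terms ?v. pattern b s \<in> \<Gamma>}. pattern b s = \<gamma>}. C j ?u (pattern b s) * node_product b s)"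
      by (rule sum.group[symmetric]) (auto simp: fin\<Gamma>)
    also have "\<dots> = (\<Sum>\<gamma>\<in>\<Gamma>. C j ?u \<gamma> * (\<Sum>s\<in>{s \<in> canon_terms ?v. pattern b s = \<gamma>}. node_product b s))"
      unfolding sum_distrib_left by (intro sum.cong refl) auto
    also have "\<dots> = (\<Sum>\<gamma>\<in>\<Gamma>. C j ?u \<gamma> * coef (monomial (symbol_ser L) \<gamma>) ?v)"
      using False j2 \<Gamma>_ne \<Gamma>_J by (intro sum.cong refl) (subst IH, auto)
    also have "\<dots> = coef (L j) (?u @ ?v)"
      using j False by (intro L_eq[symmetric]) auto
    finally show ?thesis by simp
  qed
  have B: "(\<Sum>s\<in>{s \<in> canon_terms w. pattern b s = \<gamma>}. node_product b s) = coef (monomial (symbol_ser L) \<gamma>) w"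
    if \<gamma>: "\<gamma> \<noteq> []" and \<gamma>J: "\<And>j. Inr j \<in> set \<gamma> \<Longrightarrow> j \<in> J" for b \<gamma>
  proof -
    obtain x \<gamma>' where x: "\<gamma> = x # \<gamma>'" using \<gamma> by (cases \<gamma>) auto
    show ?thesis
    proof (cases "\<gamma>' = []")
      case True
      show ?thesis
      proof (cases x)
        case (Inl a)
        have "{s \<in> canon_terms w. pattern b s = \<gamma>} = {s \<in> canon_terms w. s = Lf a}"
          unfolding x True Inl pat_Inl ..
        also have "\<dots> = (if w = [a] then {Lf a} else {})"
          by (auto simp: canon_terms_def)
        finally have "{s \<in> canon_terms w. pattern b s = \<gamma>} = (if w = [a] then {Lf a} else {})" .
        then show ?thesis by (simp add: x True Inl symbol_ser_def)
      next
        case (Inr j)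
        have jJ: "j \<in> J" using \<gamma>J x Inr by simp
        have j0: "j \<noteq> 0" using J2[OF jJ] by simp
        have "{s \<in> canon_terms w. pattern b s = \<gamma>} = {s \<in> canon_terms w. root_op s = Some (\<not> b) \<and> head s = j}"
          unfolding x True Inr pat_Inr[OF j0] ..
        then show ?thesis using A[OF jJ, of "\<not> b"] by (simp add: x True Inr symbol_ser_def)
      qed
    next
      case False
      have rtb: "root_op s = Some b" if "pattern b s = \<gamma>" for s
      proof (rule ccontr)
        assume "root_op s \<noteq> Some b"
        then obtain y where "pattern b s = [y]" using pat_single by blast
        then show False using that x False by simp
      qed
      have "(\<Sum>s\<in>{s \<in> canon_terms w. pattern b s = \<gamma>}. node_product b s) = (\<Sum>s\<in>{s \<in> {s \<in> canon_terms w. root_op s = Some b}. pattern b s = \<gamma>}. node_product b s)"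
        using rtb by (intro sum.cong) auto
      also have "\<dots> = (\<Sum>s\<in>{s \<in> canon_terms w. root_op s = Some b}. if pattern b s = \<gamma> then node_product b s else 0)"
        by (rule sum.inter_filter) simp
      also have "\<dots> = (\<Sum>s\<in>{s \<in> canon_terms w. root_op s = Some b}. case s of Nd _ s1 s2 \<Rightarrow>
          (if pattern b s1 = [x] then node_product b s1 else 0) * (if pattern b s2 = \<gamma>' then node_product b s2 else 0) | _ \<Rightarrow> 0)"
      proof (intro sum.cong refl)
        fix s assume s': "s \<in> {s \<in> canon_terms w. root_op s = Some b}"
        then obtain s1 s2 where s: "s = Nd b s1 s2" by (cases s) auto
        then have "root_op s1 \<noteq> Some b" using s' by (simp add: canon_terms_def)
        then obtain y where "pattern b s1 = [y]" using pat_single by blast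
        then show "(if pattern b s = \<gamma> then node_product b s else 0) = (case s of Nd _ s1 s2 \<Rightarrow>
          (if pattern b s1 = [x] then node_product b s1 else 0) * (if pattern b s2 = \<gamma>' then node_product b s2 else 0) | _ \<Rightarrow> 0)"
          by (auto simp: s x)
      qed
      also have "\<dots> = (\<Sum>i\<le>length w. \<Sum>s1\<in>{s \<in> canon_terms (take i w). root_op s \<noteq> Some b}. \<Sum>s2\<in>canon_terms (drop i w).
          (if pattern b s1 = [x] then node_product b s1 else 0) * (if pattern b s2 = \<gamma>' then node_product b s2 else 0))"
        by (rule sum_CT_Nd)
      also have "\<dots> = (\<Sum>i\<le>length w. (\<Sum>s\<in>{s \<in> canon_terms (take i w). pattern b s = [x]}. node_product b s) *
          (\<Sum>s\<in>{s \<in> canon_terms (drop i w). pattern b s = \<gamma>'}. node_product b s))"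
      proof (intro sum.cong refl)
        fix i
        have "(\<Sum>s1\<in>{s \<in> canon_terms (take i w). root_op s \<noteq> Some b}. if pattern b s1 = [x] then node_product b s1 else 0) =
           (\<Sum>s\<in>{s \<in> canon_terms (take i w). pattern b s = [x]}. node_product b s)"
          by (intro sum.mono_neutral_cong_right) (auto dest: pat_singleD)
        moreover have "(\<Sum>s2\<in>canon_terms (drop i w). if pattern b s2 = \<gamma>' then node_product b s2 else 0) =
           (\<Sum>s\<in>{s \<in> canon_terms (drop i w). pattern b s = \<gamma>'}. node_product b s)"
          by (intro sum.mono_neutral_cong_right) auto
        ultimately show "(\<Sum>s1\<in>{s \<in> canon_terms (take i w). root_op s \<noteq> Some b}. \<Sum>s2\<in>canon_terms (drop i w).
          (if pattern b s1 = [x] then node_product b s1 else 0) * (if pattern b s2 = \<gamma>' then node_product b s2 else 0)) =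
          (\<Sum>s\<in>{s \<in> canon_terms (take i w). pattern b s = [x]}. node_product b s) * (\<Sum>s\<in>{s \<in> canon_terms (drop i w). pattern b s = \<gamma>'}. node_product b s)"
          by (simp only: sum_product[symmetric])
      qed
      also have "\<dots> = (\<Sum>i\<le>length w. coef (monomial (symbol_ser L) [x]) (take i w) * coef (monomial (symbol_ser L) \<gamma>') (drop i w))"
      proof (intro sum.cong refl)
        fix i assume i: "i \<in> {..length w}"
        have n: "coef (monomial (symbol_ser L) [x]) [] = 0" "coef (monomial (symbol_ser L) \<gamma>') [] = 0"
          using False \<gamma>J x by (auto intro!: mon_Nil simp del: mon_simps)
        consider "i = 0" | "i = length w" | "0 < i" "i < length w" using i by fastforce
        then show "(\<Sum>s\<in>{s \<in> canon_terms (take i w). pattern b s = [x]}. node_product b s) * (\<Sum>s\<in>{s \<in> canon_terms (drop i w). pattern b s = \<gamma>'}. node_product b s) =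
           coef (monomial (symbol_ser L) [x]) (take i w) * coef (monomial (symbol_ser L) \<gamma>') (drop i w)"
        proof cases
          case 3
          have 1: "(\<Sum>s\<in>{s \<in> canon_terms (take i w). pattern b s = [x]}. node_product b s) = coef (monomial (symbol_ser L) [x]) (take i w)"
            using 3 \<gamma>J x by (intro IH) auto
          have 2: "(\<Sum>s\<in>{s \<in> canon_terms (drop i w). pattern b s = \<gamma>'}. node_product b s) = coef (monomial (symbol_ser L) \<gamma>') (drop i w)"
            using 3 False \<gamma>J x by (intro IH) auto
          show ?thesis by (simp only: 1 2)
        qed (use n in \<open>simp_all del: mon_simps\<close>)
      qed
      also have "\<dots> = coef (monomial (symbol_ser L) [x] * monomial (symbol_ser L) \<gamma>') w" by (simp add: coef_mult cauchy_def)
      finally show ?thesis by (simp add: x)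
    qed
  qed
  show ?case
  proof (intro conjI allI impI)
    show "(\<Sum>s\<in>{s \<in> canon_terms w. pattern b s = \<gamma>}. node_product b s) = coef (monomial (symbol_ser L) \<gamma>) w"
      if "\<gamma> \<noteq> []" "\<forall>j. Inr j \<in> set \<gamma> \<longrightarrow> j \<in> J" for b \<gamma>
      using that by (intro B) auto
  qed (rule A)
qed

end

section \<open>Nodes of a text in terms of its orders\<close>

definition lca_op :: "'a trm \<Rightarrow> nat \<Rightarrow> nat \<Rightarrow> bool" where
  "lca_op s x y = (if x < y then opat s x y else opat s y x)"

text \<open>The quantifier-free reading of \<open>lca_op\<close>: the two orders agree on a pair
  separated by a circ-node and disagree on one separated by a bullet-node.\<close>

definition op_at :: "'a ttext \<Rightarrow> bool \<Rightarrow> nat \<Rightarrow> nat \<Rightarrow> bool" where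
  "op_at t b x y \<longleftrightarrow> x \<noteq> y \<and> (x \<le> y \<longleftrightarrow> le2 (snd t) x y) = b"

lemma dd_so: "x < len s \<Longrightarrow> y < len s \<Longrightarrow> op_at (text_of s) b x y \<longleftrightarrow> x \<noteq> y \<and> lca_op s x y = b"
  unfolding op_at_def lca_op_def by (cases x y rule: linorder_cases) (auto simp: le2_tx)

lemma so_Nd: "lca_op (Nd b s t) x y = (if x < len s then if y < len s then lca_op s x y else b
    else if y < len s then b else lca_op t (x - len s) (y - len s))"
  by (auto simp: lca_op_def)

text \<open>The node of the unranked tree whose children are separated by the gap between the
  positions \<open>i - 1\<close> and \<open>i\<close>, together with its offset.\<close>

primrec node_at :: "'a trm \<Rightarrow> nat \<Rightarrow> nat \<times> 'a trm" where
  "node_at (Lf a) i = (0, Lf a)"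
| "node_at (Nd b s t) i = (if i = len s then (0, Nd b s t) else if i < len s then node_at s i
     else if root_op t = Some b \<and> node_at t (i - len s) = (0, t) then (0, Nd b s t)
     else (len s + fst (node_at t (i - len s)), snd (node_at t (i - len s))))"

text \<open>What formulas can observe of a subterm: the block of its positions starting at
  \<open>n\<close>, the operations between them, and their labels.\<close>

definition embeds :: "'a trm \<Rightarrow> nat \<Rightarrow> 'a trm \<Rightarrow> bool" where
  "embeds s n T \<longleftrightarrow> n + len T \<le> len s \<and>
     (\<forall>x y. x < y \<longrightarrow> y < len T \<longrightarrow> opat s (n + x) (n + y) = opat T x y) \<and>
     (\<forall>i<len T. word_of s ! (n + i) = word_of T ! i)"

lemma emb_refl: "embeds s 0 s"
  by (simp add: embeds_def)

lemma emb_trans: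
  assumes "embeds s n T" "embeds T m U" shows "embeds s (n + m) U"
proof -
  have "opat s (n + m + x) (n + m + y) = opat U x y" if "x < y" "y < len U" for x y
    using assms that unfolding embeds_def by (metis add.assoc add_less_cancel_left less_le_trans)
  moreover have "word_of s ! (n + m + i) = word_of U ! i" if "i < len U" for i
    using assms that unfolding embeds_def by (metis add.assoc add_less_cancel_left less_le_trans)
  ultimately show ?thesis using assms by (simp add: embeds_def)
qed

lemma emb_left: "embeds (Nd b s t) 0 s" and emb_right: "embeds (Nd b s t) (len s) t"
  by (auto simp: embeds_def nth_append)

lemma emb_Nd: "embeds s n (Nd b T1 T2) \<Longrightarrow> embeds s n T1 \<and> embeds s (n + len T1) T2"
  using emb_trans[of s n "Nd b T1 T2" 0 T1, OF _ emb_left]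
    emb_trans[of s n "Nd b T1 T2" "len T1" T2, OF _ emb_right] by simp

text \<open>The size bound serves to show that a gap inside a left child never belongs to the root
  node of the whole term.\<close>

lemma nd_node:
  assumes "canon s" "0 < i" "i < len s"
  shows "embeds s (fst (node_at s i)) (snd (node_at s i)) \<and> canon (snd (node_at s i)) \<and> fst (node_at s i) < i \<and>
    i < fst (node_at s i) + len (snd (node_at s i)) \<and> root_op (snd (node_at s i)) = Some (lca_op s (i - 1) i) \<and>
    size (snd (node_at s i)) \<le> size s"
  using assms
proof (induction s arbitrary: i)
  case (Nd b s t)
  consider "i = len s" | "i < len s" | "len s < i" by linarith
  then show ?case
  proof cases
    case 1
    have "lca_op (Nd b s t) (i - 1) i = b" using 1 Nd.prems by (simp add: so_Nd)
    then show ?thesis using 1 Nd.prems by (simp add: emb_refl del: opat.simps)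
  next
    case 2
    have "lca_op (Nd b s t) (i - 1) i = lca_op s (i - 1) i" using 2 by (simp add: so_Nd less_imp_diff_less)
    moreover have "embeds (Nd b s t) (fst (node_at s i)) (snd (node_at s i))"
      using emb_trans[OF emb_left, of s "fst (node_at s i)"] Nd.IH(1)[of i] Nd.prems 2 by simp
    ultimately show ?thesis using 2 Nd.IH(1)[of i] Nd.prems by simp
  next
    case 3
    let ?i = "i - len s"
    have i: "0 < ?i" "?i < len t" using 3 Nd.prems by auto
    have "\<not> i - 1 < len s" using 3 by auto
    then have lca_op: "lca_op (Nd b s t) (i - 1) i = lca_op t (?i - 1) ?i" using 3 by (simp add: so_Nd)
    note IH = Nd.IH(2)[of ?i]
    show ?thesis
    proof (cases "root_op t = Some b \<and> node_at t ?i = (0, t)")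
      case True
      then have "lca_op t (?i - 1) ?i = b" using IH i Nd.prems by simp
      then show ?thesis using True 3 Nd.prems lca_op by (simp add: emb_refl)
    next
      case False
      have "embeds t (fst (node_at t ?i)) (snd (node_at t ?i))" using IH i Nd.prems by simp
      from emb_trans[OF emb_right this, of b s]
      have "embeds (Nd b s t) (len s + fst (node_at t ?i)) (snd (node_at t ?i))" .
      moreover have "node_at (Nd b s t) i = (len s + fst (node_at t ?i), snd (node_at t ?i))"
        using 3 False by simp
      ultimately show ?thesis using IH i Nd.prems lca_op by auto
    qed
  qed
qed simp

text \<open>A position \<open>y\<close> separated from the gap before \<open>i\<close> by the other operation lies outside the node
  of this gap, and it is related by that operation to all positions of the node. Conversely, if \<open>z\<close>
  is outside the node, then either \<open>z\<close> itself is such a \<open>y\<close>, or the path from the node to its common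
  ancestor with \<open>z\<close> has an inner node with the other operation, which supplies one.\<close>

definition separates :: "'a trm \<Rightarrow> nat \<Rightarrow> nat \<Rightarrow> bool" where
  "separates s i y \<longleftrightarrow> y < len s \<and> y \<noteq> i - 1 \<and> y \<noteq> i \<and>
     lca_op s y (i - 1) = (\<not> lca_op s (i - 1) i) \<and> lca_op s y i = (\<not> lca_op s (i - 1) i)"

lemma sep_Nd:
  assumes "0 < i" "i < len s + len t"
  shows "separates (Nd b s t) i y \<longleftrightarrow> (if i = len s then False
     else if i < len s then (if y < len s then separates s i y else y < len s + len t \<and> b = (\<not> lca_op s (i - 1) i))
     else (if y < len s then b = (\<not> lca_op t (i - len s - 1) (i - len s)) else separates t (i - len s) (y - len s)))"
proof -
  consider "i = len s" | "i < len s" | "len s < i" by linarith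
  then show ?thesis
  proof cases
    case 1
    then show ?thesis using assms by (auto simp: separates_def so_Nd)
  next
    case 2
    then show ?thesis using assms by (auto simp: separates_def so_Nd)
  next
    case 3
    then have "y - len s = i - len s - 1 \<longleftrightarrow> y = i - 1" "y - len s = i - len s \<longleftrightarrow> y = i"
      "y - len s < len t \<longleftrightarrow> y < len s + len t" "i - 1 - len s = i - len s - 1"
      if "\<not> y < len s" using that by auto
    then show ?thesis using 3 assms by (cases "y < len s") (auto simp: separates_def so_Nd)
  qed
qed

text \<open>If the operation at a gap inside a child differs from the root operation
  \<open>b\<close>, any position of the other child separates. If it equals \<open>b\<close>, a left
  child has, by canonicity, a different root and so contains a separating position itself; for a
  right child the question passes to that child.\<close>

lemma nd_root:
  assumes "canon s" "0 < i" "i < len s"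
  shows "node_at s i = (0, s) \<longleftrightarrow> (\<nexists>y. separates s i y)"
  using assms
proof (induction s arbitrary: i)
  case (Nd b s t)
  have i: "0 < i" "i < len s + len t" using Nd.prems by auto
  consider "i = len s" | "i < len s" | "len s < i" by linarith
  then show ?case
  proof cases
    case 1
    then show ?thesis using sep_Nd[OF i] by simp
  next
    case 2
    have "size (snd (node_at s i)) < size (Nd b s t)" using nd_node[of s i] Nd.prems 2 by simp
    then have ne: "node_at (Nd b s t) i \<noteq> (0, Nd b s t)" using 2 by auto
    have "\<exists>y. separates (Nd b s t) i y"
    proof (cases "lca_op s (i - 1) i = b")
      case True
      then have "root_op s \<noteq> Some (lca_op s (i - 1) i)" using Nd.prems by simp
      then have "node_at s i \<noteq> (0, s)" using nd_node[of s i] Nd.prems 2 by auto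
      then obtain y where "separates s i y" using Nd.IH(1)[of i] Nd.prems 2 by auto
      moreover have "y < len s" using \<open>separates s i y\<close> by (simp add: separates_def)
      ultimately have "separates (Nd b s t) i y" using sep_Nd[OF i, of b y] 2 by simp
      then show ?thesis by blast
    next
      case False
      then have "separates (Nd b s t) i (len s)" using sep_Nd[OF i, of b "len s"] 2 by auto
      then show ?thesis by blast
    qed
    then show ?thesis using ne by blast
  next
    case 3
    let ?i = "i - len s"
    have i': "0 < ?i" "?i < len t" using 3 i by auto
    have ct: "canon t" using Nd.prems by simp
    have IH: "node_at t ?i = (0, t) \<longleftrightarrow> (\<nexists>y. separates t ?i y)" using Nd.IH(2) ct i' by simp
    have root: "node_at (Nd b s t) i = (0, Nd b s t) \<longleftrightarrow> root_op t = Some b \<and> node_at t ?i = (0, t)"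
      using 3 by auto
    have rtt: "node_at t ?i = (0, t) \<Longrightarrow> root_op t = Some (lca_op t (?i - 1) ?i)"
      using nd_node[OF ct i'] by auto
    show ?thesis
    proof (cases "lca_op t (?i - 1) ?i = b")
      case True
      have "separates (Nd b s t) i y \<longleftrightarrow> len s \<le> y \<and> separates t ?i (y - len s)" for y
        using sep_Nd[OF i, of b y] 3 True by auto
      then have "(\<exists>y. separates (Nd b s t) i y) \<longleftrightarrow> (\<exists>y. separates t ?i y)"
        by (metis add_diff_cancel_left' le_add1)
      then show ?thesis using root IH rtt True by auto
    next
      case False
      then have "separates (Nd b s t) i 0" using sep_Nd[OF i, of b 0] 3 by auto
      then show ?thesis using root rtt False by auto
    qed
  qed
qed simp

lemma nd_interval:
  assumes "canon s" "0 < i" "i < len s" "z < len s"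
  shows "fst (node_at s i) \<le> z \<and> z < fst (node_at s i) + len (snd (node_at s i)) \<longleftrightarrow>
    (\<forall>y. separates s i y \<longrightarrow> y \<noteq> z \<and> lca_op s y z = (\<not> lca_op s (i - 1) i))"
  using assms
proof (induction s arbitrary: i z)
  case (Nd b s t)
  have i: "0 < i" "i < len s + len t" using Nd.prems by auto
  have cs: "canon s" and ct: "canon t" and rts: "root_op s \<noteq> Some b" using Nd.prems by auto
  consider "i = len s" | "i < len s" | "len s < i" by linarith
  then show ?case
  proof cases
    case 1
    then show ?thesis using sep_Nd[OF i] Nd.prems by simp
  next
    case 2
    let ?c = "lca_op s (i - 1) i"
    have lca_op: "lca_op (Nd b s t) (i - 1) i = ?c" using 2 by (simp add: so_Nd less_imp_diff_less)
    have node_at: "node_at (Nd b s t) i = node_at s i" using 2 by simp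
    have sp: "separates (Nd b s t) i y \<longleftrightarrow> (if y < len s then separates s i y else y < len s + len t \<and> b = (\<not> ?c))" for y
      using sep_Nd[OF i, of b y] 2 by simp
    show ?thesis
    proof (cases "z < len s")
      case True
      have "(\<forall>y. separates (Nd b s t) i y \<longrightarrow> y \<noteq> z \<and> lca_op (Nd b s t) y z = (\<not> ?c)) \<longleftrightarrow>
         (\<forall>y. separates s i y \<longrightarrow> y \<noteq> z \<and> lca_op s y z = (\<not> ?c))" (is "?l \<longleftrightarrow> ?r")
      proof
        assume l: ?l
        show ?r
        proof (intro allI impI)
          fix y assume "separates s i y"
          moreover have "y < len s" using calculation by (simp add: separates_def)
          ultimately show "y \<noteq> z \<and> lca_op s y z = (\<not> ?c)"
            using l[rule_format, of y] sp[of y] True by (simp add: so_Nd)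
        qed
      next
        assume r: ?r
        show ?l
        proof (intro allI impI)
          fix y assume y: "separates (Nd b s t) i y"
          show "y \<noteq> z \<and> lca_op (Nd b s t) y z = (\<not> ?c)"
          proof (cases "y < len s")
            case T: True
            then show ?thesis using y sp[of y] r[rule_format, of y] True by (simp add: so_Nd)
          next
            case False
            then have "b = (\<not> ?c)" using y sp[of y] by simp
            then show ?thesis using False True by (simp add: so_Nd)
          qed
        qed
      qed
      then show ?thesis unfolding node_at lca_op using Nd.IH(1)[OF cs _ 2 True] i by simp
    next
      case False
      have "fst (node_at s i) + len (snd (node_at s i)) \<le> len s"
        using nd_node[OF cs _ 2] i by (simp add: embeds_def)
      moreover have "\<exists>y. separates (Nd b s t) i y \<and> (y = z \<or> lca_op (Nd b s t) y z \<noteq> (\<not> ?c))"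
      proof (cases "?c = b")
        case True
        then have "node_at s i \<noteq> (0, s)" using nd_node[OF cs _ 2] i rts by auto
        then obtain y where "separates s i y" using nd_root[OF cs _ 2] i by auto
        moreover have "y < len s" using \<open>separates s i y\<close> by (simp add: separates_def)
        ultimately have "separates (Nd b s t) i y \<and> lca_op (Nd b s t) y z = b"
          using False sp[of y] by (simp add: so_Nd)
        then show ?thesis using True by blast
      next
        case F: False
        then have "separates (Nd b s t) i z" using sp[of z] False Nd.prems by auto
        then show ?thesis by blast
      qed
      ultimately show ?thesis unfolding node_at lca_op using False by auto
    qed
  next
    case 3
    let ?i = "i - len s"
    let ?c = "lca_op t (?i - 1) ?i"
    have i': "0 < ?i" "?i < len t" using 3 i by auto
    have "\<not> i - 1 < len s" using 3 by auto
    then have lca_op: "lca_op (Nd b s t) (i - 1) i = ?c" using 3 by (simp add: so_Nd)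
    have sp: "separates (Nd b s t) i y \<longleftrightarrow> (if y < len s then b = (\<not> ?c) else separates t ?i (y - len s))" for y
      using sep_Nd[OF i, of b y] 3 by simp
    have rtt: "node_at t ?i = (0, t) \<Longrightarrow> root_op t = Some ?c" using nd_node[OF ct i'] by auto
    show ?thesis
    proof (cases "root_op t = Some b \<and> node_at t ?i = (0, t)")
      case True
      then have "?c = b" using rtt by simp
      then have "\<not> separates (Nd b s t) i y" for y
        using sp[of y] nd_root[OF ct i'] True by (auto split: if_splits)
      moreover have "node_at (Nd b s t) i = (0, Nd b s t)" using True 3 by simp
      ultimately show ?thesis using Nd.prems by simp
    next
      case False
      have node_at: "node_at (Nd b s t) i = (len s + fst (node_at t ?i), snd (node_at t ?i))" using 3 False by simp
      show ?thesis
      proof (cases "z < len s")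
        case True
        have "\<exists>y. separates (Nd b s t) i y \<and> (y = z \<or> lca_op (Nd b s t) y z \<noteq> (\<not> ?c))"
        proof (cases "?c = b")
          case c: True
          have "node_at t ?i \<noteq> (0, t)" using False rtt c by auto
          then obtain y where "separates t ?i y" using nd_root[OF ct i'] by auto
          then have "separates (Nd b s t) i (y + len s) \<and> lca_op (Nd b s t) (y + len s) z = b"
            using True by (auto simp: sp so_Nd)
          then show ?thesis using c by blast
        next
          case False
          then have "separates (Nd b s t) i z" using sp[of z] True by auto
          then show ?thesis by blast
        qed
        then show ?thesis unfolding node_at lca_op using True by auto
      next
        case z: False
        have "(\<forall>y. separates (Nd b s t) i y \<longrightarrow> y \<noteq> z \<and> lca_op (Nd b s t) y z = (\<not> ?c)) \<longleftrightarrow>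
           (\<forall>y. separates t ?i y \<longrightarrow> y \<noteq> z - len s \<and> lca_op t y (z - len s) = (\<not> ?c))" (is "?l \<longleftrightarrow> ?r")
        proof
          assume l: ?l
          show ?r
          proof (intro allI impI)
            fix y assume "separates t ?i y"
            then have "separates (Nd b s t) i (y + len s)" by (simp add: sp)
            then show "y \<noteq> z - len s \<and> lca_op t y (z - len s) = (\<not> ?c)"
              using l[rule_format, of "y + len s"] z by (auto simp: so_Nd)
          qed
        next
          assume r: ?r
          show ?l
          proof (intro allI impI)
            fix y assume y: "separates (Nd b s t) i y"
            show "y \<noteq> z \<and> lca_op (Nd b s t) y z = (\<not> ?c)"
            proof (cases "y < len s")
              case True
              then show ?thesis using y z sp[of y] by (auto simp: so_Nd)
            next
              case False
              then have "separates t ?i (y - len s)" using y sp[of y] by simp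
              then show ?thesis using r False z by (auto simp: so_Nd)
            qed
          qed
        qed
        moreover have "fst (node_at t ?i) \<le> z - len s \<and> z - len s < fst (node_at t ?i) + len (snd (node_at t ?i)) \<longleftrightarrow>
          len s + fst (node_at t ?i) \<le> z \<and> z < len s + fst (node_at t ?i) + len (snd (node_at t ?i))" using z by auto
        moreover have "z - len s < len t" using z Nd.prems by auto
        ultimately show ?thesis unfolding node_at lca_op using Nd.IH(2)[OF ct i', of "z - len s"] by simp
      qed
    qed
  qed
qed simp

section \<open>Children and productions as predicates on the two orders\<close>

definition cutp :: "'a ttext \<Rightarrow> bool \<Rightarrow> nat \<Rightarrow> nat \<Rightarrow> nat \<Rightarrow> bool" where
  "cutp t b l e c \<longleftrightarrow> l < c \<and> c \<le> e \<and> (\<forall>x<length (fst t). \<forall>y<length (fst t).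
     l \<le> x \<and> x < c \<and> c \<le> y \<and> y \<le> e \<longrightarrow> op_at t b x y)"

text \<open>The first cut of a block ends its first child. As canonical terms nest to the right, it
  is also the gap at which the binary node is divided.\<close>

definition fstp :: "'a ttext \<Rightarrow> bool \<Rightarrow> nat \<Rightarrow> nat \<Rightarrow> nat \<Rightarrow> bool" where
  "fstp t b l e c \<longleftrightarrow> cutp t b l e c \<and> (\<forall>d<length (fst t). d < c \<longrightarrow> \<not> cutp t b l e d)"

definition grpp :: "'a ttext \<Rightarrow> bool \<Rightarrow> nat \<Rightarrow> nat \<Rightarrow> bool" where
  "grpp t b l e \<longleftrightarrow> (\<forall>x<length (fst t). \<forall>y<length (fst t). l \<le> x \<and> x < y \<and> y \<le> e \<longrightarrow> op_at t b x y)"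

definition sucp :: "'a ttext \<Rightarrow> nat \<Rightarrow> nat \<Rightarrow> bool" where
  "sucp t x y \<longleftrightarrow> x < y \<and> (\<forall>z<length (fst t). \<not> (x < z \<and> z < y))"

definition labp :: "'a ttext \<Rightarrow> 'a option \<Rightarrow> nat \<Rightarrow> bool" where
  "labp t a x \<longleftrightarrow> (case a of None \<Rightarrow> True | Some c \<Rightarrow> fst t ! x = c)"

text \<open>Walks from \<open>l\<close> to the last position \<open>k\<close>, one position per list
  entry. Entries \<open>None\<close> only measure the length, as for a head; entries
  \<open>Some a\<close> also spell a word, as for a prefix.\<close>

fun seqp :: "'a ttext \<Rightarrow> nat \<Rightarrow> nat \<Rightarrow> 'a option list \<Rightarrow> bool" where
  "seqp t l k [] = False"
| "seqp t l k [a] = (labp t a l \<and> l = k)"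
| "seqp t l k (a # a' # as) = (labp t a l \<and> (\<exists>q<length (fst t). sucp t l q \<and> seqp t q k (a' # as)))"

definition symbp :: "'a ttext \<Rightarrow> bool \<Rightarrow> nat \<Rightarrow> nat \<Rightarrow> 'a + nat \<Rightarrow> bool" where
  "symbp t b l e x = (case x of Inl a \<Rightarrow> l = e \<and> fst t ! l = a
     | Inr j \<Rightarrow> (\<exists>c<length (fst t). \<exists>k<length (fst t).
         fstp t (\<not> b) l e c \<and> sucp t k c \<and> grpp t b l k \<and> seqp t l k (replicate j None)))"

text \<open>A single remaining symbol requires that the block has no further cut; otherwise a longer
  row of children could pass for one child.\<close>

fun pmp :: "'a ttext \<Rightarrow> bool \<Rightarrow> nat \<Rightarrow> nat \<Rightarrow> ('a + nat) list \<Rightarrow> bool" where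
  "pmp t b l e [] = False"
| "pmp t b l e [x] = ((\<nexists>c. c < length (fst t) \<and> cutp t b l e c) \<and> symbp t b l e x)"
| "pmp t b l e (x # x' # \<gamma>) = (\<exists>c<length (fst t). \<exists>k<length (fst t).
     fstp t b l e c \<and> sucp t k c \<and> symbp t b l k x \<and> pmp t b c e (x' # \<gamma>))"

lemma sucp_iff: "y < length (fst t) \<Longrightarrow> sucp t x y \<longleftrightarrow> y = Suc x"
  by (auto simp: sucp_def) (metis Suc_lessI Suc_lessD lessI less_trans_Suc)

definition tcut :: "'a trm \<Rightarrow> bool \<Rightarrow> nat \<Rightarrow> bool" where
  "tcut T b c \<longleftrightarrow> 0 < c \<and> c < len T \<and> (\<forall>x y. x < c \<longrightarrow> c \<le> y \<longrightarrow> y < len T \<longrightarrow> opat T x y = b)"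

lemma dd_emb:
  assumes "embeds s n T" "x < y" "y < len T"
  shows "op_at (text_of s) b (n + x) (n + y) \<longleftrightarrow> opat T x y = b"
proof -
  have "n + x < len s" "n + y < len s" using assms by (auto simp: embeds_def)
  then show ?thesis using assms by (simp add: dd_so lca_op_def embeds_def)
qed

text \<open>Blocks are given by their first and last positions; the relation
  \<open>Suc e = n + len T\<close> expresses the latter without truncated subtraction.\<close>

lemma cutp_emb:
  assumes "embeds s n T" "Suc e = n + len T"
  shows "cutp (text_of s) b n e c \<longleftrightarrow> n \<le> c \<and> tcut T b (c - n)"
proof
  assume c: "cutp (text_of s) b n e c"
  then have c1: "n < c" "c \<le> e" by (auto simp: cutp_def)
  have "opat T x y = b" if "x < c - n" "c - n \<le> y" "y < len T" for x y
  proof -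
    have "n + x < len s" "n + y < len s" "n + x < c" "c \<le> n + y" "n + y \<le> e"
      using that assms by (auto simp: embeds_def)
    then have "op_at (text_of s) b (n + x) (n + y)" using c unfolding cutp_def fst_tx by simp
    then show ?thesis using dd_emb[OF assms(1), of x y b] that by simp
  qed
  then show "n \<le> c \<and> tcut T b (c - n)" using c1 assms(2) by (auto simp: tcut_def)
next
  assume c: "n \<le> c \<and> tcut T b (c - n)"
  have "op_at (text_of s) b x y" if "n \<le> x" "x < c" "c \<le> y" "y \<le> e" for x y
  proof -
    have y: "y - n < len T" using that assms(2) by linarith
    then have "opat T (x - n) (y - n) = b" using c that by (auto simp: tcut_def)
    then have "op_at (text_of s) b (n + (x - n)) (n + (y - n))"
      using that by (subst dd_emb[OF assms(1) _ y]) auto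
    then show ?thesis using that by simp
  qed
  then show "cutp (text_of s) b n e c" using c assms(2) by (auto simp: cutp_def tcut_def)
qed

lemma opat_last: "Suc y = len s + len t \<Longrightarrow> opat (Nd b s t) 0 y = b"
  using len_pos(2)[of t] by (intro opat_ends(2)) linarith

lemma tcut_root: "tcut T b c \<Longrightarrow> root_op T = Some b"
proof (cases T)
  case (Nd b' T1 T2)
  assume c: "tcut T b c"
  define y where "y = len T1 + len T2 - 1"
  have y: "Suc y = len T1 + len T2" using len_pos(2)[of T1] unfolding y_def by linarith
  then have "opat T 0 y = b" using c Nd unfolding tcut_def by simp
  then show ?thesis using opat_last[OF y, of b'] Nd by simp
qed (auto simp: tcut_def)

text \<open>A cut inside the left child would also be a cut of that child, which would then have
  root operation \<open>b\<close>.\<close>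

lemma tcut_first:
  assumes "canon (Nd b T1 T2)"
  shows "tcut (Nd b T1 T2) b (len T1)" and "tcut (Nd b T1 T2) b c \<Longrightarrow> len T1 \<le> c"
proof -
  show "tcut (Nd b T1 T2) b (len T1)" by (auto simp: tcut_def)
  show "len T1 \<le> c" if t: "tcut (Nd b T1 T2) b c"
  proof (rule ccontr)
    assume *: "\<not> len T1 \<le> c"
    have "opat T1 x y = b" if "x < c" "c \<le> y" "y < len T1" for x y
    proof -
      have "opat (Nd b T1 T2) x y = b"
        using t that unfolding tcut_def by (metis length_append trans_less_add1 word_of.simps(2))
      then show ?thesis using that by simp
    qed
    then have "tcut T1 b c" using t * by (auto simp: tcut_def)
    then show False using tcut_root assms by fastforce
  qed
qed

lemma emb_len: "embeds s n (Nd b T1 T2) \<Longrightarrow> n + len T1 < len s"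
  using len_pos(2)[of T2] unfolding embeds_def word_of.simps length_append by linarith

lemma ex_cutp:
  assumes "embeds s n T" "canon T" "Suc e = n + len T"
  shows "(\<exists>c. c < len s \<and> cutp (text_of s) b n e c) \<longleftrightarrow> root_op T = Some b"
proof
  assume "root_op T = Some b"
  then obtain T1 T2 where T: "T = Nd b T1 T2" by (cases T) auto
  have "tcut T b (n + len T1 - n)" using tcut_first(1)[of b T1 T2] T assms by simp
  then have "cutp (text_of s) b n e (n + len T1)" using cutp_emb[OF assms(1,3)] by simp
  then show "\<exists>c. c < len s \<and> cutp (text_of s) b n e c" using emb_len assms(1) T by blast
qed (use cutp_emb[OF assms(1,3)] tcut_root in blast)

lemma fstp_emb:
  assumes "embeds s n T" "canon T" "Suc e = n + len T"
  shows "fstp (text_of s) b n e c \<longleftrightarrow> (\<exists>T1 T2. T = Nd b T1 T2 \<and> c = n + len T1)"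
proof -
  have *: "fstp (text_of s) b n e (n + len T1)" if T: "T = Nd b T1 T2" for T1 T2
  proof -
    have "tcut T b (n + len T1 - n)" using tcut_first(1)[of b T1 T2] T assms by simp
    then have "cutp (text_of s) b n e (n + len T1)" using cutp_emb[OF assms(1,3)] by simp
    moreover have "\<not> cutp (text_of s) b n e d" if "d < n + len T1" for d
      using cutp_emb[OF assms(1,3), of b d] tcut_first(2)[of b T1 T2 "d - n"] assms(2) T that by auto
    ultimately show ?thesis by (simp add: fstp_def)
  qed
  show ?thesis
  proof
    assume c: "fstp (text_of s) b n e c"
    then have c': "n \<le> c" "tcut T b (c - n)" using cutp_emb[OF assms(1,3)] by (auto simp: fstp_def)
    then have "root_op T = Some b" using tcut_root by blast
    then obtain T1 T2 where T: "T = Nd b T1 T2" by (cases T) auto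
    have "\<not> c < n + len T1" using *[OF T] c c'(2) assms(1,3) by (auto simp: fstp_def tcut_def embeds_def)
    moreover have "\<not> n + len T1 < c" using *[OF T] c emb_len[of s n b T1 T2] assms(1) T by (auto simp: fstp_def)
    ultimately show "\<exists>T1 T2. T = Nd b T1 T2 \<and> c = n + len T1" using T by fastforce
  qed (use * in blast)
qed

lemma grp_opat:
  assumes "canon T"
  shows "leaf_group b T \<longleftrightarrow> (\<forall>x y. x < y \<longrightarrow> y < len T \<longrightarrow> opat T x y = b)"
  using assms
proof (induction T)
  case (Nd b' T1 T2)
  show ?case
  proof
    assume g: "leaf_group b (Nd b' T1 T2)"
    then obtain a where "T1 = Lf a" by (auto simp: rt_None)
    then show "\<forall>x y. x < y \<longrightarrow> y < len (Nd b' T1 T2) \<longrightarrow> opat (Nd b' T1 T2) x y = b"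
      using g Nd by auto
  next
    assume r: "\<forall>x y. x < y \<longrightarrow> y < len (Nd b' T1 T2) \<longrightarrow> opat (Nd b' T1 T2) x y = b"
    define y where "y = len T1 + len T2 - 1"
    have y: "Suc y = len T1 + len T2" "0 < y"
      using len_pos(2)[of T1] len_pos(2)[of T2] unfolding y_def by linarith+
    have "opat (Nd b' T1 T2) 0 y = b"
      using y by (intro r[rule_format]) auto
    then have b: "b' = b" using opat_last[OF y(1), of b'] by simp
    have "opat T2 x y = b" if "x < y" "y < len T2" for x y
      using r[rule_format, of "len T1 + x" "len T1 + y"] that by simp
    then have "leaf_group b T2" using Nd by simp
    moreover have "root_op T1 = None"
    proof (rule ccontr)
      assume "root_op T1 \<noteq> None"
      then obtain c u v where T1: "T1 = Nd c u v" by (cases T1) auto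
      define y where "y = len u + len v - 1"
      have y: "Suc y = len u + len v" "0 < y"
        using len_pos(2)[of u] len_pos(2)[of v] unfolding y_def by linarith+
      then have "y < len T1" using T1 by simp
      then have "opat T1 0 y = b" using r[rule_format, of 0 y] y by simp
      then have "c = b" using opat_last[OF y(1), of c] T1 by simp
      then show False using Nd.prems b T1 by simp
    qed
    ultimately show "leaf_group b (Nd b' T1 T2)" using b by simp
  qed
qed simp

lemma grpp_emb:
  assumes "embeds s n T" "canon T" "Suc e = n + len T"
  shows "grpp (text_of s) b n e \<longleftrightarrow> leaf_group b T"
proof
  assume g: "grpp (text_of s) b n e"
  have "opat T x y = b" if "x < y" "y < len T" for x y
  proof -
    have "n + x < len s" "n + y < len s" "n + y \<le> e" using that assms by (auto simp: embeds_def)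
    then have "op_at (text_of s) b (n + x) (n + y)" using g that by (auto simp: grpp_def)
    then show ?thesis using dd_emb[OF assms(1) that] by simp
  qed
  then show "leaf_group b T" using grp_opat[OF assms(2)] by blast
next
  assume "leaf_group b T"
  then have *: "\<And>x y. x < y \<Longrightarrow> y < len T \<Longrightarrow> opat T x y = b" using grp_opat[OF assms(2)] by blast
  have "op_at (text_of s) b x y" if "n \<le> x" "x < y" "y \<le> e" for x y
  proof -
    have y: "y - n < len T" using that assms(3) by linarith
    then have "op_at (text_of s) b (n + (x - n)) (n + (y - n))"
      using that * by (subst dd_emb[OF assms(1) _ y]) auto
    then show ?thesis using that by simp
  qed
  then show "grpp (text_of s) b n e" by (auto simp: grpp_def)
qed

lemma seqp_iff:
  "k < length (fst t) \<Longrightarrow> seqp t l k as \<longleftrightarrow> as \<noteq> [] \<and> Suc k = l + length as \<and> (\<forall>i<length as. labp t (as ! i) (l + i))"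
proof (induction t l k as rule: seqp.induct)
  case (3 t l k a a' as)
  have "seqp t l k (a # a' # as) \<longleftrightarrow> labp t a l \<and> Suc l < length (fst t) \<and> seqp t (Suc l) k (a' # as)"
    using sucp_iff[of _ t l] by auto
  also have "\<dots> \<longleftrightarrow> labp t a l \<and> Suc k = Suc l + length (a' # as) \<and>
      (\<forall>i<length (a' # as). labp t ((a' # as) ! i) (Suc l + i))"
    using 3 sucp_iff[of "Suc l" t l] by auto
  also have "\<dots> \<longleftrightarrow> Suc k = l + length (a # a' # as) \<and> (\<forall>i<length (a # a' # as). labp t ((a # a' # as) ! i) (l + i))"
    by (simp add: All_less_Suc2) auto
  finally show ?case by simp
qed auto

lemma seqp_None: "k < length (fst t) \<Longrightarrow> seqp t l k (replicate j None) \<longleftrightarrow> 0 < j \<and> Suc k = l + j"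
  by (auto simp: seqp_iff labp_def)

lemma seqp_word:
  assumes "embeds s n T" "Suc e = n + len T"
  shows "seqp (text_of s) n e (map Some u) \<longleftrightarrow> u = word_of T"
proof -
  have e: "e < length (fst (text_of s))" using assms by (simp add: embeds_def)
  have "seqp (text_of s) n e (map Some u) \<longleftrightarrow> u \<noteq> [] \<and> length u = len T \<and>
      (\<forall>i<length u. word_of s ! (n + i) = u ! i)"
    unfolding seqp_iff[OF e] using assms(2) by (auto simp: labp_def)
  also have "\<dots> \<longleftrightarrow> u = word_of T"
    using assms by (auto simp: embeds_def intro: nth_equalityI)
  finally show ?thesis .
qed

lemma symbp_Inr:
  assumes "embeds s n T" "canon T" "Suc e = n + len T" "2 \<le> j"
  shows "symbp (text_of s) b n e (Inr j) \<longleftrightarrow> root_op T = Some (\<not> b) \<and> head T = j"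
proof -
  have lt: "k < len s" if "c < len s" "sucp (text_of s) k c" for c k
    using that by (auto simp: sucp_def)
  have "symbp (text_of s) b n e (Inr j) \<longleftrightarrow> (\<exists>c<len s. \<exists>k<len s. (\<exists>T1 T2. T = Nd (\<not> b) T1 T2 \<and> c = n + len T1) \<and>
      c = Suc k \<and> grpp (text_of s) b n k \<and> Suc k = n + j)"
    unfolding symbp_def sum.case fstp_emb[OF assms(1-3)] fst_tx
  proof (intro ex_cong1 conj_cong refl)
    fix c k assume "c < len s" "k < len s"
    then show "sucp (text_of s) k c \<longleftrightarrow> c = Suc k" "seqp (text_of s) n k (replicate j None) \<longleftrightarrow> Suc k = n + j"
      using assms(4) by (simp_all add: sucp_iff seqp_None)
  qed
  also have "\<dots> \<longleftrightarrow> (\<exists>T1 T2. T = Nd (\<not> b) T1 T2 \<and> len T1 = j \<and> leaf_group b T1)"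
  proof
    assume "\<exists>c<len s. \<exists>k<len s. (\<exists>T1 T2. T = Nd (\<not> b) T1 T2 \<and> c = n + len T1) \<and>
      c = Suc k \<and> grpp (text_of s) b n k \<and> Suc k = n + j"
    then obtain k T1 T2 where T: "T = Nd (\<not> b) T1 T2" "Suc k = n + len T1" "grpp (text_of s) b n k" "Suc k = n + j"
      by auto
    then have "leaf_group b T1" using grpp_emb[of s n T1 k b] emb_Nd[of s n "\<not> b" T1 T2] assms(1,2) by simp
    then show "\<exists>T1 T2. T = Nd (\<not> b) T1 T2 \<and> len T1 = j \<and> leaf_group b T1" using T by auto
  next
    assume "\<exists>T1 T2. T = Nd (\<not> b) T1 T2 \<and> len T1 = j \<and> leaf_group b T1"
    then obtain T1 T2 where T: "T = Nd (\<not> b) T1 T2" "len T1 = j" "leaf_group b T1" by blast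
    define k where "k = n + len T1 - 1"
    have k: "Suc k = n + len T1" using len_pos(2)[of T1] unfolding k_def by linarith
    have "grpp (text_of s) b n k" using grpp_emb[of s n T1 k b] emb_Nd[of s n "\<not> b" T1 T2] assms(1,2) T k by simp
    moreover have "n + len T1 < len s" using emb_len assms(1) T(1) by blast
    ultimately show "\<exists>c<len s. \<exists>k<len s. (\<exists>T1 T2. T = Nd (\<not> b) T1 T2 \<and> c = n + len T1) \<and>
      c = Suc k \<and> grpp (text_of s) b n k \<and> Suc k = n + j"
      using T k by (intro exI[of _ "n + len T1"] conjI exI[of _ k]) auto
  qed
  also have "\<dots> \<longleftrightarrow> root_op T = Some (\<not> b) \<and> head T = j"
  proof (cases T)
    case (Nd b' T1 T2)
    have "root_op T1 \<noteq> None" if "len T1 = j" using that assms(4) by (cases T1) auto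
    then show ?thesis using Nd assms(4) by (cases "b' = (\<not> b)") auto
  qed simp
  finally show ?thesis .
qed

lemma symbp_pat:
  assumes "embeds s n T" "canon T" "Suc e = n + len T" "root_op T \<noteq> Some b" "\<And>j. x = Inr j \<Longrightarrow> 2 \<le> j"
  shows "symbp (text_of s) b n e x \<longleftrightarrow> pattern b T = [x]"
proof (cases x)
  case (Inl a)
  show ?thesis
  proof (cases T)
    case (Lf c)
    then show ?thesis using assms(1,3) Inl by (auto simp: symbp_def embeds_def)
  next
    case (Nd b' T1 T2)
    then have "n \<noteq> e" using assms(3) len_pos(2)[of T1] len_pos(2)[of T2] unfolding Nd word_of.simps length_append
      by linarith
    then show ?thesis using Inl Nd pat_Inl[of b T a] by (simp add: symbp_def)
  qed
next
  case (Inr j)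
  then have "2 \<le> j" using assms(5) by simp
  then show ?thesis using symbp_Inr[OF assms(1-3), of j b] pat_Inr[of j b T] Inr by simp
qed

text \<open>Removing the first child leaves the right subterm, whose block has the same end
  \<open>e\<close>; so the recursion along the pattern follows the right spine of the term.\<close>

lemma pmp_pat:
  assumes "embeds s n T" "canon T" "Suc e = n + len T" "\<gamma> \<noteq> []" "\<And>j. Inr j \<in> set \<gamma> \<Longrightarrow> 2 \<le> j"
  shows "pmp (text_of s) b n e \<gamma> \<longleftrightarrow> pattern b T = \<gamma>"
  using assms
proof (induction \<gamma> arbitrary: n T)
  case (Cons x \<gamma>)
  note pr = Cons.prems
  show ?case
  proof (cases \<gamma>)
    case Nil
    show ?thesis
    proof (cases "root_op T = Some b")
      case True
      then have "pattern b T \<noteq> [x]" using pat_singleD by blast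
      then show ?thesis using ex_cutp[OF pr(1-3), of b] True Nil by simp
    next
      case False
      then show ?thesis
        using ex_cutp[OF pr(1-3), of b] symbp_pat[OF pr(1-3) False, of x] pr(5) Nil by simp
    qed
  next
    case (Cons x' \<gamma>')
    have sub: "(symbp (text_of s) b n k x \<longleftrightarrow> pattern b T1 = [x]) \<and>
        (pmp (text_of s) b (n + len T1) e \<gamma> \<longleftrightarrow> pattern b T2 = \<gamma>)"
      if T: "T = Nd b T1 T2" and k: "Suc k = n + len T1" for T1 T2 k
    proof -
      have e: "embeds s n T1" "embeds s (n + len T1) T2" using emb_Nd pr(1) T by blast+
      have "symbp (text_of s) b n k x \<longleftrightarrow> pattern b T1 = [x]"
        using pr T k by (intro symbp_pat[OF e(1)]) auto
      moreover have "pmp (text_of s) b (n + len T1) e \<gamma> \<longleftrightarrow> pattern b T2 = \<gamma>"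
        using pr T Cons by (intro Cons.IH[OF e(2)]) auto
      ultimately show ?thesis by blast
    qed
    have "pmp (text_of s) b n e (x # \<gamma>) \<longleftrightarrow> (\<exists>c<len s. \<exists>k<len s. (\<exists>T1 T2. T = Nd b T1 T2 \<and> c = n + len T1) \<and>
       c = Suc k \<and> symbp (text_of s) b n k x \<and> pmp (text_of s) b c e \<gamma>)"
      unfolding Cons pmp.simps fstp_emb[OF pr(1-3)] fst_tx
      by (intro ex_cong1 conj_cong refl) (simp add: sucp_iff)
    also have "\<dots> \<longleftrightarrow> (\<exists>T1 T2. T = Nd b T1 T2 \<and> pattern b T1 = [x] \<and> pattern b T2 = \<gamma>)"
    proof
      assume "\<exists>c<len s. \<exists>k<len s. (\<exists>T1 T2. T = Nd b T1 T2 \<and> c = n + len T1) \<and>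
       c = Suc k \<and> symbp (text_of s) b n k x \<and> pmp (text_of s) b c e \<gamma>"
      then obtain k T1 T2 where T: "T = Nd b T1 T2" "Suc k = n + len T1"
        "symbp (text_of s) b n k x" "pmp (text_of s) b (n + len T1) e \<gamma>" by metis
      then show "\<exists>T1 T2. T = Nd b T1 T2 \<and> pattern b T1 = [x] \<and> pattern b T2 = \<gamma>" using sub[OF T(1,2)] by blast
    next
      assume "\<exists>T1 T2. T = Nd b T1 T2 \<and> pattern b T1 = [x] \<and> pattern b T2 = \<gamma>"
      then obtain T1 T2 where T: "T = Nd b T1 T2" "pattern b T1 = [x]" "pattern b T2 = \<gamma>" by blast
      define k where "k = n + len T1 - 1"
      have k: "Suc k = n + len T1" using len_pos(2)[of T1] unfolding k_def by linarith
      moreover have "n + len T1 < len s" using emb_len pr(1) T(1) by blast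
      moreover have "k < len s" using calculation by linarith
      ultimately show "\<exists>c<len s. \<exists>k<len s. (\<exists>T1 T2. T = Nd b T1 T2 \<and> c = n + len T1) \<and>
       c = Suc k \<and> symbp (text_of s) b n k x \<and> pmp (text_of s) b c e \<gamma>"
        using sub[OF T(1) k] T by (intro exI[of _ "n + len T1"] conjI exI[of _ k]) auto
    qed
    also have "\<dots> \<longleftrightarrow> pattern b T = x # \<gamma>"
    proof
      assume p: "pattern b T = x # \<gamma>"
      then have "root_op T = Some b" using pat_single[of T b] Cons by fastforce
      then obtain T1 T2 where T: "T = Nd b T1 T2" by (cases T) auto
      then obtain y where "pattern b T1 = [y]" using pat_single[of T1 b] pr(2) by auto
      then show "\<exists>T1 T2. T = Nd b T1 T2 \<and> pattern b T1 = [x] \<and> pattern b T2 = \<gamma>" using p T by auto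
    qed auto
    finally show ?thesis .
  qed
qed simp

section \<open>The defining sentence\<close>

definition fOp :: "bool \<Rightarrow> nat \<Rightarrow> nat \<Rightarrow> 'a mso" where
  "fOp b x y = (let \<phi> = MIff (Atm (ALe1 x y)) (Atm (ALe2 x y)) in
     MAnd (MNeg (Atm (AEq x y))) (if b then \<phi> else MNeg \<phi>))"

definition fLe :: "nat \<Rightarrow> nat \<Rightarrow> 'a mso" where
  "fLe x y = Atm (ALe1 x y)"

text \<open>Here and below, bound variables are chosen above the sum of the parameters; they exceed
  each parameter, so no capture can occur.\<close>

definition fCut :: "bool \<Rightarrow> nat \<Rightarrow> nat \<Rightarrow> nat \<Rightarrow> 'a mso" where
  "fCut b l e c = (let x = Suc (l + e + c); y = Suc x in
     MAnd (MLess l c) (MAnd (fLe c e) (MAll1 x (MAll1 y (MImp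
       (MAnd (fLe l x) (MAnd (MLess x c) (MAnd (fLe c y) (fLe y e)))) (fOp b x y))))))"

definition fFst :: "bool \<Rightarrow> nat \<Rightarrow> nat \<Rightarrow> nat \<Rightarrow> 'a mso" where
  "fFst b l e c = (let d = Suc (l + e + c) in
     MAnd (fCut b l e c) (MAll1 d (MImp (MLess d c) (MNeg (fCut b l e d)))))"

definition fGrp :: "bool \<Rightarrow> nat \<Rightarrow> nat \<Rightarrow> 'a mso" where
  "fGrp b l e = (let x = Suc (l + e); y = Suc x in
     MAll1 x (MAll1 y (MImp (MAnd (fLe l x) (MAnd (MLess x y) (fLe y e))) (fOp b x y))))"

definition fSuc :: "nat \<Rightarrow> nat \<Rightarrow> 'a mso" where
  "fSuc x y = (let z = Suc (x + y) in
     MAnd (MLess x y) (MAll1 z (MNeg (MAnd (MLess x z) (MLess z y)))))"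

definition fLab :: "'a option \<Rightarrow> nat \<Rightarrow> 'a mso" where
  "fLab a x = (case a of None \<Rightarrow> Atm (AEq x x) | Some c \<Rightarrow> Atm (ALab c x))"

fun fSeq :: "nat \<Rightarrow> nat \<Rightarrow> 'a option list \<Rightarrow> 'a mso" where
  "fSeq l k [] = MNeg (Atm (AEq l l))"
| "fSeq l k [a] = MAnd (fLab a l) (Atm (AEq l k))"
| "fSeq l k (a # a' # as) = MAnd (fLab a l)
     (MEx1 (Suc (l + k)) (MAnd (fSuc l (Suc (l + k))) (fSeq (Suc (l + k)) k (a' # as))))"

definition fSym :: "bool \<Rightarrow> nat \<Rightarrow> nat \<Rightarrow> 'a + nat \<Rightarrow> 'a mso" where
  "fSym b l e x = (case x of Inl a \<Rightarrow> MAnd (Atm (AEq l e)) (Atm (ALab a l))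
     | Inr j \<Rightarrow> (let c = Suc (l + e); k = Suc c in MEx1 c (MEx1 k
         (MAnd (fFst (\<not> b) l e c) (MAnd (fSuc k c) (MAnd (fGrp b l k) (fSeq l k (replicate j None))))))))"

fun fPat :: "bool \<Rightarrow> nat \<Rightarrow> nat \<Rightarrow> ('a + nat) list \<Rightarrow> 'a mso" where
  "fPat b l e [] = MNeg (Atm (AEq l l))"
| "fPat b l e [x] = MAnd (MNeg (MEx1 (Suc (l + e)) (fCut b l e (Suc (l + e))))) (fSym b l e x)"
| "fPat b l e (x # x' # \<gamma>) = MEx1 (Suc (l + e)) (MEx1 (Suc (Suc (l + e)))
     (MAnd (fFst b l e (Suc (l + e))) (MAnd (fSuc (Suc (Suc (l + e))) (Suc (l + e)))
       (MAnd (fSym b l (Suc (Suc (l + e))) x) (fPat b (Suc (l + e)) e (x' # \<gamma>))))))"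

text \<open>Expresses the criterion of \<open>nd_interval\<close> for the gap between
  \<open>p\<close> and \<open>i\<close>: a position belongs to the node exactly if every position
  related by the opposite operation to both \<open>p\<close> and \<open>i\<close> is so related to
  it as well.\<close>

definition fNode :: "bool \<Rightarrow> nat \<Rightarrow> nat \<Rightarrow> nat \<Rightarrow> nat \<Rightarrow> 'a mso" where
  "fNode b p i l e = (let z = Suc (p + i + l + e); y = Suc z in MAnd (fLe l e)
     (MAll1 z (MIff (MAll1 y (MImp (MAnd (fOp (\<not> b) y p) (fOp (\<not> b) y i)) (fOp (\<not> b) y z)))
        (MAnd (fLe l z) (fLe z e)))))"

definition nodep :: "'a ttext \<Rightarrow> bool \<Rightarrow> nat \<Rightarrow> nat \<Rightarrow> nat \<Rightarrow> nat \<Rightarrow> bool" where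
  "nodep t b p i l e \<longleftrightarrow> l \<le> e \<and> (\<forall>z<length (fst t).
     (\<forall>y<length (fst t). op_at t (\<not> b) y p \<and> op_at t (\<not> b) y i \<longrightarrow> op_at t (\<not> b) y z) \<longleftrightarrow> l \<le> z \<and> z \<le> e)"

lemma sat_fOp [simp]: "sat t f (fOp b x y) \<longleftrightarrow> op_at t b (f x) (f y)"
  by (auto simp: fOp_def op_at_def Let_def)

lemma sat_fLe [simp]: "sat t f (fLe x y) \<longleftrightarrow> f x \<le> f y"
  by (simp add: fLe_def)

lemma sat_fCut [simp]: "sat t f (fCut b l e c) \<longleftrightarrow> cutp t b (f l) (f e) (f c)"
  by (simp add: fCut_def cutp_def Let_def)

lemma sat_fFst [simp]: "sat t f (fFst b l e c) \<longleftrightarrow> fstp t b (f l) (f e) (f c)"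
  by (simp add: fFst_def fstp_def Let_def)

lemma sat_fGrp [simp]: "sat t f (fGrp b l e) \<longleftrightarrow> grpp t b (f l) (f e)"
  by (simp add: fGrp_def grpp_def Let_def)

lemma sat_fSuc [simp]: "sat t f (fSuc x y) \<longleftrightarrow> sucp t (f x) (f y)"
  by (simp add: fSuc_def sucp_def Let_def)

lemma sat_fLab [simp]: "sat t f (fLab a x) \<longleftrightarrow> labp t a (f x)"
  by (simp add: fLab_def labp_def split: option.splits)

lemma sat_fSeq [simp]: "sat t f (fSeq l k as) \<longleftrightarrow> seqp t (f l) (f k) as"
  by (induction l k as arbitrary: f rule: fSeq.induct) simp_all

lemma sat_fSym [simp]: "sat t f (fSym b l e x) \<longleftrightarrow> symbp t b (f l) (f e) x"
  by (simp add: fSym_def symbp_def Let_def split: sum.splits)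

lemma sat_fPat [simp]: "sat t f (fPat b l e \<gamma>) \<longleftrightarrow> pmp t b (f l) (f e) \<gamma>"
  by (induction b l e \<gamma> arbitrary: f rule: fPat.induct) simp_all

lemma sat_fNode [simp]: "sat t f (fNode b p i l e) \<longleftrightarrow> nodep t b (f p) (f i) (f l) (f e)"
  by (simp add: fNode_def nodep_def Let_def)

section \<open>Free variables and membership in the weighted fragment\<close>

primrec pure :: "'a mso \<Rightarrow> bool" where
  "pure (Atm a) = (afv2 a = {})" | "pure (MOr a b) = (pure a \<and> pure b)" | "pure (MNeg a) = pure a"
| "pure (MEx1 x a) = pure a" | "pure (MEx2 X a) = False"

primrec mfv :: "'a mso \<Rightarrow> nat set" where
  "mfv (Atm a) = afv1 a" | "mfv (MOr a b) = mfv a \<union> mfv b" | "mfv (MNeg a) = mfv a"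
| "mfv (MEx1 x a) = mfv a - {x}" | "mfv (MEx2 X a) = mfv a"

lemma pure_fo: "pure \<phi> \<Longrightarrow> fo \<phi>"
  by (induction \<phi>) auto

lemma conn_simps [simp]:
  "pure (MAnd a b) \<longleftrightarrow> pure a \<and> pure b" "pure (MImp a b) \<longleftrightarrow> pure a \<and> pure b"
  "pure (MIff a b) \<longleftrightarrow> pure a \<and> pure b" "pure (MLess x y)" "pure (MAll1 x a) \<longleftrightarrow> pure a"
  "mfv (MAnd a b) = mfv a \<union> mfv b" "mfv (MImp a b) = mfv a \<union> mfv b"
  "mfv (MIff a b) = mfv a \<union> mfv b" "mfv (MLess x y) = {x, y}" "mfv (MAll1 x a) = mfv a - {x}"
  by (auto simp: MAnd_def MImp_def MIff_def MLess_def MAll1_def)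

lemma pure_ren1 [simp]: "pure (ren1 x y a) = pure a"
proof (induction a)
  case (Atm a)
  then show ?case by (cases a) auto
qed auto

lemma mfv_ren1: "mfv (ren1 x y a) \<subseteq> insert y (mfv a - {x})"
proof (induction a)
  case (Atm a)
  then show ?case by (cases a) auto
qed auto

text \<open>The universal quantifiers created by the translation have bodies \<open>tr False\<close>
  of some formula, which is \<open>tr True\<close> of its negation and hence in
  \<open>aUMSO\<close>.\<close>

lemma wfv_tr: "pure \<phi> \<Longrightarrow> wfv1 (tr b \<phi>) \<subseteq> mfv \<phi> \<and> wfv2 (tr b \<phi>) = {} \<and> noSO (tr b \<phi>) \<and> allok (tr b \<phi>)"
proof (induction b \<phi> rule: tr.induct)
  case (6 x a)
  let ?y = "fresh1 x a"
  have *: "tr False \<phi> \<in> aUMSO" for \<phi> :: "'a mso"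
    using aUMSO.unamb[of "MNeg \<phi>"] by simp
  have "mfv (MAnd (MLess ?y x) (ren1 x ?y a)) - {?y} - {x} \<subseteq> mfv a - {x}"
    using mfv_ren1[of x ?y a] by auto
  then show ?case using 6 * by auto
next
  case (7 x a)
  have "tr False a \<in> aUMSO" using aUMSO.unamb[of "MNeg a"] by simp
  then show ?case using 7 by auto
qed auto

lemma pure_formulas [simp]: "pure (fOp b x y)" "pure (fLe x y)" "pure (fCut b l e c)" "pure (fFst b l e c)"
  "pure (fGrp b l e)" "pure (fSuc x y)" "pure (fLab a x)" "pure (fNode b p i l e)"
  by (simp_all add: fOp_def fLe_def fCut_def fFst_def fGrp_def fSuc_def fLab_def fNode_def Let_def split: option.splits)

lemma pure_fSeq [simp]: "pure (fSeq l k as)"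
  by (induction l k as rule: fSeq.induct) simp_all

lemma pure_fSym [simp]: "pure (fSym b l e x)"
  by (simp add: fSym_def Let_def split: sum.splits)

lemma pure_fPat [simp]: "pure (fPat b l e \<gamma>)"
  by (induction b l e \<gamma> rule: fPat.induct) simp_all

lemma mfv_fOp: "mfv (fOp b x y) = {x, y}" and mfv_fLe: "mfv (fLe x y) = {x, y}"
  and mfv_fLab: "mfv (fLab a x) = {x}"
  by (auto simp: fOp_def fLe_def fLab_def Let_def split: option.splits)

lemma mfv_fCut: "mfv (fCut b l e c) \<subseteq> {l, e, c}"
  by (auto simp: fCut_def mfv_fOp mfv_fLe Let_def)

lemma mfv_fFst: "mfv (fFst b l e c) \<subseteq> {l, e, c}"
  using mfv_fCut[of b l e c] mfv_fCut[of b l e "Suc (l + e + c)"] by (auto simp: fFst_def Let_def)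

lemma mfv_fGrp: "mfv (fGrp b l e) \<subseteq> {l, e}"
  by (auto simp: fGrp_def mfv_fOp mfv_fLe Let_def)

lemma mfv_fSuc: "mfv (fSuc x y) \<subseteq> {x, y}"
  by (auto simp: fSuc_def Let_def)

lemma mfv_fSeq: "mfv (fSeq l k as) \<subseteq> {l, k}"
proof (induction l k as rule: fSeq.induct)
  case (3 l k a a' as)
  then show ?case using mfv_fSuc[of l "Suc (l + k)"] by (auto simp: mfv_fLab)
qed (auto simp: mfv_fLab)

lemma mfv_fSym: "mfv (fSym b l e x) \<subseteq> {l, e}"
proof (cases x)
  case (Inr j)
  let ?c = "Suc (l + e)" and ?k = "Suc (Suc (l + e))"
  show ?thesis using mfv_fFst[of "\<not> b" l e ?c] mfv_fSuc[of ?k ?c] mfv_fGrp[of b l ?k]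
      mfv_fSeq[of l ?k "replicate j None"]
    by (auto simp: Inr fSym_def Let_def)
qed (simp add: fSym_def)

lemma mfv_fPat: "mfv (fPat b l e \<gamma>) \<subseteq> {l, e}"
proof (induction b l e \<gamma> rule: fPat.induct)
  case (2 b l e x)
  then show ?case using mfv_fCut[of b l e "Suc (l + e)"] mfv_fSym[of b l e x] by auto
next
  case (3 b l e x x' \<gamma>)
  let ?c = "Suc (l + e)" and ?k = "Suc (Suc (l + e))"
  show ?case using 3 mfv_fFst[of b l e ?c] mfv_fSuc[of ?k ?c] mfv_fSym[of b l ?k x] by auto
qed simp

lemma mfv_fNode: "mfv (fNode b p i l e) \<subseteq> {p, i, l, e}"
  by (auto simp: fNode_def mfv_fOp mfv_fLe Let_def)

text \<open>Variable 0 is the position right after the gap and 1 the one before it; 2 and 3 are the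
  ends of the node of this gap. If the gap is the first cut, the first child occupies 2 to 1 and the
  remaining children 0 to 3.\<close>

definition fPiece :: "bool \<Rightarrow> 'a list \<Rightarrow> ('a + nat) list \<Rightarrow> 'a mso" where
  "fPiece b u \<gamma> = MEx1 1 (MEx1 2 (MEx1 3 (MAnd (fSuc 1 0) (MAnd (fOp b 1 0) (MAnd (fNode b 1 0 2 3)
     (MAnd (fFst b 2 3 0) (MAnd (fGrp (\<not> b) 2 1) (MAnd (fSeq 2 1 (map Some u)) (fPat b 0 3 \<gamma>)))))))))"

definition fOther :: "bool \<Rightarrow> 'a mso" where
  "fOther b = MEx1 1 (MEx1 2 (MEx1 3 (MAnd (fSuc 1 0) (MAnd (fOp b 1 0) (MAnd (fNode b 1 0 2 3)
     (MOr (MNeg (fFst b 2 3 0)) (fGrp b 2 3)))))))"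

text \<open>The positions that contribute the factor 1: the first position, gaps that do not end a
  first child, and gaps of leaf groups. For prefixes of length at least 2 this excludes
  \<open>fPiece\<close>, so the two parts of \<open>wGap\<close> can be added.\<close>

definition fOne :: "'a mso" where
  "fOne = MOr (MAll1 1 (MNeg (fSuc 1 0))) (MOr (fOther True) (fOther False))"

text \<open>Exchanging circ and bullet would give a second text for each derivation. The argument
  \<open>False\<close> stands for an imaginary parent and forces a circ-node at the root.\<close>

definition fRoot :: "nat \<Rightarrow> 'a mso" where
  "fRoot j = MEx1 0 (MEx1 1 (MAnd (MAll1 2 (MAnd (fLe 0 2) (fLe 2 1))) (fSym False 0 1 (Inr j))))"

definition fWord :: "'a list \<Rightarrow> 'a mso" where
  "fWord w = MEx1 0 (MEx1 1 (MAnd (MAll1 2 (MAnd (fLe 0 2) (fLe 2 1)))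
     (MAnd (fGrp True 0 1) (fSeq 0 1 (map Some w)))))"

lemma pure_sentences [simp]: "pure (fPiece b u \<gamma>)" "pure fOne" "pure (fRoot j)" "pure (fWord w)"
  by (simp_all add: fPiece_def fOther_def fOne_def fRoot_def fWord_def)

lemma mfv_fPiece: "mfv (fPiece b u \<gamma>) \<subseteq> {0}"
  using mfv_fSuc[of 1 0] mfv_fNode[of b 1 0 2 3] mfv_fFst[of b 2 3 0] mfv_fGrp[of "\<not> b" 2 1]
    mfv_fSeq[of 2 1 "map Some u"] mfv_fPat[of b 0 3 \<gamma>]
  unfolding fPiece_def by (simp add: mfv_fOp subset_iff) blast

lemma mfv_fOne: "mfv fOne \<subseteq> {0}"
proof -
  have "mfv (fOther b :: 'a mso) \<subseteq> {0}" for b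
    using mfv_fSuc[of 1 0] mfv_fNode[of b 1 0 2 3] mfv_fFst[of b 2 3 0] mfv_fGrp[of b 2 3]
    unfolding fOther_def by (simp add: mfv_fOp subset_iff) blast
  then show ?thesis using mfv_fSuc[of 1 0] by (auto simp: fOne_def)
qed

lemma mfv_fRoot: "mfv (fRoot j) = {}"
  using mfv_fSym[of False 0 1 "Inr j"] by (auto simp: fRoot_def mfv_fLe)

lemma mfv_fWord: "mfv (fWord w) = {}"
  using mfv_fGrp[of True 0 1] mfv_fSeq[of 0 1 "map Some w"] by (auto simp: fWord_def mfv_fLe)

section \<open>Meaning of the formulas in canonical terms\<close>

lemma nodep_nd:
  assumes s: "canon s" and i: "0 < i" "i < len s" and node_at: "node_at s i = (n, T)" and le: "l < len s" "e < len s"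
  shows "nodep (text_of s) (lca_op s (i - 1) i) (i - 1) i l e \<longleftrightarrow> l = n \<and> Suc e = n + len T"
proof -
  let ?b = "lca_op s (i - 1) i"
  have T: "n + len T \<le> len s" "n < i" "i < n + len T"
    using nd_node[OF s i] node_at by (auto simp: embeds_def)
  have "(\<forall>y<len s. op_at (text_of s) (\<not> ?b) y (i - 1) \<and> op_at (text_of s) (\<not> ?b) y i \<longrightarrow> op_at (text_of s) (\<not> ?b) y z) \<longleftrightarrow>
      n \<le> z \<and> z < n + len T" if z: "z < len s" for z
  proof -
    have "op_at (text_of s) (\<not> ?b) y (i - 1) \<and> op_at (text_of s) (\<not> ?b) y i \<longleftrightarrow> separates s i y"
      "op_at (text_of s) (\<not> ?b) y z \<longleftrightarrow> y \<noteq> z \<and> lca_op s y z = (\<not> ?b)" if "y < len s" for y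
      using that i z by (auto simp: dd_so separates_def)
    then show ?thesis using nd_interval[OF s i z] node_at by (auto simp: separates_def)
  qed
  then have "nodep (text_of s) ?b (i - 1) i l e \<longleftrightarrow>
     l \<le> e \<and> (\<forall>z<len s. (n \<le> z \<and> z < n + len T) \<longleftrightarrow> l \<le> z \<and> z \<le> e)"
    by (simp add: nodep_def)
  also have "\<dots> \<longleftrightarrow> l = n \<and> Suc e = n + len T"
  proof
    assume *: "l \<le> e \<and> (\<forall>z<len s. (n \<le> z \<and> z < n + len T) \<longleftrightarrow> l \<le> z \<and> z \<le> e)"
    then have q: "n \<le> z \<and> z < n + len T \<longleftrightarrow> l \<le> z \<and> z \<le> e" if "z < len s" for z using that by blast
    have "l \<le> e" using * by blast
    then have "n \<le> l" "e < n + len T" using q[of l] q[of e] le by auto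
    moreover have "l \<le> n" using q[of n] T by linarith
    moreover have "n + len T \<le> Suc e" using q[of "n + len T - 1"] T by linarith
    ultimately show "l = n \<and> Suc e = n + len T" by simp
  qed (use T in auto)
  finally show ?thesis .
qed

text \<open>The gap determines its predecessor, its operation and the interval of its node, so the
  three existential quantifiers amount to a substitution. The parameter \<open>Q\<close> serves both
  \<open>fPiece\<close> and \<open>fOther\<close>.\<close>

lemma sat_node:
  assumes s: "canon s" and i: "0 < i" "i < len s" and node_at: "node_at s i = (n, Nd b T1 T2)"
  shows "(\<exists>p<len s. \<exists>l<len s. \<exists>e<len s. sucp (text_of s) p i \<and> op_at (text_of s) b' p i \<and> nodep (text_of s) b' p i l e \<and> Q p l e) \<longleftrightarrow>
    b' = b \<and> Q (i - 1) n (n + len T1 + len T2 - 1)"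
proof -
  let ?e = "n + len T1 + len T2 - 1"
  have b: "lca_op s (i - 1) i = b" using nd_node[OF s i] node_at by simp
  have T: "n + len T1 + len T2 \<le> len s"
    using nd_node[OF s i] node_at by (auto simp: embeds_def)
  have e: "Suc ?e = n + len T1 + len T2" using len_pos(2)[of T1] by linarith
  have node: "nodep (text_of s) b (i - 1) i l e \<longleftrightarrow> l = n \<and> e = ?e" if "l < len s" "e < len s" for l e
    using nodep_nd[OF s i node_at that] b e by auto
  have op_at: "op_at (text_of s) b' (i - 1) i \<longleftrightarrow> b' = b" using i b by (auto simp: dd_so)
  have suc: "sucp (text_of s) p i \<longleftrightarrow> p = i - 1" for p using sucp_iff[of i "text_of s" p] i by auto
  have p: "i - 1 < len s" using i by linarith
  have "(\<exists>p<len s. \<exists>l<len s. \<exists>e<len s. sucp (text_of s) p i \<and> op_at (text_of s) b' p i \<and> nodep (text_of s) b' p i l e \<and> Q p l e)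
    \<longleftrightarrow> (\<exists>l<len s. \<exists>e<len s. b' = b \<and> nodep (text_of s) b (i - 1) i l e \<and> Q (i - 1) l e)"
    unfolding suc using op_at p by blast
  also have "\<dots> \<longleftrightarrow> b' = b \<and> Q (i - 1) n ?e"
  proof -
    have "n < len s" "?e < len s" using T e len_pos(2)[of T1] by linarith+
    then show ?thesis using node by blast
  qed
  finally show ?thesis .
qed

lemma sat_fPiece:
  assumes s: "canon s" and i: "0 < f 0" "f 0 < len s" and node_at: "node_at s (f 0) = (n, Nd b T1 T2)"
    and \<gamma>: "\<gamma> \<noteq> []" "\<And>j. Inr j \<in> set \<gamma> \<Longrightarrow> 2 \<le> j"
  shows "sat (text_of s) f (fPiece b' u \<gamma>) \<longleftrightarrow>
     b' = b \<and> f 0 = n + len T1 \<and> leaf_group (\<not> b) T1 \<and> u = word_of T1 \<and> \<gamma> = pattern b T2"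
proof -
  let ?i = "f 0" and ?e = "n + len T1 + len T2 - 1"
  let ?Q = "\<lambda>p l e. fstp (text_of s) b' l e ?i \<and> grpp (text_of s) (\<not> b') l p \<and> seqp (text_of s) l p (map Some u) \<and> pmp (text_of s) b' ?i e \<gamma>"
  have T: "embeds s n (Nd b T1 T2)" "canon (Nd b T1 T2)" using nd_node[OF s i] node_at by auto
  have e: "Suc ?e = n + len (Nd b T1 T2)" using len_pos(2)[of T1] unfolding word_of.simps length_append by linarith
  have "sat (text_of s) f (fPiece b' u \<gamma>) \<longleftrightarrow> b' = b \<and> ?Q (?i - 1) n ?e"
    unfolding sat_node[OF s i node_at, of b' ?Q, symmetric] by (simp add: fPiece_def)
  also have "\<dots> \<longleftrightarrow> b' = b \<and> ?i = n + len T1 \<and> ?Q (?i - 1) n ?e"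
    using fstp_emb[OF T e, of b ?i] by auto
  also have "\<dots> \<longleftrightarrow> b' = b \<and> ?i = n + len T1 \<and> leaf_group (\<not> b) T1 \<and> u = word_of T1 \<and> \<gamma> = pattern b T2"
  proof (rule conj_cong[OF refl], rule conj_cong[OF refl])
    assume b: "b' = b" and i': "?i = n + len T1"
    have p: "Suc (?i - 1) = n + len T1" using i i' by simp
    have sub: "embeds s n T1" "embeds s (n + len T1) T2" "canon T1" "canon T2" using emb_Nd[OF T(1)] T(2) by auto
    have e': "Suc ?e = n + len T1 + len T2" using e by simp
    show "?Q (?i - 1) n ?e \<longleftrightarrow> leaf_group (\<not> b) T1 \<and> u = word_of T1 \<and> \<gamma> = pattern b T2"
      using fstp_emb[OF T e, of b ?i] grpp_emb[OF sub(1,3) p, of "\<not> b"] seqp_word[OF sub(1) p, of u]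
        pmp_pat[OF sub(2,4) e' \<gamma>, of b] b i' by auto
  qed
  finally show ?thesis .
qed

lemma sat_fOne:
  assumes s: "canon s" and i: "0 < f 0" "f 0 < len s" and node_at: "node_at s (f 0) = (n, Nd b T1 T2)"
  shows "sat (text_of s) f fOne \<longleftrightarrow> f 0 \<noteq> n + len T1 \<or> leaf_group b (Nd b T1 T2)"
proof -
  let ?i = "f 0" and ?e = "n + len T1 + len T2 - 1"
  have T: "embeds s n (Nd b T1 T2)" "canon (Nd b T1 T2)" using nd_node[OF s i] node_at by auto
  have e: "Suc ?e = n + len (Nd b T1 T2)" using len_pos(2)[of T1] unfolding word_of.simps length_append by linarith
  have "sat (text_of s) f (fOther b') \<longleftrightarrow> b' = b \<and> (\<not> fstp (text_of s) b' n ?e ?i \<or> grpp (text_of s) b' n ?e)" for b'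
    unfolding sat_node[OF s i node_at, of b' "\<lambda>p l e. \<not> fstp (text_of s) b' l e ?i \<or> grpp (text_of s) b' l e", symmetric]
    by (simp add: fOther_def)
  moreover have "\<exists>p<len s. sucp (text_of s) p ?i"
    using i sucp_iff[of ?i "text_of s" "?i - 1"] by (intro exI[of _ "?i - 1"]) auto
  ultimately have "sat (text_of s) f fOne \<longleftrightarrow> \<not> fstp (text_of s) b n ?e ?i \<or> grpp (text_of s) b n ?e"
    by (cases b) (auto simp: fOne_def)
  then show ?thesis using fstp_emb[OF T e, of b ?i] grpp_emb[OF T e, of b] by auto
qed

lemma sat_fOne_0: "f 0 = 0 \<Longrightarrow> sat t f fOne"
  by (simp add: fOne_def sucp_def)

lemma ends:
  assumes "l < len s" "e < len s"
  shows "(\<forall>x<len s. l \<le> x \<and> x \<le> e) \<longleftrightarrow> l = 0 \<and> Suc e = 0 + len s"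
proof
  assume *: "\<forall>x<len s. l \<le> x \<and> x \<le> e"
  have "len s - 1 < len s" using len_pos(2)[of s] by linarith
  then have "len s - 1 \<le> e" using * by blast
  moreover have "l \<le> 0" using * len_pos(2)[of s] by blast
  ultimately show "l = 0 \<and> Suc e = 0 + len s" using assms by linarith
qed auto

lemma ex_ends:
  assumes e: "Suc e = 0 + len s"
  shows "(\<exists>l<len s. \<exists>e'<len s. (\<forall>x<len s. l \<le> x \<and> x \<le> e') \<and> Q l e') \<longleftrightarrow> Q 0 e"
proof
  assume "\<exists>l<len s. \<exists>e'<len s. (\<forall>x<len s. l \<le> x \<and> x \<le> e') \<and> Q l e'"
  then obtain l e' where *: "l < len s" "e' < len s" "\<forall>x<len s. l \<le> x \<and> x \<le> e'" "Q l e'" by blast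
  then have "l = 0" "Suc e' = 0 + len s" using ends by blast+
  then have "e' = e" using e by linarith
  then show "Q 0 e" using \<open>l = 0\<close> *(4) by simp
next
  assume "Q 0 e"
  moreover have "0 < len s" "e < len s" using e by simp_all
  moreover have "\<forall>x<len s. 0 \<le> x \<and> x \<le> e" using e by auto
  ultimately show "\<exists>l<len s. \<exists>e'<len s. (\<forall>x<len s. l \<le> x \<and> x \<le> e') \<and> Q l e'" by blast
qed

lemma ex_last: obtains e where "Suc e = 0 + len s"
  using len_pos(2)[of s] by (metis Suc_pred' add_0)

lemma sat_fRoot:
  assumes "canon s" "2 \<le> j" shows "sat (text_of s) f (fRoot j) \<longleftrightarrow> root_op s = Some True \<and> head s = j"
proof -
  obtain e where e: "Suc e = 0 + len s" by (rule ex_last)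
  have "sat (text_of s) f (fRoot j) \<longleftrightarrow> symbp (text_of s) False 0 e (Inr j)"
    unfolding ex_ends[OF e, of "\<lambda>l e. symbp (text_of s) False l e (Inr j)", symmetric] by (simp add: fRoot_def)
  then show ?thesis using symbp_Inr[OF emb_refl assms(1) e assms(2), of False] by simp
qed

lemma sat_fWord:
  assumes "canon s" shows "sat (text_of s) f (fWord w) \<longleftrightarrow> leaf_group True s \<and> w = word_of s"
proof -
  obtain e where e: "Suc e = 0 + len s" by (rule ex_last)
  have "sat (text_of s) f (fWord w) \<longleftrightarrow> grpp (text_of s) True 0 e \<and> seqp (text_of s) 0 e (map Some w)"
    unfolding ex_ends[OF e, of "\<lambda>l e. grpp (text_of s) True l e \<and> seqp (text_of s) l e (map Some w)", symmetric]
    by (simp add: fWord_def)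
  then show ?thesis using grpp_emb[OF emb_refl assms(1) e, of True] seqp_word[OF emb_refl e, of w] by simp
qed

primrec wsum :: "('a, 'k::zero) wf list \<Rightarrow> ('a, 'k) wf" where
  "wsum [] = WConst 0"
| "wsum (\<phi> # \<phi>s) = WOr \<phi> (wsum \<phi>s)"

lemma wsem_wsum: "wsem t f g (wsum \<phi>s) = sum_list (map (wsem t f g) \<phi>s)"
  by (induction \<phi>s) auto

lemma wsum_aUMSO: "(\<And>\<phi>. \<phi> \<in> set \<phi>s \<Longrightarrow> \<phi> \<in> aUMSO) \<Longrightarrow> wsum \<phi>s \<in> aUMSO"
  by (induction \<phi>s) (auto intro: aUMSO.intros)

lemma wsum_ok: "(\<And>\<phi>. \<phi> \<in> set \<phi>s \<Longrightarrow> noSO \<phi> \<and> allok \<phi> \<and> wfv1 \<phi> \<subseteq> V \<and> wfv2 \<phi> = {}) \<Longrightarrow>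
   noSO (wsum \<phi>s) \<and> allok (wsum \<phi>s) \<and> wfv1 (wsum \<phi>s) \<subseteq> V \<and> wfv2 (wsum \<phi>s) = {}"
  by (induction \<phi>s) auto

section \<open>The weight of a derivation as a product over positions\<close>

context pieces
begin

text \<open>Each unranked node is charged at the gap that ends its first child, and at no other gap;
  this turns a product over nodes into a product over positions.\<close>

definition gap_value :: "'a trm \<Rightarrow> nat \<Rightarrow> 'k" where
  "gap_value s i = (case snd (node_at s i) of Lf _ \<Rightarrow> 1
     | Nd b T1 T2 \<Rightarrow> if i = fst (node_at s i) + len T1 then node_value b T1 T2 else 1)"

text \<open>If \<open>s\<close> has the operation \<open>c\<close> of its parent, it is merely a
  final segment of the children of a larger node. Its root gaps belong to that node and must not be
  charged here, just as \<open>node_product\<close> omits the value in this case.\<close>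

lemma prod_gwt:
  "canon s \<Longrightarrow> (\<Prod>i\<in>{0<..<len s}. if node_at s i = (0, s) \<and> root_op s = Some c then 1 else gap_value s i) = node_product c s"
proof (induction s arbitrary: c)
  case (Lf a)
  have "{0<..<Suc 0} = {}" by auto
  then show ?case by simp
next
  case (Nd b s t)
  let ?s = "Nd b s t" and ?n = "len s"
  let ?g = "\<lambda>i. if node_at ?s i = (0, ?s) \<and> root_op ?s = Some c then 1 else gap_value ?s i"
  have c: "canon s" "canon t" "root_op s \<noteq> Some b" using Nd.prems by auto
  have pos: "0 < len s" "0 < len t" by simp_all
  have "{0<..<len ?s} = {0<..<?n} \<union> ({?n} \<union> {?n<..<?n + len t})" using pos by auto
  then have "(\<Prod>i\<in>{0<..<len ?s}. ?g i) = (\<Prod>i\<in>{0<..<?n} \<union> ({?n} \<union> {?n<..<?n + len t}). ?g i)" by simp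
  also have "\<dots> = (\<Prod>i\<in>{0<..<?n}. ?g i) * (\<Prod>i\<in>{?n} \<union> {?n<..<?n + len t}. ?g i)"
    by (rule prod.union_disjoint) auto
  also have "(\<Prod>i\<in>{?n} \<union> {?n<..<?n + len t}. ?g i) = ?g ?n * (\<Prod>i\<in>{?n<..<?n + len t}. ?g i)"
    by (subst prod.union_disjoint) auto
  also have "?g ?n = (if c = b then 1 else node_value b s t)" by (auto simp: gap_value_def)
  also have "(\<Prod>i\<in>{0<..<?n}. ?g i) = node_product b s"
  proof -
    have "?g i = (if node_at s i = (0, s) \<and> root_op s = Some b then 1 else gap_value s i)" if i: "i \<in> {0<..<?n}" for i
    proof -
      have "size (snd (node_at s i)) < size ?s" using nd_node[of s i] c i by simp
      then have "node_at ?s i \<noteq> (0, ?s)" using i by auto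
      moreover have "gap_value ?s i = gap_value s i"
      proof -
        have "node_at ?s i = node_at s i" using i by simp
        then show ?thesis by (simp only: gap_value_def)
      qed
      ultimately show ?thesis using c(3) by (simp del: node_at.simps)
    qed
    note g = this
    show ?thesis unfolding Nd.IH(1)[OF c(1), of b, symmetric] by (rule prod.cong[OF refl g])
  qed
  also have "(\<Prod>i\<in>{?n<..<?n + len t}. ?g i) = (\<Prod>i\<in>{0<..<len t}. ?g (i + ?n))"
    by (rule prod.reindex_bij_witness[of _ "\<lambda>i. i + ?n" "\<lambda>i. i - ?n"]) auto
  also have "\<dots> = node_product b t"
  proof -
    have "?g (i + ?n) = (if node_at t i = (0, t) \<and> root_op t = Some b then 1 else gap_value t i)" if i: "i \<in> {0<..<len t}" for i
    proof (cases "node_at t i = (0, t) \<and> root_op t = Some b")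
      case True
      then have "node_at ?s (i + ?n) = (0, ?s)" using i by simp
      then show ?thesis using True i by (auto simp: gap_value_def)
    next
      case False
      then have node_at: "node_at ?s (i + ?n) = (?n + fst (node_at t i), snd (node_at t i))" using i by auto
      then have "node_at ?s (i + ?n) \<noteq> (0, ?s)" using pos by simp
      then show ?thesis using False unfolding gap_value_def node_at by (auto split: trm.splits)
    qed
    note g = this
    show ?thesis unfolding Nd.IH(2)[OF c(2), of b, symmetric] by (rule prod.cong[OF refl g])
  qed
  finally show ?case by (simp add: mult.commute mult.left_commute)
qed

definition IX :: "(bool \<times> 'a list \<times> ('a + nat) list) set" where
  "IX = UNIV \<times> {u. length u \<in> J} \<times> \<Gamma>"

definition ixs :: "(bool \<times> 'a list \<times> ('a + nat) list) list" where
  "ixs = (SOME xs. set xs = IX \<and> distinct xs)"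

lemma ixs: "set ixs = IX \<and> distinct ixs"
proof -
  have "{u :: 'a list. length u \<in> J} = (\<Union>j\<in>J. {u. length u = j})" by auto
  moreover have "finite {u :: 'a list. length u = j}" for j
    using finite_lists_length_eq[of "UNIV :: 'a set" j] by simp
  ultimately have "finite IX" using finJ fin\<Gamma> by (simp add: IX_def)
  then show ?thesis unfolding ixs_def using someI_ex[OF finite_distinct_list] by blast
qed

definition wGap :: "('a, 'k) wf" where
  "wGap = WOr (tr True fOne)
     (wsum (map (\<lambda>(b, u, \<gamma>). WAnd (WConst (C (length u) u \<gamma>)) (tr True (fPiece b u \<gamma>))) ixs))"

lemma wGap_ok: "wGap \<in> aUMSO \<and> noSO wGap \<and> allok wGap \<and> wfv1 wGap \<subseteq> {0} \<and> wfv2 wGap = {}"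
proof -
  have 1: "noSO (tr True (fPiece b u \<gamma>) :: ('a, 'k) wf) \<and> allok (tr True (fPiece b u \<gamma>) :: ('a, 'k) wf) \<and>
     wfv1 (tr True (fPiece b u \<gamma>) :: ('a, 'k) wf) \<subseteq> {0} \<and> wfv2 (tr True (fPiece b u \<gamma>) :: ('a, 'k) wf) = {}"
    for b u and \<gamma> :: "('a + nat) list"
    using wfv_tr[OF pure_sentences(1), where 'd = 'k] mfv_fPiece by blast
  have 2: "noSO (tr True fOne :: ('a, 'k) wf) \<and> allok (tr True fOne :: ('a, 'k) wf) \<and>
     wfv1 (tr True fOne :: ('a, 'k) wf) \<subseteq> {0} \<and> wfv2 (tr True fOne :: ('a, 'k) wf) = {}"
    using wfv_tr[OF pure_sentences(2), where 'd = 'k] mfv_fOne by blast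
  let ?xs = "map (\<lambda>(b, u, \<gamma>). WAnd (WConst (C (length u) u \<gamma>)) (tr True (fPiece b u \<gamma>))) ixs"
  have "noSO (wsum ?xs) \<and> allok (wsum ?xs) \<and> wfv1 (wsum ?xs) \<subseteq> {0} \<and> wfv2 (wsum ?xs) = {}"
  proof (rule wsum_ok)
    fix \<phi> assume "\<phi> \<in> set ?xs"
    then obtain b u \<gamma> where "\<phi> = WAnd (WConst (C (length u) u \<gamma>)) (tr True (fPiece b u \<gamma>))" by auto
    then show "noSO \<phi> \<and> allok \<phi> \<and> wfv1 \<phi> \<subseteq> {0} \<and> wfv2 \<phi> = {}" using 1[of b u \<gamma>] by simp
  qed
  moreover have "wsum ?xs \<in> aUMSO" by (rule wsum_aUMSO) (auto intro: aUMSO.intros)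
  ultimately show ?thesis using 2 by (auto simp: wGap_def intro: aUMSO.intros)
qed

text \<open>Operation, prefix and tail at a gap are determined by the term, so at most one index in
  \<open>IX\<close> contributes to the sum. The outer product also runs over position 0, which
  precedes every gap and gets the value 1 from \<open>fOne\<close>.\<close>

lemma wsem_wGap:
  assumes s: "canon s" and i: "f 0 < len s"
  shows "wsem (text_of s) f empty_sets wGap = (if f 0 = 0 then 1 else gap_value s (f 0))"
proof -
  let ?i = "f 0"
  have fo: "fo fOne" "fo (fPiece b u \<gamma>)" for b u and \<gamma> :: "('a + nat) list" by (simp_all add: pure_fo)
  have "wsem (text_of s) f empty_sets wGap = (if sat (text_of s) f fOne then 1 else 0) +
     sum_list (map (\<lambda>(b, u, \<gamma>). C (length u) u \<gamma> * (if sat (text_of s) f (fPiece b u \<gamma>) then 1 else 0)) ixs)"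
    by (simp add: wGap_def wsem_wsum wsem_tr[OF fo(1)] wsem_tr[OF fo(2)] o_def split_def)
  also have "sum_list (map (\<lambda>(b, u, \<gamma>). C (length u) u \<gamma> * (if sat (text_of s) f (fPiece b u \<gamma>) then 1 else 0)) ixs) =
     (\<Sum>(b, u, \<gamma>)\<in>IX. C (length u) u \<gamma> * (if sat (text_of s) f (fPiece b u \<gamma>) then 1 else 0))"
    using ixs sum_list_distinct_conv_sum_set[of ixs] by simp
  finally have eq: "wsem (text_of s) f empty_sets wGap = (if sat (text_of s) f fOne then 1 else 0) +
     (\<Sum>(b, u, \<gamma>)\<in>IX. C (length u) u \<gamma> * (if sat (text_of s) f (fPiece b u \<gamma>) then 1 else 0))" .
  show ?thesis
  proof (cases "?i = 0")
    case True
    have "\<not> sat (text_of s) f (fPiece b u \<gamma>)" for b u and \<gamma> :: "('a + nat) list"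
      using True by (simp add: fPiece_def sucp_def)
    then show ?thesis using True sat_fOne_0[of f "text_of s"] by (simp add: eq split_def)
  next
    case False
    then have i': "0 < ?i" by simp
    obtain n b T1 T2 where node_at: "node_at s ?i = (n, Nd b T1 T2)"
      using nd_node[OF s i' i] by (cases "node_at s ?i"; cases "snd (node_at s ?i)") auto
    have \<Gamma>2: "2 \<le> j" if "Inr j \<in> set \<gamma>" "\<gamma> \<in> \<Gamma>" for j \<gamma> using that \<Gamma>_J J2 by blast
    define K where "K \<longleftrightarrow> ?i = n + len T1 \<and> leaf_group (\<not> b) T1"
    have "(\<Sum>(b', u, \<gamma>)\<in>IX. C (length u) u \<gamma> * (if sat (text_of s) f (fPiece b' u \<gamma>) then 1 else 0)) =
      (\<Sum>x\<in>IX. if x = (b, word_of T1, pattern b T2) then (if K then C (len T1) (word_of T1) (pattern b T2) else 0) else 0)"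
    proof (rule sum.cong[OF refl])
      fix x assume "x \<in> IX"
      then obtain b' u \<gamma> where x: "x = (b', u, \<gamma>)" "\<gamma> \<in> \<Gamma>" by (auto simp: IX_def)
      have "sat (text_of s) f (fPiece b' u \<gamma>) \<longleftrightarrow> b' = b \<and> ?i = n + len T1 \<and> leaf_group (\<not> b) T1 \<and> u = word_of T1 \<and> \<gamma> = pattern b T2"
        using x \<Gamma>_ne \<Gamma>2 by (intro sat_fPiece[where f = f, OF s i' i node_at]) auto
      then show "(case x of (b', u, \<gamma>) \<Rightarrow> C (length u) u \<gamma> * (if sat (text_of s) f (fPiece b' u \<gamma>) then 1 else 0)) =
        (if x = (b, word_of T1, pattern b T2) then (if K then C (len T1) (word_of T1) (pattern b T2) else 0) else 0)"
        by (auto simp: x K_def)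
    qed
    also have "\<dots> = (if K \<and> (b, word_of T1, pattern b T2) \<in> IX then C (len T1) (word_of T1) (pattern b T2) else 0)"
    proof -
      have "finite IX" using ixs List.finite_set[of ixs] by simp
      then show ?thesis by (simp only: sum.delta) auto
    qed
    also have "\<dots> = (if K \<and> len T1 \<in> J then C (len T1) (word_of T1) (pattern b T2) else 0)"
      using C_out by (auto simp: IX_def)
    finally have sum: "(\<Sum>(b', u, \<gamma>)\<in>IX. C (length u) u \<gamma> * (if sat (text_of s) f (fPiece b' u \<gamma>) then 1 else 0)) = \<dots>" .
    \<comment> \<open>A length in \<open>J\<close> is at least 2, so the first child is then not a
      leaf, as \<open>node_value\<close> demands; for any other length the coefficient is 0 by
      \<open>C_J\<close>.\<close>
    have J: "len T1 \<in> J \<Longrightarrow> root_op T1 \<noteq> None" using J2[of "len T1"] by (cases T1) auto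
    have "gap_value s ?i = (if ?i = n + len T1 then node_value b T1 T2 else 1)" by (simp add: gap_value_def node_at)
    also have "\<dots> = (if ?i \<noteq> n + len T1 \<or> leaf_group b (Nd b T1 T2) then 1 else 0) +
        (if K \<and> len T1 \<in> J then C (len T1) (word_of T1) (pattern b T2) else 0)"
      using J C_J[of "len T1"] by (auto simp: node_value_def K_def simp del: One_nat_def)
    finally show ?thesis using False unfolding eq sum sat_fOne[where f = f, OF s i' i node_at] by simp
  qed
qed

definition wLong :: "nat \<Rightarrow> ('a, 'k) wf" where
  "wLong j = WAnd (tr True (fRoot j)) (WAll1 0 wGap)"

lemma wsem_wLong:
  assumes s: "canon s" and j: "j \<in> J"
  shows "wsem (text_of s) f empty_sets (wLong j) = (if root_op s = Some True \<and> head s = j then node_product False s else 0)"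
proof -
  have fo: "fo (fRoot j)" by (simp add: pure_fo)
  have "(\<Prod>i<len s. wsem (text_of s) (f(0 := i)) empty_sets wGap) = (\<Prod>i<len s. if i = 0 then 1 else gap_value s i)"
    by (intro prod.cong refl) (simp add: wsem_wGap[OF s])
  also have "\<dots> = (\<Prod>i\<in>{0<..<len s}. if i = 0 then 1 else gap_value s i)"
    by (rule prod.mono_neutral_right) auto
  also have "\<dots> = (\<Prod>i\<in>{0<..<len s}. gap_value s i)" by (intro prod.cong) auto
  finally have *: "wsem (text_of s) f empty_sets (wLong j) = (if root_op s = Some True \<and> head s = j then 1 else 0) * (\<Prod>i\<in>{0<..<len s}. gap_value s i)"
    by (simp add: wLong_def wsem_tr[OF fo] sat_fRoot[OF s J2[OF j]])
  moreover have "(\<Prod>i\<in>{0<..<len s}. gap_value s i) = node_product False s" if "root_op s = Some True"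
    using prod_gwt[OF s, of False] that by simp
  ultimately show ?thesis by auto
qed

lemma tdo_sem_wLong: "j \<in> J \<Longrightarrow> tdo_sem (wLong j) w = coef (L j) w"
proof -
  assume j: "j \<in> J"
  have "tdo_sem (wLong j) w = (\<Sum>s\<in>canon_terms w. if root_op s = Some True \<and> head s = j then node_product False s else 0)"
    unfolding tdo_sem_CT by (intro sum.cong refl) (auto simp: canon_terms_def wsem_wLong j)
  also have "\<dots> = (\<Sum>s\<in>{s \<in> canon_terms w. root_op s = Some True \<and> head s = j}. node_product False s)"
    by (rule sum.inter_filter[symmetric]) simp
  also have "\<dots> = coef (L j) w" using sum_pw[of w, THEN conjunct1, rule_format, OF j, of True] by simp
  finally show ?thesis .
qed

lemma wLong_ok: "noSO (wLong j) \<and> allok (wLong j) \<and> wfv1 (wLong j) = {} \<and> wfv2 (wLong j) = {}"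
proof -
  have "noSO (tr True (fRoot j) :: ('a, 'k) wf) \<and> allok (tr True (fRoot j) :: ('a, 'k) wf) \<and>
     wfv1 (tr True (fRoot j) :: ('a, 'k) wf) = {} \<and> wfv2 (tr True (fRoot j) :: ('a, 'k) wf) = {}"
    using wfv_tr[OF pure_sentences(3), where 'd = 'k] mfv_fRoot by blast
  then show ?thesis using wGap_ok by (auto simp: wLong_def)
qed

end

lemma tdo_sem_WOr: "tdo_sem (WOr a b) w = tdo_sem a w + tdo_sem b w"
  by (simp add: tdo_sem_CT sum.distrib)

text \<open>\<open>fWord w\<close> holds in a single text only, the one over \<open>w\<close> in
  which both orders coincide, so the sum over second orders produces \<open>S w\<close>
  once.\<close>

lemma short_words:
  fixes S :: "'a::finite list \<Rightarrow> 'k::comm_semiring_1"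
  assumes "finite W"
  shows "\<exists>\<phi> :: ('a, 'k) wf. \<phi> \<in> sRFO \<and> sentence \<phi> \<and>
    (\<forall>w. tdo_sem \<phi> w = (if w \<noteq> [] \<and> w \<in> W then S w else 0))"
proof -
  obtain ws where ws: "set ws = W" "distinct ws" using finite_distinct_list[OF assms] by blast
  let ?xs = "map (\<lambda>w. WAnd (WConst (S w)) (tr True (fWord w))) ws :: ('a, 'k) wf list"
  have "noSO (tr True (fWord w) :: ('a, 'k) wf) \<and> allok (tr True (fWord w) :: ('a, 'k) wf) \<and>
     wfv1 (tr True (fWord w) :: ('a, 'k) wf) = {} \<and> wfv2 (tr True (fWord w) :: ('a, 'k) wf) = {}" for w
    using wfv_tr[OF pure_sentences(4), where 'd = 'k] mfv_fWord by blast
  then have ok: "noSO (wsum ?xs) \<and> allok (wsum ?xs) \<and> wfv1 (wsum ?xs) \<subseteq> {} \<and> wfv2 (wsum ?xs) = {}"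
    by (intro wsum_ok) auto
  have "tdo_sem (wsum ?xs) w = (if w \<noteq> [] \<and> w \<in> W then S w else 0)" for w
  proof (cases "w = []")
    case False
    have fo: "fo (fWord v)" for v :: "'a list" by (simp add: pure_fo)
    obtain g where g: "leaf_group True g" "canon g" "word_of g = w" using grp_exists[OF False] by blast
    have "tdo_sem (wsum ?xs) w = (\<Sum>s\<in>canon_terms w. if s = g then (if w \<in> W then S w else 0) else 0)"
      unfolding tdo_sem_CT
    proof (intro sum.cong refl)
      fix s assume "s \<in> canon_terms w"
      then have s: "canon s" "word_of s = w" by (auto simp: canon_terms_def)
      have sg: "leaf_group True s \<longleftrightarrow> s = g" using grp_unique[of True s g] g s by auto
      have "wsem (text_of s) (\<lambda>_. 0) empty_sets (wsum ?xs) = sum_list (map (\<lambda>v. S v * (if sat (text_of s) (\<lambda>_. 0) (fWord v) then 1 else 0)) ws)"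
        by (simp add: wsem_wsum wsem_tr[OF fo] o_def)
      also have "\<dots> = (\<Sum>v\<in>W. S v * (if sat (text_of s) (\<lambda>_. 0) (fWord v) then 1 else 0))"
        using ws by (simp add: sum_list_distinct_conv_sum_set)
      also have "\<dots> = (\<Sum>v\<in>W. if v = w then (if s = g then S w else 0) else 0)"
        by (intro sum.cong refl) (auto simp: sat_fWord[OF s(1)] s(2) sg)
      also have "\<dots> = (if s = g then (if w \<in> W then S w else 0) else 0)"
        using assms by (subst sum.delta) auto
      finally show "wsem (text_of s) (\<lambda>_. 0) empty_sets (wsum ?xs) = \<dots>" .
    qed
    also have "\<dots> = (if w \<in> W then S w else 0)"
      using g by (subst sum.delta) (auto simp: canon_terms_def[of w] intro: finite_CT[unfolded canon_terms_def])
    finally show ?thesis using False by simp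
  qed (simp add: tdo_sem_def)
  then show ?thesis using ok by (intro exI[of _ "wsum ?xs"]) (simp add: sRFO_def sentence_def)
qed

theorem algebraic_tdo_sem:
  fixes S :: "'a::finite list \<Rightarrow> 'k::comm_semiring_1"
  assumes "algebraic S"
  shows "\<exists>\<phi> :: ('a, 'k) wf. \<phi> \<in> sRFO \<and> sentence \<phi> \<and> tdo_sem \<phi> = S"
proof -
  obtain J C \<Gamma> M j0 and L :: "nat \<Rightarrow> ('a, 'k) ser" where *: "pieces J L C \<Gamma>" "j0 \<in> J"
    "\<And>w. coef (L j0) w = (if M \<le> length w then S w else 0)"
    using algebraic_pieces[OF assms] by blast
  interpret pieces J L C \<Gamma> by (rule *(1))
  have "finite {w :: 'a list. length w < M}"
    using finite_lists_length_le[of "UNIV :: 'a set" M] by (rule finite_subset[rotated]) auto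
  from short_words[OF this, of S] obtain \<psi> :: "('a, 'k) wf" where \<psi>: "\<psi> \<in> sRFO" "sentence \<psi>"
    "\<And>w. tdo_sem \<psi> w = (if w \<noteq> [] \<and> length w < M then S w else 0)" by auto
  \<comment> \<open>Quasiregularity matches the value 0 that \<open>tdo_sem\<close> takes at the
    empty word by definition.\<close>
  have "S [] = 0" using assms by (auto simp: algebraic_def)
  then have "tdo_sem (WOr (wLong j0) \<psi>) w = S w" for w
    by (auto simp: tdo_sem_WOr tdo_sem_wLong[OF *(2)] *(3) \<psi>(3))
  then have "tdo_sem (WOr (wLong j0) \<psi>) = S" by blast
  then show ?thesis using wLong_ok[of j0] \<psi>(1,2)
    by (intro exI[of _ "WOr (wLong j0) \<psi>"]) (auto simp: sRFO_def sentence_def)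
qed

theorem theorem6p12:
  fixes S :: "'a::finite list \<Rightarrow> 'k::comm_semiring_1"
  shows "(algebraic S \<longleftrightarrow> (\<exists>R :: 'a ttext \<Rightarrow> 'k. regular_text_series R \<and> proj R = S))
       \<and> (algebraic S \<longleftrightarrow> (\<exists>\<phi> :: ('a, 'k) wf. \<phi> \<in> sRFO \<and> sentence \<phi> \<and> tdo_sem \<phi> = S))"
  using algebraic_projection[of S] projection_algebraic algebraic_tdo_sem[of S] tdo_sem_algebraic by blast

end
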